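(* Let $T$ satisfy one of the conditions $\mathbf{Z}$ or $\mathbf{A_\gamma}$, let $\mathcal{H}(T,A,\mu)$ be a Cauchy--de Branges space with spectral data $(T,\mu)$, and let $\mathcal{H}_1,\mathcal{H}_2$ be two nearly invariant subspaces of $\mathcal{H}(T,A,\mu)$ without common zeros. Then either $\mathcal{H}_1\subset\mathcal{H}_2$ or $\mathcal{H}_2\subset\mathcal{H}_1$.
   Context: $T=\{t_n\}\subset\mathbb{C}$ consists of pairwise distinct points, $0\notin T$, $|t_n|\to\infty$, and $T$ has finite convergence exponent ($\sum_n|t_n|^{-K}<\infty$ for some $K>0$; the convergence exponent is the infimum of such $K$). Condition $\mathbf{Z}$: $T$ is the zero set of some entire function of zero exponential type. Condition $\mathbf{A_\gamma}$ ($0<\gamma<1$): $T$ lies in some angle $\{\theta_0<\arg z<\theta_0+\pi\gamma\}$ and the convergence exponent of $T$ is strictly less than $\gamma^{-1}$. Cauchy--de Branges space: let $A$ be an entire function with simple zeros whose zero set is exactly $T$, taken to be a canonical product over $T$ (so its order equals the convergence exponent of $T$), and let $\mu_n>0$ with $\sum_n\frac{\mu_n}{|t_n|^2+1}<\infty$. Then $$\mathcal{H}(T,A,\mu)=\Big\{f(z)=A(z)\sum_n\frac{a_n\mu_n^{1/2}}{z-t_n}:\ a=\{a_n\}\in\ell^2\Big\},\qquad \|f\|=\|a\|_{\ell^2},$$ a Hilbert space of entire functions. A closed subspace $\mathcal{H}_0$ of $\mathcal{H}(T,A,\mu)$ is nearly invariant if there is $w_0\in\mathbb{C}$ such that $f(z)/(z-w_0)\in\mathcal{H}_0$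 whenever $f\in\mathcal{H}_0$ and $f(w_0)=0$. It has no common zeros if $\mathcal{Z}(\mathcal{H}_0):=\{w\in\mathbb{C}: f(w)=0\ \forall f\in\mathcal{H}_0\}$ is empty. *)

theory Defs
  imports "HOL-Analysis.Analysis"
begin

definition conv_exponent :: "(nat \<Rightarrow> complex) \<Rightarrow> real" where
  "conv_exponent t = Inf {K. K > 0 \<and> summable (\<lambda>n. norm (t n) powr (- K))}"

definition admissible_set :: "(nat \<Rightarrow> complex) \<Rightarrow> bool" where
  "admissible_set t \<longleftrightarrow> inj t \<and> (\<forall>n. t n \<noteq> 0)
     \<and> filterlim (\<lambda>n. norm (t n)) at_top sequentially
     \<and> (\<exists>K>0. summable (\<lambda>n. norm (t n) powr (- K)))"

definition condZ :: "(nat \<Rightarrow> complex) \<Rightarrow> bool" where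
  "condZ t \<longleftrightarrow> (\<exists>F. F holomorphic_on UNIV \<and> {z. F z = 0} = range t
      \<and> (\<forall>\<epsilon>>0. \<exists>C. \<forall>z. norm (F z) \<le> C * exp (\<epsilon> * norm z)))"

definition condA :: "real \<Rightarrow> (nat \<Rightarrow> complex) \<Rightarrow> bool" where
  "condA \<gamma> t \<longleftrightarrow> 0 < \<gamma> \<and> \<gamma> < 1
     \<and> (\<exists>\<theta>0. \<forall>n. \<exists>\<theta>. \<theta>0 < \<theta> \<and> \<theta> < \<theta>0 + pi * \<gamma> \<and> t n = complex_of_real (norm (t n)) * cis \<theta>)
     \<and> conv_exponent t < 1 / \<gamma>"

definition weierstrass_factor :: "nat \<Rightarrow> complex \<Rightarrow> complex" where
  "weierstrass_factor p u = (1 - u) * exp (\<Sum>k=1..p. u ^ k / of_nat k)"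

definition genus :: "(nat \<Rightarrow> complex) \<Rightarrow> nat" where
  "genus t = (LEAST p. summable (\<lambda>n. 1 / norm (t n) ^ (p + 1)))"

definition canonical_product :: "(nat \<Rightarrow> complex) \<Rightarrow> (complex \<Rightarrow> complex) \<Rightarrow> bool" where
  "canonical_product t A \<longleftrightarrow>
     (\<forall>z. (\<lambda>N. \<Prod>n<N. weierstrass_factor (genus t) (z / t n)) \<longlonglongrightarrow> A z)"

text \<open>The kernel A(z)/(z - t_n), extended continuously by A'(t_n) at z = t_n.\<close>
definition cdb_kernel :: "(nat \<Rightarrow> complex) \<Rightarrow> (complex \<Rightarrow> complex) \<Rightarrow> nat \<Rightarrow> complex \<Rightarrow> complex" where
  "cdb_kernel t A n z = (if z = t n then deriv A z else A z / (z - t n))"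

definition l2seq :: "(nat \<Rightarrow> complex) \<Rightarrow> bool" where
  "l2seq a \<longleftrightarrow> summable (\<lambda>n. (norm (a n))\<^sup>2)"

text \<open>f is represented by the coefficient sequence a (with a in l^2):
  f(z) = A(z) sum_n a_n mu_n^{1/2} / (z - t_n).\<close>
definition cdb_repr :: "(nat \<Rightarrow> complex) \<Rightarrow> (complex \<Rightarrow> complex) \<Rightarrow> (nat \<Rightarrow> real)
    \<Rightarrow> (nat \<Rightarrow> complex) \<Rightarrow> (complex \<Rightarrow> complex) \<Rightarrow> bool" where
  "cdb_repr t A \<mu> a f \<longleftrightarrow> l2seq a \<and>
     (\<forall>z. f z = (\<Sum>n. a n * complex_of_real (sqrt (\<mu> n)) * cdb_kernel t A n z))"

definition cdb_space :: "(nat \<Rightarrow> complex) \<Rightarrow> (complex \<Rightarrow> complex) \<Rightarrow> (nat \<Rightarrow> real)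
    \<Rightarrow> (complex \<Rightarrow> complex) set" where
  "cdb_space t A \<mu> = {f. \<exists>a. cdb_repr t A \<mu> a f}"

text \<open>Closed (complex-)linear subspace with respect to the norm ||f|| = ||a||_{l^2}.\<close>
definition cdb_closed_subspace :: "(nat \<Rightarrow> complex) \<Rightarrow> (complex \<Rightarrow> complex) \<Rightarrow> (nat \<Rightarrow> real)
    \<Rightarrow> (complex \<Rightarrow> complex) set \<Rightarrow> bool" where
  "cdb_closed_subspace t A \<mu> H0 \<longleftrightarrow>
     H0 \<subseteq> cdb_space t A \<mu>
     \<and> (\<lambda>z. 0) \<in> H0
     \<and> (\<forall>f\<in>H0. \<forall>g\<in>H0. (\<lambda>z. f z + g z) \<in> H0)
     \<and> (\<forall>c::complex. \<forall>f\<in>H0. (\<lambda>z. c * f z) \<in> H0)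
     \<and> (\<forall>F a b g. (\<forall>k. F k \<in> H0 \<and> cdb_repr t A \<mu> (a k) (F k)) \<and> cdb_repr t A \<mu> b g
          \<and> (\<lambda>k. sqrt (\<Sum>n. (norm (a k n - b n))\<^sup>2)) \<longlonglongrightarrow> 0 \<longrightarrow> g \<in> H0)"

definition nearly_invariant :: "(nat \<Rightarrow> complex) \<Rightarrow> (complex \<Rightarrow> complex) \<Rightarrow> (nat \<Rightarrow> real)
    \<Rightarrow> (complex \<Rightarrow> complex) set \<Rightarrow> bool" where
  "nearly_invariant t A \<mu> H0 \<longleftrightarrow> cdb_closed_subspace t A \<mu> H0 \<and>
     (\<exists>w0. \<forall>f\<in>H0. f w0 = 0 \<longrightarrow>
        (\<lambda>z. if z = w0 then deriv f w0 else f z / (z - w0)) \<in> H0)"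

definition no_common_zeros :: "(complex \<Rightarrow> complex) set \<Rightarrow> bool" where
  "no_common_zeros H0 \<longleftrightarrow> {w. \<forall>f\<in>H0. f w = 0} = {}"

end

theory Submission
  imports Defs "HOL-Complex_Analysis.Complex_Analysis"
begin

text \<open>If neither subspace contains the other, pick \<open>F \<in> H1 - H2\<close> and \<open>G \<in> H2 - H1\<close>, together with functionals
  \<open>b\<close>, \<open>c\<close> annihilating \<open>H1\<close>, \<open>H2\<close> with \<open>\<langle>G, b\<rangle> \<noteq> 0\<close> and \<open>\<langle>F, c\<rangle> \<noteq> 0\<close>. With the Cauchy transforms
  \<open>b\<^sub>F(w) = \<Sum>\<^sub>n (coef F)\<^sub>n b\<^sub>n / (w - t\<^sub>n)\<close>, near invariance of \<open>H1\<close> and the absence of common zeros make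
  \<open>f1 = b\<^sub>G - (G / F) b\<^sub>F\<close> an entire function, and likewise \<open>f2 = c\<^sub>F - (F / G) c\<^sub>G\<close> for \<open>H2\<close>.

  Each is a quotient of entire functions whose size is controlled; conditions \<open>Z\<close> and \<open>A\<^sub>\<gamma>\<close> force both to be of zero
  exponential type. Since one of \<open>G / F\<close> and \<open>F / G\<close> has modulus at most one at every point, \<open>min(|f1|, |f2|)\<close> is
  polynomially bounded off a set of radii of finite logarithmic measure and \<open>O(1 / r)\<close> on a sequence of circles.
  A Friedland--Hayman type monotonicity argument in logarithmic coordinates shows that two nonconstant entire functions of zero
  exponential type cannot be large on disjoint sets only, so one of \<open>f1\<close>, \<open>f2\<close> vanishes identically. If \<open>f1 = 0\<close>, then
  \<open>|F / G| = |b\<^sub>F / b\<^sub>G|\<close> is bounded on the good circles (where \<open>w b\<^sub>F \<rightarrow> 0\<close>, while \<open>w b\<^sub>G\<close> stays away from \<open>0\<close>), so that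
  \<open>w f2(w) \<rightarrow> \<langle>F, c\<rangle> \<noteq> 0\<close> there; no entire function behaves in this way.\<close>

section \<open>Square-summable sequences\<close>

text \<open>Zero type is the exact borderline: \<open>exp z\<close> and \<open>exp (- z)\<close> are
  nonconstant, of finite exponential type, and the smaller of their moduli never exceeds 1. Disjoint
  supports force the product of two circular means to grow like \<open>e^(4t)\<close>, where t = ln
  r, while zero type makes each of them \<open>o(e^(2t))\<close>. The obstacle is that f1 is known
  only as a quotient whose denominator may be small anywhere. Its bounds rest on Harnack's
  inequality, applied once the zeros of the denominator are removed. The quotient does not change if
  \<open>A\<close> is replaced by another entire function vanishing at the nodes; under
  \<open>condZ\<close> the zero-type function of the hypothesis takes this role. Under
  \<open>condA\<close> all Cauchy transforms are bounded off a slightly larger angle, and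
  Phragmen-Lindelof covers that angle. A polynomial bound off the exceptional radii suffices because
  powers of z can be divided out. What survives is only that one of f1, f2 vanishes or stays away
  from 0 near infinity; the circles with bound O(1/r) then decide.\<close>

lemma norm_mult_le_squares:
  fixes x y :: complex
  shows "norm (x * y) \<le> (norm x)\<^sup>2 + (norm y)\<^sup>2"
proof -
  have "0 \<le> norm x * norm y" by simp
  thus ?thesis using sum_squares_bound[of "norm x" "norm y"] unfolding norm_mult by linarith
qed

lemma l2seq_mult_summable:
  assumes "l2seq a" "l2seq b"
  shows "summable (\<lambda>n. norm (a n * b n))"
proof (rule summable_comparison_test')
  show "summable (\<lambda>n. (norm (a n))\<^sup>2 + (norm (b n))\<^sup>2)"
    using assms by (auto simp: l2seq_def intro: summable_add)
qed (use norm_mult_le_squares in auto)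

lemma l2seq_cmult: "l2seq a \<Longrightarrow> l2seq (\<lambda>n. c * a n)"
  by (simp add: l2seq_def norm_mult power_mult_distrib summable_mult)

lemma l2seq_add:
  assumes "l2seq a" "l2seq b"
  shows "l2seq (\<lambda>n. a n + b n)"
  unfolding l2seq_def
proof (rule summable_comparison_test')
  show "summable (\<lambda>n. 2 * (norm (a n))\<^sup>2 + 2 * (norm (b n))\<^sup>2)"
    using assms by (auto simp: l2seq_def intro!: summable_add summable_mult)
  show "norm ((norm (a n + b n))\<^sup>2) \<le> 2 * (norm (a n))\<^sup>2 + 2 * (norm (b n))\<^sup>2" for n
  proof -
    have "(norm (a n + b n))\<^sup>2 \<le> (norm (a n) + norm (b n))\<^sup>2"
      by (intro power_mono norm_triangle_ineq) auto
    also have "\<dots> \<le> 2 * (norm (a n))\<^sup>2 + 2 * (norm (b n))\<^sup>2"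
      using sum_squares_bound[of "norm (a n)" "norm (b n)"] by (simp add: power2_sum)
    finally show ?thesis by simp
  qed
qed

lemma l2seq_diff: "l2seq a \<Longrightarrow> l2seq b \<Longrightarrow> l2seq (\<lambda>n. a n - b n)"
  using l2seq_add[of a "\<lambda>n. (-1) * b n"] l2seq_cmult[of b "-1"] by simp

lemma l2seq_cnj: "l2seq a \<Longrightarrow> l2seq (\<lambda>n. cnj (a n))"
  by (simp add: l2seq_def)

definition l2sq :: "(nat \<Rightarrow> complex) \<Rightarrow> real" where "l2sq a = (\<Sum>n. (norm (a n))\<^sup>2)"

lemma l2sq_nonneg: "l2seq a \<Longrightarrow> l2sq a \<ge> 0"
  by (simp add: l2sq_def l2seq_def suminf_nonneg)

lemma l2_parallelogram:
  assumes "l2seq a" "l2seq b"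
  shows "l2sq (\<lambda>n. a n + b n) + l2sq (\<lambda>n. a n - b n) = 2 * l2sq a + 2 * l2sq b"
proof -
  have "l2sq (\<lambda>n. a n + b n) + l2sq (\<lambda>n. a n - b n) = (\<Sum>n. (norm (a n + b n))\<^sup>2 + (norm (a n - b n))\<^sup>2)"
    unfolding l2sq_def using l2seq_add[OF assms] l2seq_diff[OF assms] by (intro suminf_add) (auto simp: l2seq_def)
  also have "(\<lambda>n. (norm (a n + b n))\<^sup>2 + (norm (a n - b n))\<^sup>2) = (\<lambda>n. 2 * (norm (a n))\<^sup>2 + 2 * (norm (b n))\<^sup>2)"
    unfolding cmod_power2 by (simp add: fun_eq_iff power2_eq_square algebra_simps)
  also have "(\<Sum>n. 2 * (norm (a n))\<^sup>2 + 2 * (norm (b n))\<^sup>2) = 2 * l2sq a + 2 * l2sq b"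
    unfolding l2sq_def using assms
    by (subst suminf_add[symmetric]) (auto simp: l2seq_def suminf_mult intro!: summable_mult)
  finally show ?thesis .
qed

text \<open>Fatou's lemma for series. It serves twice below: as completeness of the sequence space
  and as lower semicontinuity of the distance along a minimizing sequence.\<close>

lemma l2_pointwise_limit:
  assumes x: "\<And>k. l2seq (x k)" and lim: "\<And>n. (\<lambda>k. x k n) \<longlonglongrightarrow> y n" and le: "eventually (\<lambda>k. l2sq (x k) \<le> B k) sequentially" and B: "B \<longlonglongrightarrow> b"
  shows "l2seq y" "l2sq y \<le> b"
proof -
  have part: "(\<Sum>n<N. (norm (y n))\<^sup>2) \<le> b" for N
  proof (rule tendsto_le[OF _ B])
    show "(\<lambda>k. \<Sum>n<N. (norm (x k n))\<^sup>2) \<longlonglongrightarrow> (\<Sum>n<N. (norm (y n))\<^sup>2)"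
      by (intro tendsto_intros lim)
    show "\<forall>\<^sub>F k in sequentially. (\<Sum>n<N. (norm (x k n))\<^sup>2) \<le> B k"
      using le
    proof eventually_elim
      case (elim k)
      have "(\<Sum>n<N. (norm (x k n))\<^sup>2) \<le> l2sq (x k)"
        unfolding l2sq_def using x[of k] by (intro sum_le_suminf) (auto simp: l2seq_def)
      with elim show ?case by simp
    qed
  qed simp
  show s: "l2seq y" unfolding l2seq_def
    by (rule summableI_nonneg_bounded[OF _ part]) auto
  show "l2sq y \<le> b" unfolding l2sq_def
    by (rule suminf_le_const[OF _ part]) (use s in \<open>simp add: l2seq_def\<close>)
qed

lemma l2sq_diff_expand:
  assumes b: "l2seq b" and m: "l2seq m"
  shows "l2sq (\<lambda>n. b n - z * m n) = l2sq b - 2 * Re (z * (\<Sum>n. m n * cnj (b n))) + (norm z)\<^sup>2 * l2sq m"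
proof -
  have s: "summable (\<lambda>n. m n * cnj (b n))"
    using l2seq_mult_summable[OF m l2seq_cnj[OF b]] by (rule summable_norm_cancel)
  have "(\<lambda>n. (norm (b n))\<^sup>2 - 2 * Re (z * (m n * cnj (b n))) + (norm z)\<^sup>2 * (norm (m n))\<^sup>2) sums
     (l2sq b - 2 * Re (z * (\<Sum>n. m n * cnj (b n))) + (norm z)\<^sup>2 * l2sq m)"
    unfolding l2sq_def using b m s
    by (intro sums_add sums_diff sums_mult sums_Re summable_sums) (auto simp: l2seq_def)
  moreover have "(norm (b n - z * m n))\<^sup>2 = (norm (b n))\<^sup>2 - 2 * Re (z * (m n * cnj (b n))) + (norm z)\<^sup>2 * (norm (m n))\<^sup>2" for n
    unfolding cmod_power2 by (simp add: power2_eq_square algebra_simps)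
  ultimately show ?thesis unfolding l2sq_def[of "\<lambda>n. b n - z * m n"] by (simp add: sums_iff)
qed

text \<open>Projection theorem: the parallelogram law makes a minimizing sequence for the distance
  from \<open>g\<close> to \<open>M\<close> Cauchy, and the residual at the nearest point is
  orthogonal to \<open>M\<close>. The pairing is bilinear, so the annihilator returned is the
  conjugate of the residual.\<close>

theorem l2_separation:
  fixes M :: "(nat \<Rightarrow> complex) set"
  assumes M: "\<And>m. m \<in> M \<Longrightarrow> l2seq m" and M0: "(\<lambda>n. 0) \<in> M"
    and Madd: "\<And>a b. a \<in> M \<Longrightarrow> b \<in> M \<Longrightarrow> (\<lambda>n. a n + b n) \<in> M"
    and Mcm: "\<And>a c. a \<in> M \<Longrightarrow> (\<lambda>n. c * a n) \<in> M"
    and closed: "\<And>x y. (\<And>k. x k \<in> M) \<Longrightarrow> l2seq y \<Longrightarrow> (\<lambda>k. l2sq (\<lambda>n. x k n - y n)) \<longlonglongrightarrow> 0 \<Longrightarrow> y \<in> M"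
    and g: "l2seq g" "g \<notin> M"
  obtains b where "l2seq b" "\<And>m. m \<in> M \<Longrightarrow> (\<Sum>n. m n * b n) = 0" "(\<Sum>n. g n * b n) \<noteq> 0"
proof -
  define D where "D = (\<lambda>m. l2sq (\<lambda>n. g n - m n)) ` M"
  define d where "d = Inf D"
  have bdd: "bdd_below D" unfolding D_def by (intro bdd_belowI2[of _ 0] l2sq_nonneg l2seq_diff g M)
  have D0: "D \<noteq> {}" using M0 by (auto simp: D_def)
  have d_le: "d \<le> l2sq (\<lambda>n. g n - m n)" if "m \<in> M" for m
    unfolding d_def using bdd that by (intro cInf_lower) (auto simp: D_def)
  have "\<exists>m\<in>M. l2sq (\<lambda>n. g n - m n) < d + 1 / real (Suc k)" for k
    using cInf_lessD[OF D0, of "d + 1 / real (Suc k)"] by (auto simp: d_def D_def)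
  then obtain m where m: "\<And>k. m k \<in> M" "\<And>k. l2sq (\<lambda>n. g n - m k n) < d + 1 / real (Suc k)" by metis
  have gm: "l2seq (\<lambda>n. g n - m k n)" for k by (intro l2seq_diff g M m)
  have mm: "l2seq (\<lambda>n. m k n - m l n)" for k l by (intro l2seq_diff M m)
  have cauchy: "l2sq (\<lambda>n. m k n - m l n) \<le> 2 / real (Suc k) + 2 / real (Suc l)" for k l
  proof -
    have "l2sq (\<lambda>n. (g n - m l n) + (g n - m k n)) + l2sq (\<lambda>n. (g n - m l n) - (g n - m k n)) =
      2 * l2sq (\<lambda>n. g n - m l n) + 2 * l2sq (\<lambda>n. g n - m k n)"
      by (rule l2_parallelogram[OF gm gm])
    moreover have "(\<lambda>n. (g n - m l n) - (g n - m k n)) = (\<lambda>n. m k n - m l n)" by simp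
    moreover have "4 * d \<le> l2sq (\<lambda>n. (g n - m l n) + (g n - m k n))"
    proof -
      have "(\<lambda>n. 1 / 2 * (m l n + m k n)) \<in> M" by (intro Mcm Madd m)
      from d_le[OF this] have "4 * d \<le> 4 * l2sq (\<lambda>n. g n - 1 / 2 * (m l n + m k n))" by simp
      also have "\<dots> = (\<Sum>n. 4 * (norm (g n - 1 / 2 * (m l n + m k n)))\<^sup>2)"
        unfolding l2sq_def using l2seq_diff[OF g(1) M[OF \<open>(\<lambda>n. 1 / 2 * (m l n + m k n)) \<in> M\<close>]]
        by (intro suminf_mult[symmetric]) (simp add: l2seq_def)
      also have "(\<lambda>n. 4 * (norm (g n - 1 / 2 * (m l n + m k n)))\<^sup>2) = (\<lambda>n. (norm ((g n - m l n) + (g n - m k n)))\<^sup>2)"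
      proof
        fix n
        have "(g n - m l n) + (g n - m k n) = 2 * (g n - 1 / 2 * (m l n + m k n))" by (simp add: algebra_simps)
        thus "4 * (norm (g n - 1 / 2 * (m l n + m k n)))\<^sup>2 = (norm ((g n - m l n) + (g n - m k n)))\<^sup>2"
          by (simp only: norm_mult power_mult_distrib) simp
      qed
      finally show ?thesis by (simp add: l2sq_def)
    qed
    ultimately show ?thesis using m(2)[of k] m(2)[of l] by simp
  qed
  have "\<exists>c. (\<lambda>k. m k n) \<longlonglongrightarrow> c" for n
  proof -
    have "Cauchy (\<lambda>k. m k n)"
    proof (rule metric_CauchyI)
      fix e :: real assume e: "e > 0"
      obtain K where K: "4 / e\<^sup>2 < real (Suc K)" using reals_Archimedean2 by (metis less_trans of_nat_less_iff lessI)
      have "dist (m k n) (m l n) < e" if "k \<ge> K" "l \<ge> K" for k l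
      proof -
        have "(norm (m k n - m l n))\<^sup>2 \<le> l2sq (\<lambda>n. m k n - m l n)"
          unfolding l2sq_def using mm[of k l] sum_le_suminf[of "\<lambda>n. (norm (m k n - m l n))\<^sup>2" "{n}"]
          by (simp add: l2seq_def)
        also have "\<dots> \<le> 2 / real (Suc k) + 2 / real (Suc l)" by (rule cauchy)
        also have "\<dots> \<le> 2 / real (Suc K) + 2 / real (Suc K)" using that by (intro add_mono divide_left_mono) auto
        also have "\<dots> = 4 / real (Suc K)" by simp
        also have "\<dots> < e\<^sup>2" using K e by (simp add: field_simps del: of_nat_Suc)
        finally have "norm (m k n - m l n) < e" by (rule power_less_imp_less_base) (use e in simp)
        thus ?thesis by (simp add: dist_norm)
      qed
      thus "\<exists>K. \<forall>k\<ge>K. \<forall>l\<ge>K. dist (m k n) (m l n) < e" by blast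
    qed
    thus ?thesis by (meson Cauchy_convergent_iff convergent_def)
  qed
  then obtain c where c: "\<And>n. (\<lambda>k. m k n) \<longlonglongrightarrow> c n" by metis
  have lim1: "(\<lambda>k. a / real (Suc k)) \<longlonglongrightarrow> 0" for a :: real
    using tendsto_mult_right_zero[OF lim_1_over_n[THEN LIMSEQ_Suc], of a] by simp
  have mc: "l2seq (\<lambda>n. m k n - c n)" "l2sq (\<lambda>n. m k n - c n) \<le> 2 / real (Suc k) + 0" for k
  proof -
    note * = l2_pointwise_limit[where x = "\<lambda>l n. m k n - m l n" and y = "\<lambda>n. m k n - c n" and B = "\<lambda>l. 2 / real (Suc k) + 2 / real (Suc l)" and b = "2 / real (Suc k) + 0"]
    show "l2seq (\<lambda>n. m k n - c n)"
      by (rule *(1)) (intro mm tendsto_diff tendsto_const c always_eventually allI cauchy tendsto_add lim1)+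
    show "l2sq (\<lambda>n. m k n - c n) \<le> 2 / real (Suc k) + 0"
      by (rule *(2)) (intro mm tendsto_diff tendsto_const c always_eventually allI cauchy tendsto_add lim1)+
  qed
  have cl2: "l2seq c" using l2seq_diff[OF M[OF m(1)] mc(1), of 0 0] by simp
  have cM: "c \<in> M"
  proof (rule closed[OF m(1) cl2])
    show "(\<lambda>k. l2sq (\<lambda>n. m k n - c n)) \<longlonglongrightarrow> 0"
      by (rule tendsto_sandwich[OF _ _ tendsto_const lim1[of 2]])
         (use mc l2sq_nonneg in \<open>auto intro!: always_eventually simp del: of_nat_Suc\<close>)
  qed
  define b where "b = (\<lambda>n. g n - c n)"
  have bl2: "l2seq b" unfolding b_def by (intro l2seq_diff g cl2)
  have bd: "l2sq b \<le> d"
  proof (rule l2_pointwise_limit(2)[where x = "\<lambda>k n. g n - m k n" and B = "\<lambda>k. d + 1 / real (Suc k)"])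
    show "(\<lambda>k. d + 1 / real (Suc k)) \<longlonglongrightarrow> d" using tendsto_add[OF tendsto_const[of d] lim1[of 1]] by simp
  qed (use gm m(2) c in \<open>auto simp: b_def intro!: tendsto_intros always_eventually less_imp_le simp del: of_nat_Suc\<close>)
  have orth: "(\<Sum>n. a n * cnj (b n)) = 0" if a: "a \<in> M" for a
  proof (rule ccontr)
    define w where "w = (\<Sum>n. a n * cnj (b n))"
    assume "w \<noteq> 0"
    define q where "q = l2sq a"
    have q: "q \<ge> 0" unfolding q_def by (intro l2sq_nonneg M a)
    \<comment> \<open>If \<open>w\<close> were nonzero, moving the nearest point by
      \<open>z a\<close> would bring it closer to \<open>g\<close>. The optimal factor is
      \<open>cnj w / q\<close>; the denominator \<open>q + 1\<close> avoids the case
      \<open>q = 0\<close>.\<close>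
    define z where "z = of_real (1 / (q + 1)) * cnj w"
    have "(\<lambda>n. c n + z * a n) \<in> M" by (intro Madd Mcm cM a)
    from d_le[OF this] have "d \<le> l2sq (\<lambda>n. b n - z * a n)" by (simp add: b_def algebra_simps)
    also have "\<dots> = l2sq b - 2 * Re (z * w) + (norm z)\<^sup>2 * q"
      unfolding w_def q_def by (rule l2sq_diff_expand[OF bl2 M[OF a]])
    finally have "2 * Re (z * w) \<le> (norm z)\<^sup>2 * q" using bd by simp
    moreover have "Re (z * w) = (norm w)\<^sup>2 / (q + 1)"
      unfolding z_def cmod_power2 by (simp add: power2_eq_square add_divide_distrib algebra_simps)
    moreover have "(norm z)\<^sup>2 = (norm w)\<^sup>2 / (q + 1)\<^sup>2" using q by (simp add: z_def norm_mult norm_divide power_mult_distrib power_divide)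
    ultimately have "2 * ((norm w)\<^sup>2 / (q + 1)) \<le> (norm w)\<^sup>2 / (q + 1)\<^sup>2 * q" by simp
    hence "2 * (norm w)\<^sup>2 * (q + 1) \<le> (norm w)\<^sup>2 * q"
      using q by (simp add: power2_eq_square divide_simps split: if_splits)
    hence "(norm w)\<^sup>2 * (q + 2) \<le> 0" by (simp add: algebra_simps)
    thus False using q \<open>w \<noteq> 0\<close> by (smt (verit) mult_pos_pos zero_less_norm_iff zero_less_power)
  qed
  have "(\<Sum>n. g n * cnj (b n)) = (\<Sum>n. b n * cnj (b n)) + (\<Sum>n. c n * cnj (b n))"
    using l2seq_mult_summable[OF bl2 l2seq_cnj[OF bl2]] l2seq_mult_summable[OF cl2 l2seq_cnj[OF bl2]]
    by (subst suminf_add) (auto simp: b_def algebra_simps intro: summable_norm_cancel)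
  also have "(\<Sum>n. c n * cnj (b n)) = 0" by (rule orth[OF cM])
  finally have gb: "(\<Sum>n. g n * cnj (b n)) = (\<Sum>n. of_real ((norm (b n))\<^sup>2))" by (simp only: complex_norm_square add_0_right)
  have "(\<Sum>n. g n * cnj (b n)) \<noteq> 0"
  proof
    assume "(\<Sum>n. g n * cnj (b n)) = 0"
    hence "of_real (\<Sum>n. (norm (b n))\<^sup>2) = (0 :: complex)" using bl2 by (simp add: gb suminf_of_real l2seq_def)
    hence "(\<Sum>n. (norm (b n))\<^sup>2) = 0" by (simp only: of_real_eq_0_iff)
    hence "\<forall>n. (norm (b n))\<^sup>2 = 0" using bl2 by (subst (asm) suminf_eq_zero_iff) (auto simp: l2seq_def)
    hence "g = c" by (auto simp: b_def fun_eq_iff)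
    thus False using g(2) cM by simp
  qed
  thus ?thesis using orth l2seq_cnj[OF bl2] that by blast
qed

section \<open>Subharmonic functions with disjoint supports\<close>

lemma mult_cos_le_sin:
  fixes x :: real
  assumes "0 \<le> x" "x \<le> pi"
  shows "x * cos x \<le> sin x"
proof -
  have "sin 0 - 0 * cos 0 \<le> sin x - x * cos x"
  proof (rule DERIV_nonneg_imp_nondecreasing[OF assms(1)])
    fix y assume "0 \<le> y" "y \<le> x"
    thus "\<exists>d. ((\<lambda>x. sin x - x * cos x) has_real_derivative d) (at y) \<and> 0 \<le> d"
      using assms by (intro exI[of _ "y * sin y"]) (auto intro!: derivative_eq_intros mult_nonneg_nonneg sin_ge_zero)
  qed
  thus ?thesis by simp
qed

text \<open>Jacobi's trick: with \<open>k = pi / s b\<close>, the function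
  \<open>g = u^2 k cot (k s)\<close> has derivative
  \<open>u'^2 - k^2 u^2 - (u' - k u cot (k s))^2\<close> and vanishes at both ends; dropping the
  square gives the claim. Since \<open>s\<close> stands still off the support, the constant is that
  of a single interval of length \<open>s b\<close>, however many components the support
  has.\<close>

lemma wirtinger_support:
  fixes u u' :: "real \<Rightarrow> real" and a b :: real
  defines "s \<equiv> \<lambda>x. integral {a..x} (indicat_real {x. u x > 0})"
  assumes ab: "a < b"
    and du: "\<And>x. (u has_real_derivative u' x) (at x)"
    and cu': "continuous_on UNIV u'"
    and u0: "\<And>x. u x \<ge> 0" and ua: "u a = 0" and ub: "u b = 0"
    and \<theta>: "s b > 0"
  shows "(pi / s b)\<^sup>2 * integral {a..b} (\<lambda>x. (u x)\<^sup>2) \<le> integral {a..b} (\<lambda>x. (u' x)\<^sup>2)"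
proof -
  define k where "k = pi / s b"
  have k: "k > 0" and k\<theta>: "k * s b = pi" using \<theta> by (auto simp: k_def)
  have cu: "continuous_on S u" for S
    using du by (meson DERIV_continuous continuous_at_imp_continuous_on)
  have openU: "open {x. u x > 0}"
    using cu[of UNIV] by (simp add: open_Collect_less continuous_on_const)
  have ind: "indicat_real {x. u x > 0} integrable_on {c..d}" for c d
    by (simp add: integrable_on_indicator fmeasurable_Int_fmeasurable lmeasurable_open openU
         borel_open sets_completionI_sets inf_commute)
  have s_diff: "s y - s x = integral {x..y} (indicat_real {x. u x > 0})" if "a \<le> x" "x \<le> y" for x y
    using Henstock_Kurzweil_Integration.integral_combine[of a x y "indicat_real {x. u x > 0}"] that ind
    by (simp add: s_def)
  have u'0: "u' x = 0" if "u x = 0" for x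
    using DERIV_local_min[OF du, of 1] that u0 by auto
  obtain M where M: "M > 0" "\<And>x. x \<in> {a..b} \<Longrightarrow> \<bar>u' x\<bar> \<le> M"
  proof -
    have "bounded (u' ` {a..b})"
      using cu' by (intro compact_imp_bounded compact_continuous_image) (auto intro: continuous_on_subset)
    thus ?thesis using that by (auto simp: bounded_pos)
  qed
  \<comment> \<open>\<open>u'\<close> vanishes wherever \<open>u\<close> does, so \<open>u\<close>
    is Lipschitz with respect to \<open>s\<close>, which advances only on the support. Hence
    \<open>u\<close> is at most \<open>M\<close> times its \<open>s\<close>-distance to either
    endpoint.\<close>
  have u_lip: "\<bar>u y - u x\<bar> \<le> M * (s y - s x)" if "a \<le> x" "x \<le> y" "y \<le> b" for x y
  proof -
    have *: "(u' has_integral (u y - u x)) {x..y}"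
      using that du by (intro fundamental_theorem_of_calculus)
        (auto simp flip: has_real_derivative_iff_has_vector_derivative intro: DERIV_subset)
    have **: "((\<lambda>x. M * indicat_real {x. u x > 0} x) has_integral (M * (s y - s x))) {x..y}"
      using that by (intro has_integral_mult_right) (simp add: s_diff ind integrable_integral)
    have "norm (integral {x..y} u') \<le> integral {x..y} (\<lambda>x. M * indicat_real {x. u x > 0} x)"
    proof (rule integral_norm_bound_integral)
      fix z assume z: "z \<in> {x..y}"
      show "norm (u' z) \<le> M * indicat_real {x. u x > 0} z"
        using M(2)[of z] z that u'0[of z] u0[of z] by (auto simp: indicator_def)
    qed (use * ** in auto)
    thus ?thesis by (simp only: integral_unique[OF *] integral_unique[OF **] real_norm_def)
  qed
  have s_mono: "s x \<le> s y" if "a \<le> x" "x \<le> y" for x y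
    using s_diff[OF that] integral_nonneg[OF ind, of x y] by simp
  have sa: "s a = 0" by (simp add: s_def)
  have us: "u x \<le> M * s x" and us': "u x \<le> M * (s b - s x)"
    if "x \<in> {a..b}" for x
    using u_lip[of a x] u_lip[of x b] s_mono[of a x] s_mono[of x b] that ua ub u0[of x] sa by auto
  define g where "g = (\<lambda>x. (u x)\<^sup>2 * (k * cot (k * s x)))"
  have cot_le: "\<bar>cot x\<bar> \<le> 1 / x \<or> \<bar>cot x\<bar> \<le> 1 / (pi - x)" if x: "0 < x" "x < pi" for x :: real
  proof -
    have *: "\<bar>cot x\<bar> \<le> 1 / x" if "0 < x" "x \<le> pi / 2" for x :: real
    proof -
      have "cos x \<ge> 0" "sin x > 0" using that by (auto intro!: cos_ge_zero sin_gt_zero)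
      thus ?thesis using mult_cos_le_sin[of x] that by (simp add: cot_def field_simps)
    qed
    show ?thesis
    proof (cases "x \<le> pi / 2")
      case False
      have "cot (pi - x) = - cot x" by (simp add: cot_def)
      with *[of "pi - x"] False x show ?thesis by simp
    qed (use * x in auto)
  qed
  \<comment> \<open>The poles of \<open>cot\<close> at \<open>s = 0\<close> and
    \<open>s = s b\<close> are absorbed by the linear bounds \<open>us\<close> and
    \<open>us'\<close>.\<close>
  have gle: "\<bar>g x\<bar> \<le> M * u x" if x: "x \<in> {a..b}" for x
  proof (cases "u x = 0")
    case False
    with u0[of x] have ux: "u x > 0" by auto
    have sx: "s x > 0" "s b - s x > 0" using us[OF x] us'[OF x] ux M(1)
      by (smt (verit) mult_nonneg_nonpos)+
    have "k * s x > 0" "k * s x < pi" using sx k k\<theta> by (simp_all, smt (verit) mult_less_cancel_left_pos)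
    from cot_le[OF this] have "k * \<bar>cot (k * s x)\<bar> \<le> 1 / s x \<or> k * \<bar>cot (k * s x)\<bar> \<le> 1 / (s b - s x)"
    proof
      assume "\<bar>cot (k * s x)\<bar> \<le> 1 / (k * s x)"
      hence "k * \<bar>cot (k * s x)\<bar> \<le> k * (1 / (k * s x))" using k by (intro mult_left_mono) auto
      thus ?thesis using k by simp
    next
      assume "\<bar>cot (k * s x)\<bar> \<le> 1 / (pi - k * s x)"
      hence "k * \<bar>cot (k * s x)\<bar> \<le> k * (1 / (pi - k * s x))" using k by (intro mult_left_mono) auto
      also have "pi - k * s x = k * (s b - s x)" using k\<theta> by (simp add: algebra_simps)
      finally show ?thesis using k by simp
    qed
    hence "u x * (k * \<bar>cot (k * s x)\<bar>) \<le> M"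
    proof
      assume "k * \<bar>cot (k * s x)\<bar> \<le> 1 / s x"
      hence "u x * (k * \<bar>cot (k * s x)\<bar>) \<le> M * s x * (1 / s x)"
        using us[OF x] ux k by (intro mult_mono) (use M sx in auto)
      thus ?thesis using sx by simp
    next
      assume "k * \<bar>cot (k * s x)\<bar> \<le> 1 / (s b - s x)"
      hence "u x * (k * \<bar>cot (k * s x)\<bar>) \<le> M * (s b - s x) * (1 / (s b - s x))"
        using us'[OF x] ux k by (intro mult_mono) (use M sx in auto)
      thus ?thesis using sx by simp
    qed
    hence "u x * (u x * (k * \<bar>cot (k * s x)\<bar>)) \<le> u x * M" using ux by (intro mult_left_mono) auto
    thus ?thesis using k by (simp add: g_def abs_mult power2_eq_square mult_ac)
  qed (auto simp: g_def)
  define g' where "g' = (\<lambda>x. if u x = 0 then 0 else (u' x)\<^sup>2 - k\<^sup>2 * (u x)\<^sup>2 - (u' x - u x * (k * cot (k * s x)))\<^sup>2)"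
  \<comment> \<open>At a zero of \<open>u\<close> the formula for \<open>g\<close> need not be
    differentiable termwise, but by \<open>gle\<close> its difference quotient is dominated by
    \<open>M\<close> times that of \<open>u\<close>, whose limit is 0.\<close>
  have g_near0: "(g has_real_derivative 0) (at x)" if x: "x \<in> {a<..<b}" and ux: "u x = 0" for x
  proof -
    have "((\<lambda>h. (u (x + h) - u x) / h) \<longlongrightarrow> 0) (at 0)" using du[of x] u'0[OF ux] by (simp add: DERIV_def)
    hence l: "((\<lambda>h. M * \<bar>(u (x + h) - u x) / h\<bar>) \<longlongrightarrow> M * \<bar>0\<bar>) (at 0)"
      by (intro tendsto_intros)
    have "((\<lambda>h. (g (x + h) - g x) / h) \<longlongrightarrow> 0) (at 0)"
    proof (rule Lim_null_comparison)
      show "((\<lambda>h. M * \<bar>(u (x + h) - u x) / h\<bar>) \<longlongrightarrow> 0) (at 0)" using l by simp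
      have "eventually (\<lambda>h. x + h \<in> {a<..<b}) (at 0)"
        using x by (intro topological_tendstoD[where f = "\<lambda>h. x + h" and l = x]) (auto intro!: tendsto_eq_intros)
      thus "\<forall>\<^sub>F h in at 0. norm ((g (x + h) - g x) / h) \<le> M * \<bar>(u (x + h) - u x) / h\<bar>"
      proof eventually_elim
        case (elim h)
        have "g x = 0" using ux by (simp add: g_def)
        moreover have "\<bar>g (x + h)\<bar> \<le> M * u (x + h)" using elim by (intro gle) auto
        ultimately show ?case using ux u0[of "x + h"] M(1)
          by (simp add: abs_mult divide_right_mono)
      qed
    qed
    thus ?thesis by (simp add: DERIV_def)
  qed
  have g_pos: "(g has_real_derivative g' x) (at x)" if x: "x \<in> {a<..<b}" and ux: "u x \<noteq> 0" for x
  proof -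
    have ux: "u x > 0" using ux u0[of x] by auto
    have sx: "s x > 0" "s b - s x > 0" using us[of x] us'[of x] ux M(1) x
      by (smt (verit) mult_nonneg_nonpos greaterThanLessThan_iff atLeastAtMost_iff)+
    have "k * s x > 0" "k * s x < pi" using sx k k\<theta> by (simp_all, smt (verit) mult_less_cancel_left_pos)
    hence sn: "sin (k * s x) \<noteq> 0" using sin_gt_zero by fastforce
    have "((\<lambda>y. integral {a..y} (indicat_real {x. u x > 0})) has_vector_derivative (indicat_real {x. u x > 0} x)) (at x within ({a..b} - {}))"
    proof (rule integral_has_vector_derivative_continuous_at)
      have "\<forall>\<^sub>F y in nhds x. y \<in> {x. u x > 0}" using openU ux by (intro eventually_nhds_in_open) auto
      hence "((indicat_real {x. u x > 0}) \<longlongrightarrow> 1) (nhds x)"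
        by (intro tendsto_eventually) (auto elim!: eventually_mono)
      hence "isCont (indicat_real {x. u x > 0}) x" 
        unfolding isCont_def tendsto_at_iff_tendsto_nhds using ux by simp
      thus "continuous (at x within {a..b} - {}) (indicat_real {x. 0 < u x})"
        by (rule continuous_at_imp_continuous_within)
    qed (use x ind in auto)
    hence ds: "(s has_real_derivative 1) (at x)"
      using ux x at_within_interior[of x "{a..b}"] by (simp add: s_def has_real_derivative_iff_has_vector_derivative)
    have "(g has_real_derivative (2 * u x * u' x * (k * cot (k * s x)) + (u x)\<^sup>2 * (k * (- inverse ((sin (k * s x))\<^sup>2) * k)))) (at x)"
      unfolding g_def by (rule derivative_eq_intros DERIV_cot DERIV_chain2[where f = cot] du ds sn refl | simp)+
    moreover have "inverse ((sin (k * s x))\<^sup>2) = 1 + (cot (k * s x))\<^sup>2"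
      using sn sin_cos_squared_add[of "k * s x"] by (simp add: cot_def field_simps)
    ultimately show ?thesis using ux by (simp add: g'_def power2_eq_square algebra_simps)
  qed
  have "continuous_on {a..b} g"
    unfolding continuous_on_def
  proof
    fix x assume x: "x \<in> {a..b}"
    show "(g \<longlongrightarrow> g x) (at x within {a..b})"
    proof (cases "u x = 0")
      case False
      hence "x \<in> {a<..<b}" using x ua ub by (auto simp: less_le)
      thus ?thesis using g_pos[of x] False by (meson DERIV_isCont isCont_def tendsto_within_subset top_greatest)
    next
      case True
      have "((\<lambda>x. M * u x) \<longlongrightarrow> M * u x) (at x within {a..b})"
        using cu[of "{a..b}"] x by (intro tendsto_intros) (auto simp: continuous_on_def)
      hence "((\<lambda>x. M * u x) \<longlongrightarrow> 0) (at x within {a..b})" using True by simp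
      moreover have "\<forall>\<^sub>F y in at x within {a..b}. norm (g y) \<le> M * u y"
        using gle by (auto simp: eventually_at intro!: exI[of _ 1])
      ultimately have "(g \<longlongrightarrow> 0) (at x within {a..b})" using Lim_null_comparison[of g "\<lambda>x. M * u x"] by blast
      thus ?thesis using True by (simp add: g_def)
    qed
  qed
  hence "(g' has_integral (g b - g a)) {a..b}"
    using g_near0 g_pos ab by (intro fundamental_theorem_of_calculus_interior)
      (auto simp flip: has_real_derivative_iff_has_vector_derivative simp: g'_def)
  hence gi: "(g' has_integral 0) {a..b}" using ua ub by (simp add: g_def)
  have i1: "(\<lambda>x. (u' x)\<^sup>2) integrable_on {a..b}" "(\<lambda>x. (u x)\<^sup>2) integrable_on {a..b}"
    using cu cu' by (auto intro!: integrable_continuous_real continuous_intros intro: continuous_on_subset)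
  have "((\<lambda>x. (u' x)\<^sup>2 - k\<^sup>2 * (u x)\<^sup>2) has_integral (integral {a..b} (\<lambda>x. (u' x)\<^sup>2) - k\<^sup>2 * integral {a..b} (\<lambda>x. (u x)\<^sup>2))) {a..b}"
    using i1 by (intro has_integral_diff has_integral_mult_right) (auto simp: integrable_integral)
  from has_integral_le[OF gi this] show ?thesis
    using u'0 by (auto simp: g'_def k_def)
qed

section \<open>Square means of a subharmonic function on circles\<close>

lemma integral_periodic_shift:
  fixes p :: "real \<Rightarrow> real"
  assumes int: "\<And>a b. p integrable_on {a..b}" and per: "\<And>x. p (x + c) = p x" and a: "0 \<le> a" "a \<le> c"
  shows "integral {a..a + c} p = integral {0..c} p"
proof -
  have "integral {0..a} p = integral {0..a} (p \<circ> (+) c)"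
    using per by (intro arg_cong[where f = "integral {0..a}"]) (auto simp: o_def add.commute)
  also have "\<dots> = integral {c..a + c} p" by (simp add: integral_shift_Icc_real)
  finally have "integral {a..a + c} p = integral {a..c} p + integral {0..a} p"
    using Henstock_Kurzweil_Integration.integral_combine[of a c "a + c" p] int a by simp
  thus ?thesis
    using Henstock_Kurzweil_Integration.integral_combine[of 0 a c p] int a by simp
qed

text \<open>In the coordinates \<open>z = e\<^bsup>t + ih\<^esup>\<close> the Laplacian of \<open>u\<close> is a positive multiple of \<open>utt + uhh\<close>.\<close>

locale tract =
  fixes u ut uh utt uhh :: "real \<Rightarrow> real \<Rightarrow> real"
  assumes Dt: "\<And>t h. ((\<lambda>t. u t h) has_real_derivative ut t h) (at t)"
    and Dtt: "\<And>t h. ((\<lambda>t. ut t h) has_real_derivative utt t h) (at t)"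
    and Dh: "\<And>t h. (u t has_real_derivative uh t h) (at h)"
    and Dhh: "\<And>t h. (uh t has_real_derivative uhh t h) (at h)"
    and cont: "continuous_on UNIV (\<lambda>(t, h). u t h)" "continuous_on UNIV (\<lambda>(t, h). ut t h)"
      "continuous_on UNIV (\<lambda>(t, h). uh t h)" "continuous_on UNIV (\<lambda>(t, h). utt t h)"
      "continuous_on UNIV (\<lambda>(t, h). uhh t h)"
    and nonneg: "\<And>t h. u t h \<ge> 0"
    and subharmonic: "\<And>t h. utt t h + uhh t h \<ge> 0"
    and periodic: "\<And>t h. u t (h + 2 * pi) = u t h" "\<And>t h. uh t (h + 2 * pi) = uh t h"
    and vanish: "\<And>t h. t \<le> 0 \<Longrightarrow> u t h = 0"
begin

text \<open>\<open>J\<close> is half the derivative of the square mean \<open>I\<close>, and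
  \<open>K\<close> is the derivative of \<open>J\<close>; the argument concerns the logarithmic
  derivative \<open>K / J\<close>.\<close>

definition I where "I t = integral {0..2 * pi} (\<lambda>h. (u t h)\<^sup>2)"
definition J where "J t = integral {0..2 * pi} (\<lambda>h. u t h * ut t h)"
definition K where "K t = integral {0..2 * pi} (\<lambda>h. (ut t h)\<^sup>2 + u t h * utt t h)"

lemma cont_slice:
  "continuous_on S (u t)" "continuous_on S (ut t)" "continuous_on S (uh t)" "continuous_on S (utt t)" "continuous_on S (uhh t)"
  using cont[THEN continuous_on_compose2, of S "\<lambda>h. (t, h)"] by (simp_all add: continuous_on_Pair)

lemma cont_prod:
  "continuous_on S (\<lambda>p. u (fst p) (snd p))" "continuous_on S (\<lambda>p. ut (fst p) (snd p))"
  "continuous_on S (\<lambda>p. utt (fst p) (snd p))"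
  using cont by (auto simp: split_beta intro: continuous_on_subset)

lemma DERIV_I: "(I has_real_derivative 2 * J t) (at t)"
proof -
  have "((\<lambda>t. integral (cbox 0 (2 * pi)) (\<lambda>h. (u t h)\<^sup>2)) has_real_derivative
      integral (cbox 0 (2 * pi)) (\<lambda>h. 2 * (u t h * ut t h))) (at t within UNIV)"
  proof (rule leibniz_rule_field_derivative[where fx = "\<lambda>t h. 2 * (u t h * ut t h)" and U = UNIV])
    show "continuous_on (UNIV \<times> cbox 0 (2 * pi)) (\<lambda>(t, h). 2 * (u t h * ut t h))"
      unfolding split_beta by (intro continuous_intros cont_prod)
    show "(\<lambda>h. (u t h)\<^sup>2) integrable_on cbox 0 (2 * pi)" for t
      by (intro integrable_continuous continuous_intros cont_slice)
    show "((\<lambda>t. (u t h)\<^sup>2) has_real_derivative 2 * (u t h * ut t h)) (at t within UNIV)" for t h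
      by (auto intro!: derivative_eq_intros Dt)
  qed auto
  thus ?thesis by (simp add: I_def[abs_def] J_def)
qed

lemma DERIV_J: "(J has_real_derivative K t) (at t)"
proof -
  have "((\<lambda>t. integral (cbox 0 (2 * pi)) (\<lambda>h. u t h * ut t h)) has_real_derivative
      integral (cbox 0 (2 * pi)) (\<lambda>h. (ut t h)\<^sup>2 + u t h * utt t h)) (at t within UNIV)"
  proof (rule leibniz_rule_field_derivative[where fx = "\<lambda>t h. (ut t h)\<^sup>2 + u t h * utt t h" and U = UNIV])
    show "continuous_on (UNIV \<times> cbox 0 (2 * pi)) (\<lambda>(t, h). (ut t h)\<^sup>2 + u t h * utt t h)"
      unfolding split_beta by (intro continuous_intros cont_prod)
    show "(\<lambda>h. u t h * ut t h) integrable_on cbox 0 (2 * pi)" for t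
      by (intro integrable_continuous continuous_intros cont_slice)
    show "((\<lambda>t. u t h * ut t h) has_real_derivative (ut t h)\<^sup>2 + u t h * utt t h) (at t within UNIV)" for t h
      by (auto intro!: derivative_eq_intros Dt Dtt simp: power2_eq_square)
  qed auto
  thus ?thesis by (simp add: J_def[abs_def] K_def)
qed

text \<open>Integration by parts over a full period turns the integral of \<open>u uhh\<close> into
  minus that of \<open>uh^2\<close>; subharmonicity and \<open>u \<ge> 0\<close> allow
  \<open>u utt\<close> to be replaced by \<open>- u uhh\<close>.\<close>

lemma K_ge: "K t \<ge> integral {0..2 * pi} (\<lambda>h. (ut t h)\<^sup>2) + integral {0..2 * pi} (\<lambda>h. (uh t h)\<^sup>2)"
proof -
  have "((\<lambda>h. (uh t h)\<^sup>2 + u t h * uhh t h) has_integral (u t (2 * pi) * uh t (2 * pi) - u t 0 * uh t 0)) {0..2 * pi}"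
    by (intro fundamental_theorem_of_calculus)
       (auto simp flip: has_real_derivative_iff_has_vector_derivative simp: power2_eq_square intro!: derivative_eq_intros DERIV_subset[OF Dh] DERIV_subset[OF Dhh])
  hence *: "((\<lambda>h. (uh t h)\<^sup>2 + u t h * uhh t h) has_integral 0) {0..2 * pi}"
    using periodic[of t 0] by simp
  have i: "(\<lambda>h. (ut t h)\<^sup>2) integrable_on {0..2*pi}" "(\<lambda>h. (uh t h)\<^sup>2) integrable_on {0..2*pi}"
     "(\<lambda>h. (ut t h)\<^sup>2 + u t h * utt t h) integrable_on {0..2*pi}"
    by (intro integrable_continuous_real continuous_intros cont_slice)+
  have "((\<lambda>h. (ut t h)\<^sup>2 + (uh t h)\<^sup>2 - ((uh t h)\<^sup>2 + u t h * uhh t h)) has_integral 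
      (integral {0..2 * pi} (\<lambda>h. (ut t h)\<^sup>2) + integral {0..2 * pi} (\<lambda>h. (uh t h)\<^sup>2) - 0)) {0..2*pi}"
    by (intro has_integral_diff has_integral_add integrable_integral i *)
  moreover have "((\<lambda>h. (ut t h)\<^sup>2 + u t h * utt t h) has_integral K t) {0..2 * pi}"
    unfolding K_def by (intro integrable_integral i)
  moreover have "(ut t h)\<^sup>2 + (uh t h)\<^sup>2 - ((uh t h)\<^sup>2 + u t h * uhh t h) \<le> (ut t h)\<^sup>2 + u t h * utt t h" for h
    using mult_nonneg_nonneg[OF nonneg subharmonic, of t h t h] by (simp add: algebra_simps)
  ultimately show ?thesis using has_integral_le[of _ _ "{0..2 * pi}"] by (metis (no_types, lifting) diff_zero)
qed

lemma K_nonneg: "K t \<ge> 0"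
  by (rule order_trans[OF _ K_ge]) (auto intro!: add_nonneg_nonneg integral_nonneg integrable_continuous_real continuous_intros cont_slice)

lemma J_mono: "s \<le> t \<Longrightarrow> J s \<le> J t"
  by (erule DERIV_nonneg_imp_nondecreasing) (use DERIV_J K_nonneg in blast)

lemma I_nonneg: "I t \<ge> 0"
  unfolding I_def by (auto intro!: integral_nonneg integrable_continuous_real continuous_intros cont_slice)

lemma J_nonneg: "J t \<ge> 0"
proof (cases "t \<le> 0")
  case False
  have "J 0 = 0" by (simp add: J_def vanish)
  with J_mono[of 0 t] False show ?thesis by simp
qed (simp add: J_def vanish)

text \<open>Mean value theorem for \<open>I\<close> on an interval of length one, with
  \<open>J\<close> increasing and \<open>I\<close> nonnegative. It turns a pointwise bound on
  \<open>u\<close> into a bound on \<open>J\<close>.\<close>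

lemma J_le_I: "2 * J t \<le> I (t + 1)"
proof -
  obtain z where z: "t < z" "z < t + 1" "I (t + 1) - I t = (t + 1 - t) * (2 * J z)"
    using MVT2[of t "t + 1" I "\<lambda>t. 2 * J t"] DERIV_I by auto
  with J_mono[of t z] I_nonneg[of t] show ?thesis by simp
qed

lemma zero_if_J_zero:
  assumes "\<And>t. J t = 0" "h \<in> {0..2 * pi}"
  shows "u t h = 0"
proof -
  have "I t = I 0"
    using DERIV_isconst_all[of I t 0] DERIV_I assms(1) by (metis mult_zero_right)
  also have "I 0 = 0" by (simp add: I_def vanish)
  finally have I0: "((\<lambda>h. (u t h)\<^sup>2) has_integral 0) (cbox 0 (2 * pi))"
    unfolding I_def using integrable_continuous_real[of 0 "2 * pi" "\<lambda>h. (u t h)\<^sup>2"]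
    by (simp add: cont_slice continuous_intros integrable_integral has_integral_integral)
  have "(u t h)\<^sup>2 = 0"
    by (rule has_integral_0_cbox_imp_0[OF _ _ I0]) (use assms pi_gt_zero in \<open>auto simp del: pi_gt_zero intro!: continuous_intros cont_slice\<close>)
  thus ?thesis by simp
qed

definition supp where "supp t = integral {0..2 * pi} (indicat_real {h. u t h > 0})"

lemma open_supp: "open {h. u t h > 0}"
  using cont_slice(1)[of UNIV t] by (intro open_Collect_less) auto

lemma indicat_supp_integrable: "indicat_real {h. u t h > 0} integrable_on {a..b}"
  by (simp add: integrable_on_indicator fmeasurable_Int_fmeasurable lmeasurable_open open_supp
         borel_open sets_completionI_sets inf_commute)

text \<open>With the period starting at the zero \<open>h0\<close> and
  \<open>k = pi / supp t\<close>, Wirtinger bounds the integral of \<open>uh^2\<close> from below by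
  \<open>k^2 I\<close>. Then \<open>2 k u ut \<le> k^2 u^2 + ut^2\<close> and \<open>K_ge\<close>
  give \<open>2 k J \<le> K\<close>. A support of measure zero would make \<open>u t\<close> vanish
  by continuity, and \<open>J t\<close> with it.\<close>

lemma growth:
  assumes J: "J t > 0" and z: "h0 \<in> {0..2 * pi}" "u t h0 = 0"
  shows "supp t > 0" "2 * pi / supp t * J t \<le> K t"
proof -
  have int: "integral {h0..h0 + 2 * pi} p = integral {0..2 * pi} p"
    if "\<And>a b. p integrable_on {a..b}" "\<And>x. p (x + 2 * pi) = p x" for p :: "real \<Rightarrow> real"
    using integral_periodic_shift[of p "2 * pi" h0] that z by simp
  have s: "integral {h0..h0 + 2 * pi} (indicat_real {h. u t h > 0}) = supp t"
    unfolding supp_def by (rule int) (auto simp: indicat_supp_integrable indicator_def periodic)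
  have U: "integral {h0..h0 + 2 * pi} (\<lambda>h. (u t h)\<^sup>2) = I t"
    unfolding I_def by (rule int) (auto simp: periodic intro!: integrable_continuous_real continuous_intros cont_slice)
  have UH: "integral {h0..h0 + 2 * pi} (\<lambda>h. (uh t h)\<^sup>2) = integral {0..2 * pi} (\<lambda>h. (uh t h)\<^sup>2)"
    by (rule int) (auto simp: periodic intro!: integrable_continuous_real continuous_intros cont_slice)
  show sp: "supp t > 0"
  proof (rule ccontr)
    assume "\<not> supp t > 0"
    moreover have "supp t \<ge> 0" unfolding supp_def by (intro integral_nonneg indicat_supp_integrable) auto
    ultimately have "supp t = 0" by simp
    hence ind0: "(indicat_real {h. u t h > 0} has_integral 0) {0..2 * pi}"
      using indicat_supp_integrable[of t 0 "2 * pi"] by (simp add: supp_def has_integral_iff)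
    have "bounded (u t ` {0..2 * pi})"
      by (intro compact_imp_bounded compact_continuous_image cont_slice compact_Icc)
    then obtain M where M: "M > 0" "\<And>h. h \<in> {0..2 * pi} \<Longrightarrow> \<bar>u t h\<bar> \<le> M"
      by (auto simp: bounded_pos)
    have ui: "u t integrable_on {0..2 * pi}" by (intro integrable_continuous_real cont_slice)
    have leM: "u t h \<le> M * indicat_real {h. u t h > 0} h" if "h \<in> {0..2 * pi}" for h
      using M(2)[OF that] nonneg[of t h] by (cases "u t h > 0") (simp_all add: indicator_def)
    have "integral {0..2 * pi} (u t) \<le> M * 0"
      by (rule has_integral_le[OF integrable_integral[OF ui] has_integral_mult_right[OF ind0] leM])
    moreover have "0 \<le> integral {0..2 * pi} (u t)" by (intro integral_nonneg ui nonneg)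
    ultimately have "integral {0..2 * pi} (u t) = 0" by linarith
    hence ui0: "(u t has_integral 0) (cbox 0 (2 * pi))" using ui by (simp add: has_integral_iff)
    have "u t h * ut t h = 0" if "h \<in> {0..2 * pi}" for h
      using has_integral_0_cbox_imp_0[OF cont_slice(1) _ ui0, of h] nonneg that by (auto simp: box_real not_le)
    hence "J t = 0" unfolding J_def using integral_cong[of "{0..2 * pi}" "\<lambda>h. u t h * ut t h" "\<lambda>_. 0"] by simp
    with J show False by simp
  qed
  define k where "k = pi / supp t"
  have k: "k > 0" using sp by (simp add: k_def)
  have "k\<^sup>2 * I t \<le> integral {0..2 * pi} (\<lambda>h. (uh t h)\<^sup>2)"
    using wirtinger_support[of h0 "h0 + 2 * pi" "u t" "uh t"] z sp periodic[of t h0] cont_slice Dh nonneg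
    by (simp add: s U UH k_def)
  moreover have "2 * k * J t \<le> k\<^sup>2 * I t + integral {0..2 * pi} (\<lambda>h. (ut t h)\<^sup>2)"
  proof -
    have i: "(\<lambda>h. u t h * ut t h) integrable_on {0..2*pi}" "(\<lambda>h. (u t h)\<^sup>2) integrable_on {0..2*pi}"
       "(\<lambda>h. (ut t h)\<^sup>2) integrable_on {0..2*pi}"
      by (intro integrable_continuous_real continuous_intros cont_slice)+
    have "((\<lambda>h. 2 * k * (u t h * ut t h)) has_integral 2 * k * J t) {0..2 * pi}"
      unfolding J_def by (intro has_integral_mult_right integrable_integral i)
    moreover have "((\<lambda>h. k\<^sup>2 * (u t h)\<^sup>2 + (ut t h)\<^sup>2) has_integral
       (k\<^sup>2 * I t + integral {0..2 * pi} (\<lambda>h. (ut t h)\<^sup>2))) {0..2 * pi}"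
      unfolding I_def by (intro has_integral_add has_integral_mult_right integrable_integral i)
    moreover have "2 * k * (u t h * ut t h) \<le> k\<^sup>2 * (u t h)\<^sup>2 + (ut t h)\<^sup>2" for h
      using sum_squares_bound[of "k * u t h" "ut t h"] by (simp add: power_mult_distrib mult_ac)
    ultimately show ?thesis using has_integral_le by blast
  qed
  ultimately have "2 * k * J t \<le> K t" using K_ge[of t] by linarith
  thus "2 * pi / supp t * J t \<le> K t" by (simp add: k_def)
qed

lemma J_small:
  assumes gr: "\<And>\<epsilon>. \<epsilon> > 0 \<Longrightarrow> \<exists>C. \<forall>t h. u t h \<le> \<epsilon> * exp t + C" and \<delta>: "\<delta> > 0"
  shows "\<exists>T0. \<forall>T\<ge>T0. J T \<le> \<delta> * exp (2 * T)"
proof -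
  \<comment> \<open>Chosen so that
    \<open>2 pi (2 \<epsilon> exp (T + 1))^2 = 2 \<delta> exp (2 T)\<close>; the left side bounds
    \<open>I (T + 1)\<close>, hence \<open>2 J T\<close>.\<close>
  define \<epsilon> where "\<epsilon> = sqrt (\<delta> / (4 * pi * exp 2))"
  have \<epsilon>: "\<epsilon> > 0" "\<epsilon>\<^sup>2 = \<delta> / (4 * pi * exp 2)" using \<delta> by (auto simp: \<epsilon>_def)
  from gr[OF \<epsilon>(1)] obtain C where C: "\<And>t h. u t h \<le> \<epsilon> * exp t + C" by auto
  have "J T \<le> \<delta> * exp (2 * T)" if T: "T \<ge> ln ((\<bar>C\<bar> + 1) / \<epsilon>)" for T
  proof -
    have "(\<bar>C\<bar> + 1) / \<epsilon> \<le> exp (T + 1)"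
      using T \<epsilon>(1) by (subst ln_le_cancel_iff[symmetric]) auto
    hence "C \<le> \<epsilon> * exp (T + 1)" using \<epsilon>(1) by (simp add: field_simps)
    hence le: "u (T + 1) h \<le> 2 * \<epsilon> * exp (T + 1)" for h using C[of "T + 1" h] by simp
    have "I (T + 1) \<le> integral {0..2 * pi} (\<lambda>h. (2 * \<epsilon> * exp (T + 1))\<^sup>2)"
      unfolding I_def
      by (intro integral_le integrable_continuous_real continuous_intros cont_slice power_mono le nonneg)
    also have "\<dots> = 2 * pi * (2 * \<epsilon> * exp (T + 1))\<^sup>2" by simp
    also have "(2 * \<epsilon> * exp (T + 1))\<^sup>2 = 4 * \<epsilon>\<^sup>2 * (exp 2 * exp (2 * T))"
      by (simp add: power_mult_distrib power2_eq_square exp_add[symmetric] algebra_simps)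
    also have "2 * pi * \<dots> = 2 * (\<delta> * exp (2 * T))" by (simp add: \<epsilon>(2) field_simps)
    finally show ?thesis using J_le_I[of T] by simp
  qed
  thus ?thesis by blast
qed

end

text \<open>By Wirtinger's inequality \<open>K/J \<ge> 2 \<pi> / supp t\<close> for either function. Where the supports are disjoint their lengths add up
  to at most \<open>2 \<pi>\<close>, so \<open>(ln (J\<^sub>u J\<^sub>w))' \<ge> 4\<close>: one of the two grows at least like \<open>e\<^bsup>2t\<^esup>\<close>.\<close>

lemma two_tracts:
  fixes E :: "real set"
  assumes A: "tract u ut uh utt uhh" and B: "tract w wt wh wtt whh"
    and E: "E \<in> lmeasurable"
    and disj: "\<And>t h. t \<notin> E \<Longrightarrow> u t h = 0 \<or> w t h = 0"
    and gru: "\<And>\<epsilon>. \<epsilon> > 0 \<Longrightarrow> \<exists>C. \<forall>t h. u t h \<le> \<epsilon> * exp t + C"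
    and grw: "\<And>\<epsilon>. \<epsilon> > 0 \<Longrightarrow> \<exists>C. \<forall>t h. w t h \<le> \<epsilon> * exp t + C"
  shows "(\<forall>t. \<forall>h\<in>{0..2 * pi}. u t h = 0) \<or> (\<forall>t. \<forall>h\<in>{0..2 * pi}. w t h = 0)"
proof (rule ccontr)
  interpret A: tract u ut uh utt uhh by fact
  interpret B: tract w wt wh wtt whh by fact
  assume "\<not> ?thesis"
  then obtain ta tb where "A.J ta \<noteq> 0" "B.J tb \<noteq> 0"
    using A.zero_if_J_zero B.zero_if_J_zero by metis
  hence "A.J ta > 0" "B.J tb > 0" using A.J_nonneg B.J_nonneg by (simp_all add: order_less_le)
  define t0 where "t0 = max ta tb"
  have pos: "A.J t > 0" "B.J t > 0" if "t \<ge> t0" for t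
    using A.J_mono[of ta t] B.J_mono[of tb t] that \<open>A.J ta > 0\<close> \<open>B.J tb > 0\<close> by (auto simp: t0_def)
  define H where "H t = ln (A.J t) + ln (B.J t)" for t
  define H' where "H' t = A.K t / A.J t + B.K t / B.J t" for t
  have DH: "(H has_real_derivative H' t) (at t)" if "t \<ge> t0" for t
    unfolding H_def[abs_def] H'_def using pos[OF that]
    by (auto intro!: derivative_eq_intros A.DERIV_J B.DERIV_J)
  \<comment> \<open>On \<open>E\<close> only \<open>K \<ge> 0\<close> is available, which gives up 4
    per unit length; as \<open>E\<close> has finite measure the total loss is at most
    \<open>4 m\<close>.\<close>
  have ge4: "H' t \<ge> 4 - 4 * indicat_real E t" if t: "t \<ge> t0" for t
  proof (cases "t \<in> E")
    case True
    thus ?thesis using pos[OF t] A.K_nonneg[of t] B.K_nonneg[of t] by (simp add: H'_def)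
  next
    case False
    have exA: "\<exists>h\<in>{0..2 * pi}. u t h \<noteq> 0"
    proof (rule ccontr)
      assume "\<not> ?thesis"
      hence "A.J t = 0" unfolding A.J_def using integral_cong[of "{0..2 * pi}" "\<lambda>h. u t h * ut t h" "\<lambda>_. 0"] by simp
      thus False using pos[OF t] by simp
    qed
    have exB: "\<exists>h\<in>{0..2 * pi}. w t h \<noteq> 0"
    proof (rule ccontr)
      assume "\<not> ?thesis"
      hence "B.J t = 0" unfolding B.J_def using integral_cong[of "{0..2 * pi}" "\<lambda>h. w t h * wt t h" "\<lambda>_. 0"] by simp
      thus False using pos[OF t] by simp
    qed
    \<comment> \<open>Both values of \<open>J\<close> are positive, so neither function vanishes on
      the whole circle, and where one is nonzero the other is zero. This supplies the zeros at which
      \<open>growth\<close> starts its period.\<close>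
    obtain ha hb where "ha \<in> {0..2 * pi}" "u t ha = 0" "hb \<in> {0..2 * pi}" "w t hb = 0"
      using exA exB disj[OF False] by blast
    note gA = A.growth[OF pos(1)[OF t] this(1,2)] and gB = B.growth[OF pos(2)[OF t] this(3,4)]
    have sum: "A.supp t + B.supp t \<le> 2 * pi"
    proof -
      have "((\<lambda>h. indicat_real {h. u t h > 0} h + indicat_real {h. w t h > 0} h) has_integral (A.supp t + B.supp t)) {0..2 * pi}"
        unfolding A.supp_def B.supp_def
        by (intro has_integral_add integrable_integral A.indicat_supp_integrable B.indicat_supp_integrable)
      moreover have "((\<lambda>h. 1 :: real) has_integral (2 * pi)) {0..2 * pi}"
        using has_integral_const_real[of "1::real" 0 "2 * pi"] by simp
      ultimately show ?thesis
      proof (rule has_integral_le)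
        fix h show "indicat_real {h. u t h > 0} h + indicat_real {h. w t h > 0} h \<le> 1"
          using disj[OF False, of h] by (auto simp: indicator_def)
      qed
    qed
    \<comment> \<open>Among two lengths with sum at most \<open>2 pi\<close>, equal ones give the
      smallest sum of reciprocals.\<close>
    have "4 \<le> 2 * pi / A.supp t + 2 * pi / B.supp t"
    proof -
      define a b where "a = A.supp t" and "b = B.supp t"
      have ab: "a > 0" "b > 0" "a + b \<le> 2 * pi" using gA gB sum by (auto simp: a_def b_def)
      have "4 \<le> (a + b) / a + (a + b) / b"
        using sum_squares_bound[of a b] ab by (simp add: field_simps power2_eq_square)
      also have "\<dots> \<le> 2 * pi / a + 2 * pi / b" using ab by (intro add_mono divide_right_mono) auto
      finally show ?thesis using ab by (simp add: a_def b_def)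
    qed
    also have "\<dots> \<le> H' t"
      unfolding H'_def using gA(2) gB(2) pos[OF t] by (intro add_mono) (simp_all add: pos_le_divide_eq)
    finally show ?thesis using False by simp
  qed
  define m where "m = integral UNIV (indicat_real E)"
  have iE: "indicat_real E integrable_on UNIV" "indicat_real E integrable_on {a..b}" for a b
    using E fmeasurable_Int_fmeasurable[OF E, of "{a..b}"] by (simp_all add: integrable_on_indicator)
  have lower: "H T \<ge> H t0 + 4 * (T - t0) - 4 * m" if T: "T \<ge> t0" for T
  proof -
    have iH: "(H' has_integral (H T - H t0)) {t0..T}"
      using T by (intro fundamental_theorem_of_calculus)
        (auto simp flip: has_real_derivative_iff_has_vector_derivative intro: DERIV_subset[OF DH])
    have i4: "((\<lambda>t. 4 - 4 * indicat_real E t) has_integral (4 * (T - t0) - 4 * integral {t0..T} (indicat_real E))) {t0..T}"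
      using has_integral_const_real[of "4::real" t0 T] T
      by (intro has_integral_diff has_integral_mult_right integrable_integral iE) (simp add: mult.commute)
    have "4 * (T - t0) - 4 * integral {t0..T} (indicat_real E) \<le> H T - H t0"
      by (rule has_integral_le[OF i4 iH]) (rule ge4, simp)
    moreover have "integral {t0..T} (indicat_real E) \<le> m"
      unfolding m_def by (intro integral_subset_le iE) auto
    ultimately show ?thesis by simp
  qed
  define c where "c = exp (H t0 - 4 * t0 - 4 * m)"
  have c: "c > 0" by (simp add: c_def)
  have lower': "A.J T * B.J T \<ge> c * exp (4 * T)" if T: "T \<ge> t0" for T
  proof -
    have "A.J T * B.J T = exp (H T)" using pos[OF T] by (simp add: H_def exp_add)
    also have "\<dots> \<ge> exp (H t0 - 4 * t0 - 4 * m + 4 * T)" using lower[OF T] by simp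
    finally show ?thesis by (simp add: c_def exp_add)
  qed
  \<comment> \<open>The two upper bounds then multiply to \<open>c / 4 * exp (4 T)\<close>, which is
    below the lower bound \<open>c * exp (4 T)\<close>.\<close>
  define \<delta> where "\<delta> = sqrt c / 2"
  have \<delta>: "\<delta> > 0" "\<delta> * \<delta> = c / 4" using c by (auto simp: \<delta>_def)
  obtain Ta where Ta: "\<And>T. T \<ge> Ta \<Longrightarrow> A.J T \<le> \<delta> * exp (2 * T)" using A.J_small[OF gru \<delta>(1)] by auto
  obtain Tb where Tb: "\<And>T. T \<ge> Tb \<Longrightarrow> B.J T \<le> \<delta> * exp (2 * T)" using B.J_small[OF grw \<delta>(1)] by auto
  define T where "T = max t0 (max Ta Tb)"
  have "c * exp (4 * T) \<le> A.J T * B.J T" by (rule lower') (simp add: T_def)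
  also have "\<dots> \<le> (\<delta> * exp (2 * T)) * (\<delta> * exp (2 * T))"
    using A.J_nonneg B.J_nonneg \<delta>(1) by (intro mult_mono Ta Tb) (auto simp: T_def)
  also have "\<dots> = (\<delta> * \<delta>) * exp (4 * T)" by (simp add: exp_add[symmetric] mult_ac)
  finally show False using c by (simp add: \<delta>(2))
qed

section \<open>Entire functions of zero exponential type\<close>

lemma DERIV_vanish_left:
  fixes g g' :: "real \<Rightarrow> real"
  assumes g: "\<And>x. (g has_real_derivative g' x) (at x)" and 0: "g 0 = 0" "g' 0 = 0"
  shows "((\<lambda>x. if x \<le> 0 then 0 else g x) has_real_derivative (if x \<le> 0 then 0 else g' x)) (at x)"
proof -
  consider "x < 0" | "x > 0" | "x = 0" by linarith
  thus ?thesis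
  proof cases
    case 1
    have "((\<lambda>x. 0 :: real) has_real_derivative 0) (at x)" by simp
    hence "((\<lambda>x. if x \<le> 0 then 0 else g x) has_real_derivative 0) (at x)"
      by (rule has_field_derivative_transform_within_open[of _ _ _ "{..<0}"]) (use 1 in auto)
    thus ?thesis using 1 by simp
  next
    case 2
    have "((\<lambda>x. if x \<le> 0 then 0 else g x) has_real_derivative g' x) (at x)"
      by (rule has_field_derivative_transform_within_open[of _ _ _ "{0<..}", OF g]) (use 2 in auto)
    thus ?thesis using 2 by simp
  next
    case 3
    have l: "(\<lambda>h. \<bar>g h / h\<bar>) \<midarrow>0\<rightarrow> \<bar>0\<bar>"
      using g[of 0] by (intro tendsto_intros) (simp add: DERIV_def 0)
    hence l0: "(\<lambda>h. \<bar>g h / h\<bar>) \<midarrow>0\<rightarrow> 0" by (simp only: abs_zero)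
    have "(\<lambda>h. (if h \<le> 0 then 0 else g h) / h) \<midarrow>0\<rightarrow> 0"
    proof (rule Lim_null_comparison[OF always_eventually l0], rule allI)
      fix h show "norm ((if h \<le> 0 then 0 else g h) / h) \<le> \<bar>g h / h\<bar>"
        by (cases "h \<le> 0") (simp_all del: abs_divide)
    qed
    hence "((\<lambda>x. if x \<le> 0 then 0 else g x) has_real_derivative 0) (at 0)"
      unfolding DERIV_def by (simp only: add_0_left order_refl if_True diff_zero)
    moreover have "(if x \<le> 0 then 0 else g' x) = 0" using 3 by simp
    ultimately show ?thesis unfolding 3 by (simp only:)
  qed
qed

text \<open>A convex C^2 substitute for \<open>max 0 x\<close>: the first two derivatives of
  \<open>x - arctan x\<close> vanish at 0, so the pieces join smoothly. It is positive exactly for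
  \<open>x > 0\<close>, so it keeps the support, and it stays below \<open>x\<close>, so it keeps
  the growth bound.\<close>

definition tpsi :: "real \<Rightarrow> real" where "tpsi x = (if x \<le> 0 then 0 else x - arctan x)"
definition tpsi1 :: "real \<Rightarrow> real" where "tpsi1 x = (if x \<le> 0 then 0 else x\<^sup>2 / (1 + x\<^sup>2))"
definition tpsi2 :: "real \<Rightarrow> real" where "tpsi2 x = (if x \<le> 0 then 0 else 2 * x / (1 + x\<^sup>2)\<^sup>2)"

lemma DERIV_tpsi: "(tpsi has_real_derivative tpsi1 x) (at x)"
  unfolding tpsi_def[abs_def] tpsi1_def
proof (rule DERIV_vanish_left)
  fix x :: real
  have "1 + x\<^sup>2 \<noteq> 0" by (smt (verit) zero_le_power2)
  thus "((\<lambda>x. x - arctan x) has_real_derivative x\<^sup>2 / (1 + x\<^sup>2)) (at x)"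
    by (auto intro!: derivative_eq_intros simp: field_simps)
qed auto

lemma DERIV_tpsi1: "(tpsi1 has_real_derivative tpsi2 x) (at x)"
  unfolding tpsi1_def[abs_def] tpsi2_def
proof (rule DERIV_vanish_left)
  fix x :: real
  have "1 + x\<^sup>2 \<noteq> 0" by (smt (verit) zero_le_power2)
  thus "((\<lambda>x. x\<^sup>2 / (1 + x\<^sup>2)) has_real_derivative 2 * x / (1 + x\<^sup>2)\<^sup>2) (at x)"
    by (auto intro!: derivative_eq_intros simp: power2_eq_square algebra_simps)
qed auto

lemma isCont_tpsi2: "isCont tpsi2 x"
proof -
  have "1 + x\<^sup>2 \<noteq> 0" for x :: real by (smt (verit) zero_le_power2)
  hence "isCont (\<lambda>x. 2 * max 0 x / (1 + x\<^sup>2)\<^sup>2) x" by (intro continuous_intros) auto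
  also have "(\<lambda>x. 2 * max 0 x / (1 + x\<^sup>2)\<^sup>2) = tpsi2" by (auto simp: tpsi2_def fun_eq_iff max_def)
  finally show ?thesis .
qed

lemma tpsi_left: "x \<le> 0 \<Longrightarrow> tpsi x = 0" "x \<le> 0 \<Longrightarrow> tpsi1 x = 0" "x \<le> 0 \<Longrightarrow> tpsi2 x = 0"
  by (auto simp: tpsi_def tpsi1_def tpsi2_def)

lemma tpsi_pos: assumes "x > 0" shows "0 < tpsi x"
proof -
  obtain z where z: "0 < z" "z < x" "tpsi x - tpsi 0 = (x - 0) * tpsi1 z"
    using MVT2[of 0 x tpsi tpsi1] DERIV_tpsi assms by auto
  hence "tpsi1 z > 0" by (simp add: tpsi1_def add_pos_pos)
  thus ?thesis using z assms by (simp add: tpsi_def[of 0])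
qed

lemma tpsi_nonneg: "tpsi x \<ge> 0" "tpsi2 x \<ge> 0"
  by (cases "x \<le> 0"; use tpsi_pos[of x] in \<open>simp add: tpsi2_def tpsi_left\<close>)+

lemma tpsi_le: "tpsi x \<le> max 0 x"
  by (auto simp: tpsi_def)

lemma DERIV_ln_norm:
  fixes h :: "real \<Rightarrow> complex"
  assumes "(h has_vector_derivative h') (at x)" "h x \<noteq> 0"
  shows "((\<lambda>x. ln (norm (h x))) has_real_derivative Re (h' / h x)) (at x)"
proof -
  have *: "((\<lambda>x. Re (h x)) has_real_derivative Re h') (at x)" "((\<lambda>x. Im (h x)) has_real_derivative Im h') (at x)"
    using assms(1) by (auto simp: has_vector_derivative_complex_iff)
  have pos: "(Re (h x))\<^sup>2 + (Im (h x))\<^sup>2 > 0" using assms(2) by (simp add: complex_neq_0)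
  have gen: "((\<lambda>x. 1 / 2 * ln ((a x)\<^sup>2 + (b x)\<^sup>2)) has_real_derivative (a x * a' + b x * b') / ((a x)\<^sup>2 + (b x)\<^sup>2)) (at x)"
    if "(a has_real_derivative a') (at x)" "(b has_real_derivative b') (at x)" "(a x)\<^sup>2 + (b x)\<^sup>2 > 0" for a b a' b'
  proof -
    have "((\<lambda>x. (a x)\<^sup>2 + (b x)\<^sup>2) has_real_derivative 2 * (a x * a' + b x * b')) (at x)"
      by (auto intro!: derivative_eq_intros that simp: algebra_simps)
    note D = DERIV_cmult[OF DERIV_chain2[OF DERIV_ln_divide[OF that(3)] this], of "1 / 2"]
    have "1 / 2 * (1 / S * (2 * X)) = X / S" for S X :: real by simp
    with D show ?thesis by (metis (no_types))
  qed
  have "((\<lambda>x. 1 / 2 * ln ((Re (h x))\<^sup>2 + (Im (h x))\<^sup>2)) has_real_derivative Re (h' / h x)) (at x)"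
    using gen[OF * pos] by (simp add: Re_divide mult.commute)
  also have "(\<lambda>x. 1 / 2 * ln ((Re (h x))\<^sup>2 + (Im (h x))\<^sup>2)) = (\<lambda>x. ln (norm (h x)))"
    by (auto simp: cmod_def ln_sqrt fun_eq_iff)
  finally show ?thesis .
qed

lemma ln_norm_le:
  assumes "norm z < 1" "c \<ge> 0"
  shows "ln (norm z) - c \<le> 0"
proof (cases "z = 0")
  case False
  hence "ln (norm z) < 0" using assms by (intro ln_less_zero) auto
  thus ?thesis using assms by simp
qed (use assms in simp)

lemma isCont_zero_eventually_small:
  fixes h :: "'a :: t2_space \<Rightarrow> complex"
  assumes "isCont h x" "h x = 0"
  shows "\<forall>\<^sub>F y in nhds x. norm (h y) < 1"
proof -
  have "(h \<longlongrightarrow> h x) (nhds x)"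
    using assms(1) by (simp add: isCont_def tendsto_at_iff_tendsto_nhds)
  from topological_tendstoD[OF this, of "ball 0 1"] show ?thesis using assms(2) by simp
qed

text \<open>Where \<open>h\<close> vanishes the cut-off kills everything nearby; \<open>ln 0 = 0\<close> and \<open>c \<ge> 0\<close> make the formula correct there as well.\<close>

lemma DERIV_cutoff_mult:
  fixes h :: "real \<Rightarrow> complex" and \<psi> \<psi>' :: "real \<Rightarrow> real"
  assumes h: "(h has_vector_derivative h') (at x)" and c: "c \<ge> 0"
    and \<psi>: "\<And>y. (\<psi> has_real_derivative \<psi>' y) (at y)" "\<And>y. y \<le> 0 \<Longrightarrow> \<psi> y = 0" "\<And>y. y \<le> 0 \<Longrightarrow> \<psi>' y = 0"
    and r: "h x \<noteq> 0 \<Longrightarrow> (r has_real_derivative r') (at x)"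
  shows "((\<lambda>x. \<psi> (ln (norm (h x)) - c) * r x) has_real_derivative
     \<psi>' (ln (norm (h x)) - c) * Re (h' / h x) * r x + \<psi> (ln (norm (h x)) - c) * r') (at x)"
proof (cases "h x = 0")
  case True
  have "isCont h x" using h by (rule has_vector_derivative_continuous)
  from isCont_zero_eventually_small[OF this True] obtain S where S: "open S" "x \<in> S" "\<And>y. y \<in> S \<Longrightarrow> norm (h y) < 1"
    by (auto simp: eventually_nhds)
  have 0: "\<psi> (ln (norm (h y)) - c) = 0" if "y \<in> S" for y
    by (rule \<psi>(2)[OF ln_norm_le[OF S(3)[OF that] c]])
  have "((\<lambda>x. \<psi> (ln (norm (h x)) - c) * r x) has_real_derivative 0) (at x)"
    by (rule has_field_derivative_transform_within_open[OF DERIV_const S(1,2)]) (simp only: 0 mult_zero_left)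
  thus ?thesis using True c \<psi> by simp
next
  case False
  have "((\<lambda>x. ln (norm (h x)) - c) has_real_derivative Re (h' / h x) - 0) (at x)"
    by (intro DERIV_diff DERIV_const DERIV_ln_norm h False)
  from DERIV_mult[OF DERIV_chain2[OF \<psi>(1) this] r[OF False]] show ?thesis
    by (rule DERIV_cong) (simp only: diff_zero mult.commute[of r'])
qed

lemma isCont_cutoff_mult:
  fixes H :: "complex \<Rightarrow> complex" and \<psi> :: "real \<Rightarrow> real" and R :: "complex \<Rightarrow> real"
  assumes H: "isCont H z" and c: "c \<ge> 0" and \<psi>: "\<And>y. isCont \<psi> y" "\<And>y. y \<le> 0 \<Longrightarrow> \<psi> y = 0"
    and R: "H z \<noteq> 0 \<Longrightarrow> isCont R z"
  shows "isCont (\<lambda>z. \<psi> (ln (norm (H z)) - c) * R z) z"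
proof (cases "H z = 0")
  case True
  from isCont_zero_eventually_small[OF H this]
  have "\<forall>\<^sub>F y in nhds z. \<psi> (ln (norm (H y)) - c) * R y = 0"
    by eventually_elim (simp add: \<psi>(2)[OF ln_norm_le[OF _ c]])
  hence "((\<lambda>z. \<psi> (ln (norm (H z)) - c) * R z) \<longlongrightarrow> 0) (nhds z)" by (rule tendsto_eventually)
  moreover define F where "F = (\<lambda>z. \<psi> (ln (norm (H z)) - c) * R z)"
  ultimately have "(F \<longlongrightarrow> 0) (nhds z)" by (simp only: F_def)
  moreover have "F z = 0" using True c \<psi>(2) by (simp add: F_def)
  ultimately have "(F \<longlongrightarrow> F z) (nhds z)" by (simp only:)
  hence "isCont F z" by (simp add: isCont_def tendsto_at_iff_tendsto_nhds)
  thus ?thesis by (simp add: F_def)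
next
  case False
  have "isCont (\<lambda>z. ln (norm (H z)) - c) z" using H False by (intro continuous_intros) auto
  from isCont_o2[OF this \<psi>(1)] show ?thesis by (intro isCont_mult R False)
qed

text \<open>The common shape of the subharmonic function and of every summand of its partial
  derivatives up to order two: \<open>\<psi>\<close> runs through \<open>tpsi\<close>,
  \<open>tpsi1\<close>, \<open>tpsi2\<close>, while \<open>R\<close> collects real and imaginary
  parts of the logarithmic derivative of \<open>H\<close> and of its derivative.\<close>

definition cutoff :: "(real \<Rightarrow> real) \<Rightarrow> real \<Rightarrow> (complex \<Rightarrow> complex) \<Rightarrow> (complex \<Rightarrow> real) \<Rightarrow> real \<Rightarrow> real \<Rightarrow> real" where
  "cutoff \<psi> c H R t h = \<psi> (ln (norm (H (Complex t h))) - c) * R (Complex t h)"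

lemma continuous_on_cutoff:
  assumes "\<And>z. isCont H z" "c \<ge> 0" "\<And>y. isCont \<psi> y" "\<And>y. y \<le> 0 \<Longrightarrow> \<psi> y = 0"
    "\<And>z. H z \<noteq> 0 \<Longrightarrow> isCont R z"
  shows "continuous_on UNIV (\<lambda>(t, h). cutoff \<psi> c H R t h)"
proof -
  have "continuous_on UNIV (\<lambda>z. \<psi> (ln (norm (H z)) - c) * R z)"
    using isCont_cutoff_mult[OF assms(1,2) assms(3,4,5)] by (simp add: continuous_on_eq_continuous_at)
  hence "continuous_on UNIV (\<lambda>p. (\<lambda>z. \<psi> (ln (norm (H z)) - c) * R z) (Complex (fst p) (snd p)))"
    by (rule continuous_on_compose2) (auto simp: Complex_eq intro!: continuous_intros)
  thus ?thesis unfolding cutoff_def case_prod_unfold .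
qed

text \<open>Moving in \<open>h\<close> multiplies a complex derivative by \<open>\<i>\<close>, so
  its real part is replaced by minus its imaginary part.\<close>

lemma DERIV_cutoff:
  fixes H :: "complex \<Rightarrow> complex" and \<psi> \<psi>' :: "real \<Rightarrow> real"
  assumes H: "(H has_field_derivative H') (at (Complex t h))" and c: "c \<ge> 0"
    and \<psi>: "\<And>y. (\<psi> has_real_derivative \<psi>' y) (at y)" "\<And>y. y \<le> 0 \<Longrightarrow> \<psi> y = 0" "\<And>y. y \<le> 0 \<Longrightarrow> \<psi>' y = 0"
    and R: "H (Complex t h) \<noteq> 0 \<Longrightarrow> (R has_field_derivative R') (at (Complex t h))"
  shows "((\<lambda>t. cutoff \<psi> c H (\<lambda>z. Re (R z)) t h) has_real_derivative
      \<psi>' (ln (norm (H (Complex t h))) - c) * Re (H' / H (Complex t h)) * Re (R (Complex t h))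
      + cutoff \<psi> c H (\<lambda>_. Re R') t h) (at t)"
    and "(cutoff \<psi> c H (\<lambda>z. Re (R z)) t has_real_derivative
      - \<psi>' (ln (norm (H (Complex t h))) - c) * Im (H' / H (Complex t h)) * Re (R (Complex t h))
      - cutoff \<psi> c H (\<lambda>_. Im R') t h) (at h)"
proof -
  have Ct: "((\<lambda>t. Complex t h) has_vector_derivative 1) (at t)"
    by (auto simp: has_vector_derivative_complex_iff)
  have Ch: "((\<lambda>h. Complex t h) has_vector_derivative \<i>) (at h)"
    by (auto simp: has_vector_derivative_complex_iff)
  have vt: "((\<lambda>t. F (Complex t h)) has_vector_derivative F') (at t)" if "(F has_field_derivative F') (at (Complex t h))" for F F'
    using field_vector_diff_chain_at[OF Ct that] by (simp add: o_def)
  have vh: "((\<lambda>h. F (Complex t h)) has_vector_derivative (\<i> * F')) (at h)" if "(F has_field_derivative F') (at (Complex t h))" for F F'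
    using field_vector_diff_chain_at[OF Ch that] by (simp add: o_def)
  have Re_D: "(G has_vector_derivative G') (at x) \<Longrightarrow> ((\<lambda>x. Re (G x)) has_real_derivative Re G') (at x)"
    for G :: "real \<Rightarrow> complex" and G' x
    by (auto simp: has_vector_derivative_complex_iff)
  have Re_i: "Re (\<i> * a / b) = - Im (a / b)" for a b by (simp flip: times_divide_eq_right)
  show "((\<lambda>t. cutoff \<psi> c H (\<lambda>z. Re (R z)) t h) has_real_derivative
      \<psi>' (ln (norm (H (Complex t h))) - c) * Re (H' / H (Complex t h)) * Re (R (Complex t h))
      + cutoff \<psi> c H (\<lambda>_. Re R') t h) (at t)"
    unfolding cutoff_def by (rule DERIV_cutoff_mult[OF vt[OF H] c \<psi> Re_D[OF vt[OF R]]])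
  have "((\<lambda>h. cutoff \<psi> c H (\<lambda>z. Re (R z)) t h) has_real_derivative
      \<psi>' (ln (norm (H (Complex t h))) - c) * Re (\<i> * H' / H (Complex t h)) * Re (R (Complex t h))
      + cutoff \<psi> c H (\<lambda>_. Re (\<i> * R')) t h) (at h)"
    unfolding cutoff_def by (rule DERIV_cutoff_mult[OF vh[OF H] c \<psi> Re_D[OF vh[OF R]]])
  thus "(cutoff \<psi> c H (\<lambda>z. Re (R z)) t has_real_derivative
      - \<psi>' (ln (norm (H (Complex t h))) - c) * Im (H' / H (Complex t h)) * Re (R (Complex t h))
      - cutoff \<psi> c H (\<lambda>_. Im R') t h) (at h)"
    unfolding Re_i by (simp add: cutoff_def[abs_def])
qed

text \<open>With \<open>l = H' / H\<close>, the function ln |H| has gradient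
  \<open>(Re l, - Im l)\<close> and is harmonic off the zeros. The terms with
  \<open>Re (l' z)\<close> therefore cancel in \<open>utt + uhh\<close>, and what is left is
  \<open>tpsi2\<close> times \<open>(Re l)^2 + (Im l)^2\<close>.\<close>

lemma tract_cutoff:
  fixes H H' l l' :: "complex \<Rightarrow> complex"
  assumes H: "\<And>z. (H has_field_derivative H' z) (at z)" and c: "c \<ge> 0"
    and l: "\<And>z. l z = H' z / H z" and dl: "\<And>z. H z \<noteq> 0 \<Longrightarrow> (l has_field_derivative l' z) (at z)"
    and cl': "\<And>z. H z \<noteq> 0 \<Longrightarrow> isCont l' z"
    and per: "\<And>z. H (z + 2 * of_real pi * \<i>) = H z"
    and small: "\<And>z. Re z \<le> 0 \<Longrightarrow> norm (H z) \<le> exp c"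
  shows "tract (cutoff tpsi c H (\<lambda>_. 1)) (cutoff tpsi1 c H (\<lambda>z. Re (l z))) (cutoff tpsi1 c H (\<lambda>z. - Im (l z)))
     (\<lambda>t h. cutoff tpsi2 c H (\<lambda>z. (Re (l z))\<^sup>2) t h + cutoff tpsi1 c H (\<lambda>z. Re (l' z)) t h)
     (\<lambda>t h. cutoff tpsi2 c H (\<lambda>z. (Im (l z))\<^sup>2) t h + cutoff tpsi1 c H (\<lambda>z. - Re (l' z)) t h)"
proof
  have cH: "isCont H z" for z using H DERIV_isCont by blast
  have cl: "isCont l z" if "H z \<noteq> 0" for z using dl[OF that] DERIV_isCont by blast
  have cpsi: "isCont tpsi y" "isCont tpsi1 y" for y
    using DERIV_tpsi DERIV_tpsi1 DERIV_isCont by blast+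
  note psi0 = DERIV_tpsi tpsi_left(1,2) and psi1 = DERIV_tpsi1 tpsi_left(2,3)
  note cu0 = continuous_on_cutoff[OF cH c cpsi(1) tpsi_left(1)]
   and cu1 = continuous_on_cutoff[OF cH c cpsi(2) tpsi_left(2)] and cu2 = continuous_on_cutoff[OF cH c isCont_tpsi2 tpsi_left(3)]
  show "continuous_on UNIV (\<lambda>(t, h). cutoff tpsi c H (\<lambda>_. 1) t h)"
    by (rule cu0) auto
  show "continuous_on UNIV (\<lambda>(t, h). cutoff tpsi1 c H (\<lambda>z. Re (l z)) t h)"
    by (rule cu1) (assumption, intro continuous_intros isCont_Re cl)
  show "continuous_on UNIV (\<lambda>(t, h). cutoff tpsi1 c H (\<lambda>z. - Im (l z)) t h)"
    by (rule cu1) (assumption, intro continuous_intros isCont_Im cl)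
  have "continuous_on UNIV (\<lambda>(t, h). cutoff tpsi2 c H (\<lambda>z. (Re (l z))\<^sup>2) t h)"
    by (rule cu2) (assumption, intro continuous_intros isCont_Re cl)
  moreover have "continuous_on UNIV (\<lambda>(t, h). cutoff tpsi1 c H (\<lambda>z. Re (l' z)) t h)"
    by (rule cu1) (assumption, intro continuous_intros isCont_Re cl')
  ultimately show "continuous_on UNIV (\<lambda>(t, h). cutoff tpsi2 c H (\<lambda>z. (Re (l z))\<^sup>2) t h + cutoff tpsi1 c H (\<lambda>z. Re (l' z)) t h)"
    unfolding split_beta by (rule continuous_on_add)
  have "continuous_on UNIV (\<lambda>(t, h). cutoff tpsi2 c H (\<lambda>z. (Im (l z))\<^sup>2) t h)"
    by (rule cu2) (assumption, intro continuous_intros isCont_Im cl)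
  moreover have "continuous_on UNIV (\<lambda>(t, h). cutoff tpsi1 c H (\<lambda>z. - Re (l' z)) t h)"
    by (rule cu1) (assumption, intro continuous_intros isCont_Re cl')
  ultimately show "continuous_on UNIV (\<lambda>(t, h). cutoff tpsi2 c H (\<lambda>z. (Im (l z))\<^sup>2) t h + cutoff tpsi1 c H (\<lambda>z. - Re (l' z)) t h)"
    unfolding split_beta by (rule continuous_on_add)
  fix t h
  \<comment> \<open>\<open>- Im l\<close> is the real part of the holomorphic function
    \<open>\<i> * l\<close>, so the second \<open>h\<close>-derivative is again an instance of
    \<open>DERIV_cutoff\<close>.\<close>
  have dil: "((\<lambda>z. \<i> * l z) has_field_derivative \<i> * l' (Complex t h)) (at (Complex t h))" if "H (Complex t h) \<noteq> 0"
    using dl[OF that] by (rule DERIV_cmult)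
  have D1: "((\<lambda>z. 1 :: complex) has_field_derivative 0) (at (Complex t h))" by simp
  show "((\<lambda>t. cutoff tpsi c H (\<lambda>_. 1) t h) has_real_derivative cutoff tpsi1 c H (\<lambda>z. Re (l z)) t h) (at t)"
    using DERIV_cutoff(1)[OF H c psi0 D1] by (simp add: cutoff_def l)
  show "(cutoff tpsi c H (\<lambda>_. 1) t has_real_derivative cutoff tpsi1 c H (\<lambda>z. - Im (l z)) t h) (at h)"
    using DERIV_cutoff(2)[OF H c psi0 D1] by (simp add: cutoff_def l)
  show "((\<lambda>t. cutoff tpsi1 c H (\<lambda>z. Re (l z)) t h) has_real_derivative
     cutoff tpsi2 c H (\<lambda>z. (Re (l z))\<^sup>2) t h + cutoff tpsi1 c H (\<lambda>z. Re (l' z)) t h) (at t)"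
    using DERIV_cutoff(1)[OF H c psi1 dl] by (simp add: cutoff_def l[symmetric] power2_eq_square mult.assoc)
  show "(cutoff tpsi1 c H (\<lambda>z. - Im (l z)) t has_real_derivative
     cutoff tpsi2 c H (\<lambda>z. (Im (l z))\<^sup>2) t h + cutoff tpsi1 c H (\<lambda>z. - Re (l' z)) t h) (at h)"
    using DERIV_cutoff(2)[OF H c psi1 dil] by (simp add: cutoff_def l[symmetric] power2_eq_square mult.assoc)
  show "0 \<le> cutoff tpsi c H (\<lambda>_. 1) t h" by (simp add: cutoff_def tpsi_nonneg)
  show "0 \<le> cutoff tpsi2 c H (\<lambda>z. (Re (l z))\<^sup>2) t h + cutoff tpsi1 c H (\<lambda>z. Re (l' z)) t h +
      (cutoff tpsi2 c H (\<lambda>z. (Im (l z))\<^sup>2) t h + cutoff tpsi1 c H (\<lambda>z. - Re (l' z)) t h)"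
    by (simp add: cutoff_def tpsi_nonneg)
  have Cper: "Complex t (h + 2 * pi) = Complex t h + 2 * of_real pi * \<i>" by (simp add: complex_eq_iff)
  have per': "H' (z + 2 * of_real pi * \<i>) = H' z" for z
  proof -
    have "((\<lambda>z. H (z + 2 * of_real pi * \<i>)) has_field_derivative H' (z + 2 * of_real pi * \<i>)) (at z)"
      using H[of "z + 2 * of_real pi * \<i>"] unfolding DERIV_shift .
    thus ?thesis unfolding per using H DERIV_unique by blast
  qed
  show "cutoff tpsi c H (\<lambda>_. 1) t (h + 2 * pi) = cutoff tpsi c H (\<lambda>_. 1) t h"
    "cutoff tpsi1 c H (\<lambda>z. - Im (l z)) t (h + 2 * pi) = cutoff tpsi1 c H (\<lambda>z. - Im (l z)) t h"
    by (simp_all add: cutoff_def Cper per per' l)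
  assume t: "t \<le> 0"
  have "norm (H (Complex t h)) \<le> exp c" using t by (intro small) simp
  hence "ln (norm (H (Complex t h))) - c \<le> 0"
    using c ln_le_cancel_iff[of "norm (H (Complex t h))" "exp c"] by (cases "H (Complex t h) = 0") simp_all
  from tpsi_left(1)[OF this] show "cutoff tpsi c H (\<lambda>_. 1) t h = 0" unfolding cutoff_def by (simp only: mult_zero_left)
qed

text \<open>Since \<open>\<psi>\<close> is convex and \<open>log|f(e\<^bsup>t+i\<theta>\<^esup>)|\<close> is harmonic off the zeros of \<open>f\<close>, this function is subharmonic in \<open>(t, \<theta>)\<close>.\<close>

definition tract_fun :: "(complex \<Rightarrow> complex) \<Rightarrow> real \<Rightarrow> real \<Rightarrow> real \<Rightarrow> real" where
  "tract_fun f c t h = tpsi (ln (norm (f (exp (Complex t h)))) - c)"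

lemma tract_entire:
  fixes f :: "complex \<Rightarrow> complex"
  assumes f: "f holomorphic_on UNIV" and c: "c \<ge> 0" and small: "\<And>z. norm z \<le> 1 \<Longrightarrow> norm (f z) \<le> exp c"
  obtains ut uh utt uhh where "tract (tract_fun f c) ut uh utt uhh"
proof -
  define H where "H = (\<lambda>z. f (exp z))"
  have hH: "H holomorphic_on UNIV" unfolding H_def
    using holomorphic_on_compose[of exp UNIV f] f by (simp add: o_def holomorphic_on_exp holomorphic_on_subset)
  have hH': "deriv H holomorphic_on UNIV" by (intro holomorphic_deriv hH open_UNIV)
  have hl: "(\<lambda>z. deriv H z / H z) holomorphic_on {z. H z \<noteq> 0}"
    by (intro holomorphic_on_divide holomorphic_on_subset[OF hH'] holomorphic_on_subset[OF hH]) auto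
  have o: "open {z. H z \<noteq> 0}"
    by (rule open_Collect_neq[OF holomorphic_on_imp_continuous_on[OF hH] continuous_on_const])
  have "tract (cutoff tpsi c H (\<lambda>_. 1)) (cutoff tpsi1 c H (\<lambda>z. Re (deriv H z / H z))) (cutoff tpsi1 c H (\<lambda>z. - Im (deriv H z / H z)))
     (\<lambda>t h. cutoff tpsi2 c H (\<lambda>z. (Re (deriv H z / H z))\<^sup>2) t h + cutoff tpsi1 c H (\<lambda>z. Re (deriv (\<lambda>z. deriv H z / H z) z)) t h)
     (\<lambda>t h. cutoff tpsi2 c H (\<lambda>z. (Im (deriv H z / H z))\<^sup>2) t h + cutoff tpsi1 c H (\<lambda>z. - Re (deriv (\<lambda>z. deriv H z / H z) z)) t h)"
  proof (rule tract_cutoff[where H' = "deriv H", OF _ c refl])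
    show "(H has_field_derivative deriv H z) (at z)" for z
      using hH by (intro holomorphic_derivI[of _ UNIV]) auto
    fix z assume z: "H z \<noteq> 0"
    show "((\<lambda>z. deriv H z / H z) has_field_derivative deriv (\<lambda>z. deriv H z / H z) z) (at z)"
      using z by (intro holomorphic_derivI[OF hl o]) auto
    have "deriv (\<lambda>z. deriv H z / H z) holomorphic_on {z. H z \<noteq> 0}" by (intro holomorphic_deriv hl o)
    thus "isCont (deriv (\<lambda>z. deriv H z / H z)) z"
      using z o by (intro continuous_on_interior[OF holomorphic_on_imp_continuous_on]) (auto simp: interior_open)
  qed (use small in \<open>auto simp: H_def exp_add\<close>)
  moreover have "cutoff tpsi c H (\<lambda>_. 1) = tract_fun f c" by (simp add: H_def tract_fun_def cutoff_def fun_eq_iff)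
  ultimately show ?thesis using that by simp
qed

section \<open>Two tracts of entire functions\<close>

definition zero_exp_type :: "(complex \<Rightarrow> complex) \<Rightarrow> bool" where
  "zero_exp_type f \<longleftrightarrow> (\<forall>\<epsilon>>0. \<exists>C. \<forall>z. norm (f z) \<le> C * exp (\<epsilon> * norm z))"

lemma tract_fun_growth:
  assumes f: "zero_exp_type f" and c: "c \<ge> 0" and \<epsilon>: "\<epsilon> > 0"
  shows "\<exists>C. \<forall>t h. tract_fun f c t h \<le> \<epsilon> * exp t + C"
proof -
  obtain C where C: "\<And>z. norm (f z) \<le> C * exp (\<epsilon> * norm z)" using f \<epsilon> by (auto simp: zero_exp_type_def)
  have "tract_fun f c t h \<le> \<epsilon> * exp t + ln (\<bar>C\<bar> + 1)" for t h
  proof -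
    define z where "z = exp (Complex t h)"
    have z: "norm z = exp t" by (simp add: z_def)
    have "ln (norm (f z)) \<le> \<epsilon> * exp t + ln (\<bar>C\<bar> + 1)"
    proof (cases "f z = 0")
      case False
      have "norm (f z) \<le> (\<bar>C\<bar> + 1) * exp (\<epsilon> * norm z)"
        by (rule order_trans[OF C]) (intro mult_right_mono, auto)
      hence "ln (norm (f z)) \<le> ln ((\<bar>C\<bar> + 1) * exp (\<epsilon> * norm z))" using False by (subst ln_le_cancel_iff) auto
      also have "\<dots> = ln (\<bar>C\<bar> + 1) + \<epsilon> * exp t" by (subst ln_mult) (auto simp: z)
      finally show ?thesis by simp
    qed (use \<epsilon> in auto)
    moreover have "0 \<le> \<epsilon> * exp t + ln (\<bar>C\<bar> + 1)" using \<epsilon> by auto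
    ultimately have "max 0 (ln (norm (f z)) - c) \<le> \<epsilon> * exp t + ln (\<bar>C\<bar> + 1)" using c by auto
    thus ?thesis unfolding tract_fun_def z_def[symmetric] using tpsi_le order_trans by blast
  qed
  thus ?thesis by blast
qed

lemma entire_bounded_cball:
  assumes "f holomorphic_on UNIV"
  obtains B :: real where "B > 0" "\<And>z. norm z \<le> R \<Longrightarrow> norm (f z) \<le> B"
proof -
  have "bounded (f ` cball 0 R)"
    using assms by (intro compact_imp_bounded compact_continuous_image holomorphic_on_imp_continuous_on compact_cball)
       (auto intro: holomorphic_on_subset)
  thus ?thesis using that by (auto simp: bounded_pos)
qed

text \<open>\<open>tpsi\<close> is positive for positive arguments, so a vanishing cut-off means
  that \<open>exp c\<close> bounds |f| off 0, and Liouville applies.\<close>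

lemma entire_bounded_tract_const:
  assumes f: "f holomorphic_on UNIV" and 0: "\<forall>t. \<forall>h\<in>{0..2 * pi}. tract_fun f c t h = 0"
  shows "\<exists>a. \<forall>z. f z = a"
proof -
  have "norm (f z) \<le> max (exp c) (norm (f 0))" for z
  proof (cases "z = 0 \<or> f z = 0")
    case False
    define t where "t = ln (norm z)"
    have "exp (Complex t (Arg2pi z)) = of_real (norm z) * exp (\<i> * of_real (Arg2pi z))"
      using False by (simp add: Complex_eq exp_add t_def exp_of_real)
    hence z: "z = exp (Complex t (Arg2pi z))" using Arg2pi_eq[of z] by simp
    have "tract_fun f c t (Arg2pi z) = 0"
      using 0 Arg2pi_ge_0[of z] Arg2pi_lt_2pi[of z] by auto
    hence "ln (norm (f z)) - c \<le> 0"
      unfolding tract_fun_def z[symmetric] using tpsi_pos[of "ln (norm (f z)) - c"] by linarith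
    hence "exp (ln (norm (f z))) \<le> exp c" unfolding exp_le_cancel_iff by linarith
    moreover have "exp (ln (norm (f z))) = norm (f z)" using False by simp
    ultimately have "norm (f z) \<le> exp c" by (simp only:)
    thus ?thesis by simp
  qed (auto simp: le_max_iff_disj)
  hence "bounded (range f)" by (auto simp: bounded_iff)
  thus ?thesis using Liouville_theorem[OF f] by (auto simp: constant_on_def)
qed

text \<open>\<open>exp c\<close> is taken above \<open>B\<close> and above both functions on the
  unit disc: the first makes the supports of the two cut-offs disjoint off \<open>E\<close>, the
  second makes both vanish for t at most 0.\<close>

lemma two_tract_entire:
  assumes f: "f holomorphic_on UNIV" "zero_exp_type f" and g: "g holomorphic_on UNIV" "zero_exp_type g"
    and E: "E \<in> lmeasurable"
    and min: "\<And>z. z \<noteq> 0 \<Longrightarrow> ln (norm z) \<notin> E \<Longrightarrow> norm (f z) \<le> B \<or> norm (g z) \<le> B"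
  shows "(\<exists>a. \<forall>z. f z = a) \<or> (\<exists>a. \<forall>z. g z = a)"
proof -
  obtain Bf where Bf: "\<And>z. norm z \<le> 1 \<Longrightarrow> norm (f z) \<le> Bf" using entire_bounded_cball[OF f(1)] by metis
  obtain Bg where Bg: "\<And>z. norm z \<le> 1 \<Longrightarrow> norm (g z) \<le> Bg" using entire_bounded_cball[OF g(1)] by metis
  define M where "M = max 1 (max B (max Bf Bg))"
  define c where "c = ln M"
  have c: "c \<ge> 0" "exp c = M" by (auto simp: c_def M_def)
  have le: "norm (f z) \<le> exp c" "norm (g z) \<le> exp c" if "norm z \<le> 1" for z
    using Bf[OF that] Bg[OF that] unfolding c(2) M_def by linarith+
  obtain ut uh utt uhh where A: "tract (tract_fun f c) ut uh utt uhh"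
    by (rule tract_entire[OF f(1) c(1) le(1)])
  obtain wt wh wtt whh where B: "tract (tract_fun g c) wt wh wtt whh"
    by (rule tract_entire[OF g(1) c(1) le(2)])
  have van: "tpsi (ln (norm w) - c) = 0" if "norm w \<le> B" for w :: complex
  proof (cases "w = 0")
    case False
    have "ln (norm w) \<le> c" unfolding c_def using that False by (subst ln_le_cancel_iff) (auto simp: M_def)
    thus ?thesis by (simp add: tpsi_left)
  qed (use c in \<open>simp add: tpsi_left\<close>)
  have "(\<forall>t. \<forall>h\<in>{0..2 * pi}. tract_fun f c t h = 0) \<or> (\<forall>t. \<forall>h\<in>{0..2 * pi}. tract_fun g c t h = 0)"
  proof (rule two_tracts[OF A B E])
    fix t h assume "t \<notin> E"
    hence "norm (f (exp (Complex t h))) \<le> B \<or> norm (g (exp (Complex t h))) \<le> B" by (intro min) auto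
    thus "tract_fun f c t h = 0 \<or> tract_fun g c t h = 0" unfolding tract_fun_def using van by blast
  qed (use tract_fun_growth f g c in blast)+
  thus ?thesis using entire_bounded_tract_const f g by blast
qed

definition diff_quot0 :: "(complex \<Rightarrow> complex) \<Rightarrow> complex \<Rightarrow> complex" where
  "diff_quot0 f z = (if z = 0 then deriv f 0 else (f z - f 0) / z)"

lemma diff_quot0_holomorphic: "f holomorphic_on UNIV \<Longrightarrow> diff_quot0 f holomorphic_on UNIV"
  using pole_lemma_open[of f UNIV 0] unfolding diff_quot0_def[abs_def] diff_zero by simp

lemma diff_quot0_eq: "f z = f 0 + z * diff_quot0 f z"
  by (simp add: diff_quot0_def)

lemma zero_exp_type_diff_quot0:
  assumes f: "f holomorphic_on UNIV" "zero_exp_type f"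
  shows "zero_exp_type (diff_quot0 f)"
  unfolding zero_exp_type_def
proof (intro allI impI)
  fix \<epsilon> :: real assume \<epsilon>: "\<epsilon> > 0"
  obtain C where C: "\<And>z. norm (f z) \<le> C * exp (\<epsilon> * norm z)" using f \<epsilon> by (auto simp: zero_exp_type_def)
  obtain B where B: "B > 0" "\<And>z. norm z \<le> 1 \<Longrightarrow> norm (diff_quot0 f z) \<le> B"
    using entire_bounded_cball[OF diff_quot0_holomorphic[OF f(1)]] by metis
  have "norm (diff_quot0 f z) \<le> (B + C + norm (f 0)) * exp (\<epsilon> * norm z)" for z
  proof -
    have e1: "1 \<le> exp (\<epsilon> * norm z)" using \<epsilon> by simp
    have C0: "C \<ge> 0" using C[of 0] norm_ge_zero[of "f 0"] by (simp del: norm_ge_zero)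
    show ?thesis
    proof (cases "norm z \<le> 1")
      case True
      have "B * 1 \<le> (B + C + norm (f 0)) * exp (\<epsilon> * norm z)"
        using e1 C0 B(1) by (intro mult_mono) auto
      thus ?thesis using B(2)[OF True] by simp
    next
      case False
      have "norm (f z - f 0) * 1 \<le> norm (f z - f 0) * norm z" using False by (intro mult_left_mono) auto
      hence "norm (f z - f 0) / norm z \<le> norm (f z - f 0)" using False by (subst pos_divide_le_eq) auto
      hence "norm (diff_quot0 f z) \<le> norm (f z - f 0)" using False by (auto simp: diff_quot0_def norm_divide)
      also have "\<dots> \<le> norm (f z) + norm (f 0)" by (rule norm_triangle_ineq4)
      also have "\<dots> \<le> C * exp (\<epsilon> * norm z) + norm (f 0) * exp (\<epsilon> * norm z)"
        using e1 C[of z] mult_left_mono[OF e1, of "norm (f 0)"] by auto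
      also have "\<dots> \<le> (B + C + norm (f 0)) * exp (\<epsilon> * norm z)"
        using B(1) by (simp add: algebra_simps)
      finally show ?thesis .
    qed
  qed
  thus "\<exists>C. \<forall>z. norm (diff_quot0 f z) \<le> C * exp (\<epsilon> * norm z)" by blast
qed

text \<open>A property of polynomials that is weak enough to pass from \<open>diff_quot0 f\<close>
  back to \<open>f\<close>, yet strong enough to rule out that \<open>f\<close> is nonzero and small
  on large circles.\<close>

definition zero_or_large :: "(complex \<Rightarrow> complex) \<Rightarrow> bool" where
  "zero_or_large f \<longleftrightarrow> (\<forall>z. f z = 0) \<or> (\<exists>c>0. \<exists>R. \<forall>z. norm z \<ge> R \<longrightarrow> norm (f z) \<ge> c)"

lemma zero_or_large_const: "\<forall>z. f z = a \<Longrightarrow> zero_or_large f"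
  by (cases "a = 0") (auto simp: zero_or_large_def intro!: exI[of _ "norm a"])

lemma zero_or_large_diff_quot0:
  assumes "zero_or_large (diff_quot0 f)"
  shows "zero_or_large f"
  using assms unfolding zero_or_large_def[of "diff_quot0 f"]
proof
  assume "\<forall>z. diff_quot0 f z = 0"
  hence "\<forall>z. f z = f 0" using diff_quot0_eq[of f] by (metis add.right_neutral mult_zero_right)
  thus ?thesis by (rule zero_or_large_const)
next
  assume "\<exists>c>0. \<exists>R. \<forall>z. norm z \<ge> R \<longrightarrow> norm (diff_quot0 f z) \<ge> c"
  then obtain c R where c: "c > 0" "\<And>z. norm z \<ge> R \<Longrightarrow> norm (diff_quot0 f z) \<ge> c" by blast
  have "norm (f z) \<ge> 1" if z: "norm z \<ge> max R ((norm (f 0) + 1) / c)" for z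
  proof -
    have "norm (f 0) + 1 \<le> norm z * c" using z c(1) by (simp add: field_simps)
    also have "\<dots> \<le> norm z * norm (diff_quot0 f z)" using z c by (intro mult_left_mono) auto
    also have "\<dots> = norm (f z - f 0)" using diff_quot0_eq[of f z] by (simp add: norm_mult)
    also have "\<dots> \<le> norm (f z) + norm (f 0)" by (rule norm_triangle_ineq4)
    finally show ?thesis by simp
  qed
  thus ?thesis unfolding zero_or_large_def
    by (intro disjI2 exI[of _ 1] conjI exI[of _ "max R ((norm (f 0) + 1) / c)"]) auto
qed

text \<open>Each passage to \<open>diff_quot0\<close> lowers the exponent of the bound by one and
  preserves zero exponential type, so the induction ends with a constant bound, where
  \<open>two_tract_entire\<close> makes one function constant.\<close>

theorem two_tract_polynomial:
  assumes f: "f holomorphic_on UNIV" "zero_exp_type f" and g: "g holomorphic_on UNIV" "zero_exp_type g"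
    and E: "E \<in> lmeasurable"
    and min: "\<And>z. norm z \<ge> 1 \<Longrightarrow> ln (norm z) \<notin> E \<Longrightarrow> norm (f z) \<le> B * norm z ^ m \<or> norm (g z) \<le> B * norm z ^ m"
  shows "zero_or_large f \<or> zero_or_large g"
  using f g min
proof (induction m arbitrary: f g B)
  case 0
  obtain Bf where Bf: "\<And>z. norm z \<le> 1 \<Longrightarrow> norm (f z) \<le> Bf" using entire_bounded_cball[OF 0(1)] by metis
  have "(\<exists>a. \<forall>z. f z = a) \<or> (\<exists>a. \<forall>z. g z = a)"
  proof (rule two_tract_entire[OF 0(1-4) E, of "max B Bf"])
    fix z :: complex assume "z \<noteq> 0" "ln (norm z) \<notin> E"
    thus "norm (f z) \<le> max B Bf \<or> norm (g z) \<le> max B Bf"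
      using 0(5)[of z] Bf[of z] by (cases "norm z \<le> 1") auto
  qed
  thus ?case using zero_or_large_const by blast
next
  case (Suc m)
  have *: "norm (diff_quot0 h z) \<le> (\<bar>B\<bar> + norm (f 0) + norm (g 0)) * norm z ^ m"
    if z: "norm z \<ge> 1" and le: "norm (h z) \<le> B * norm z ^ Suc m" and h0: "h 0 = f 0 \<or> h 0 = g 0" for h z
  proof -
    have "z \<noteq> 0" using z by auto
    hence "norm (diff_quot0 h z) = norm (h z - h 0) / norm z" by (simp add: diff_quot0_def norm_divide)
    also have "\<dots> \<le> (\<bar>B\<bar> * norm z ^ Suc m + (norm (f 0) + norm (g 0)) * norm z ^ Suc m) / norm z"
    proof (intro divide_right_mono order_trans[OF norm_triangle_ineq4] add_mono)
      show "norm (h z) \<le> \<bar>B\<bar> * norm z ^ Suc m"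
        by (rule order_trans[OF le mult_right_mono]) auto
      have "norm (h 0) * 1 \<le> (norm (f 0) + norm (g 0)) * norm z ^ Suc m"
        using h0 one_le_power[OF z, of "Suc m"] by (intro mult_mono) (auto simp del: power_Suc)
      thus "norm (h 0) \<le> (norm (f 0) + norm (g 0)) * norm z ^ Suc m" by simp
    qed auto
    also have "\<dots> = (\<bar>B\<bar> + norm (f 0) + norm (g 0)) * norm z ^ m"
      using \<open>z \<noteq> 0\<close> by (simp add: field_simps)
    finally show ?thesis .
  qed
  have "zero_or_large (diff_quot0 f) \<or> zero_or_large (diff_quot0 g)"
  proof (rule Suc.IH)
    fix z :: complex assume "norm z \<ge> 1" "ln (norm z) \<notin> E"
    with Suc.prems(5)[OF this] *[of z f] *[of z g]
    show "norm (diff_quot0 f z) \<le> (\<bar>B\<bar> + norm (f 0) + norm (g 0)) * norm z ^ m \<or>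
       norm (diff_quot0 g z) \<le> (\<bar>B\<bar> + norm (f 0) + norm (g 0)) * norm z ^ m" by blast
  qed (use Suc.prems in \<open>auto intro: diff_quot0_holomorphic zero_exp_type_diff_quot0\<close>)
  thus ?case using zero_or_large_diff_quot0 by blast
qed

section \<open>Quotients of holomorphic functions\<close>

text \<open>The Schwarz lemma is applied to the Cayley transform of a logarithm of \<open>G\<close>.\<close>

lemma harnack_zero_free:
  assumes G: "G holomorphic_on ball 0 1" and nz: "\<And>z. z \<in> ball 0 1 \<Longrightarrow> G z \<noteq> 0"
    and lt: "\<And>z. z \<in> ball 0 1 \<Longrightarrow> norm (G z) < 1" and z: "norm z < 1"
  shows "- ln (norm (G z)) \<le> - ln (norm (G 0)) * ((1 + norm z) / (1 - norm z))"
proof -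
  obtain g where g: "g holomorphic_on ball 0 1" "\<And>z. z \<in> ball 0 1 \<Longrightarrow> exp (g z) = G z"
    using holomorphic_logarithm_exists[OF convex_ball open_ball G nz, of 0] by auto
  \<comment> \<open>Minus the logarithm of \<open>G\<close>, shifted by an imaginary constant so
    that \<open>k 0\<close> is the positive number \<open>a\<close>; the Cayley transform then
    vanishes at 0, as Schwarz's lemma demands.\<close>
  define k where "k = (\<lambda>z. \<i> * of_real (Im (g 0)) - g z)"
  define a where "a = - Re (g 0)"
  have Rek: "Re (k z) = - ln (norm (G z))" "Re (k z) > 0" if "z \<in> ball 0 1" for z
  proof -
    have "norm (G z) = exp (Re (g z))" using g(2)[OF that] by (metis norm_exp_eq_Re)
    thus "Re (k z) = - ln (norm (G z))" by (simp add: k_def)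
    thus "Re (k z) > 0" using lt[OF that] nz[OF that] by (simp add: ln_less_zero)
  qed
  have k0: "k 0 = of_real a" by (simp add: k_def a_def complex_eq_iff)
  have a: "a > 0" "a = - ln (norm (G 0))" using Rek[of 0] by (auto simp: k0)
  define \<phi> where "\<phi> = (\<lambda>z. (k z - of_real a) / (k z + of_real a))"
  have nz': "k z + of_real a \<noteq> 0" if "z \<in> ball 0 1" for z
  proof
    assume "k z + of_real a = 0"
    hence "Re (k z) + a = 0" by (simp add: complex_eq_iff)
    thus False using Rek(2)[OF that] a(1) by simp
  qed
  have "norm (\<phi> z) \<le> norm z"
  proof (rule Schwarz_Lemma(1))
    show "\<phi> holomorphic_on ball 0 1"
      unfolding \<phi>_def k_def using nz' by (intro holomorphic_intros g) (auto simp: k_def)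
    show "\<phi> 0 = 0" by (simp add: \<phi>_def k0)
    fix z :: complex assume z: "norm z < 1"
    have "(norm (k z - of_real a))\<^sup>2 < (norm (k z + of_real a))\<^sup>2"
      using mult_pos_pos[OF Rek(2)[of z] a(1)] z unfolding cmod_power2
      by (simp add: power2_eq_square algebra_simps)
    hence "norm (k z - of_real a) < norm (k z + of_real a)" by (rule power_less_imp_less_base) simp
    thus "norm (\<phi> z) < 1" using nz'[of z] z by (simp add: \<phi>_def norm_divide)
  qed (use z in auto)
  have kz: "k z * (1 - \<phi> z) = of_real a * (1 + \<phi> z)"
    using nz'[of z] z by (simp add: \<phi>_def field_simps)
  have "norm (k z) * (1 - norm z) \<le> norm (k z) * norm (1 - \<phi> z)"
    using norm_triangle_ineq2[of 1 "\<phi> z"] \<open>norm (\<phi> z) \<le> norm z\<close> by (intro mult_left_mono) auto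
  also have "\<dots> = a * norm (1 + \<phi> z)" using arg_cong[OF kz, of norm] a(1) by (simp add: norm_mult)
  also have "\<dots> \<le> a * (1 + norm z)"
    using norm_triangle_ineq[of 1 "\<phi> z"] \<open>norm (\<phi> z) \<le> norm z\<close> a(1) by (intro mult_left_mono) auto
  finally have "norm (k z) \<le> a * ((1 + norm z) / (1 - norm z))" using z by (simp add: field_simps)
  thus ?thesis using Rek(1)[of z] complex_Re_le_cmod[of "k z"] z by (simp add: a(2))
qed

lemma maximum_modulus_unit_disc:
  assumes "f holomorphic_on ball 0 R" "R > 1" "\<And>z. norm z = 1 \<Longrightarrow> norm (f z) \<le> B" "norm z < 1"
  shows "norm (f z) \<le> B"
proof (rule maximum_modulus_frontier[of f "ball 0 1"])
  show "f holomorphic_on interior (ball 0 1)" "continuous_on (closure (ball 0 1)) f"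
    using assms(1,2) by (auto intro!: holomorphic_on_imp_continuous_on intro: holomorphic_on_subset)
qed (use assms in auto)

lemma holomorphic_factor_zero_global:
  assumes p: "p holomorphic_on S" "open S" "connected S" and a: "a \<in> S" "p a = 0" and nc: "b \<in> S" "p b \<noteq> 0"
  obtains g and m :: nat where "g holomorphic_on S" "\<And>z. z \<in> S \<Longrightarrow> p z = (z - a) ^ m * g z" "g a \<noteq> 0"
proof -
  have "\<not> p constant_on S" using a nc by (metis constant_on_def)
  from holomorphic_factor_zero_nonconstant[OF p a this]
  obtain g r m where g: "0 < m" "0 < r" "ball a r \<subseteq> S" "g holomorphic_on ball a r"
      "\<And>w. w \<in> ball a r \<Longrightarrow> p w = (w - a) ^ m * g w" "\<And>w. w \<in> ball a r \<Longrightarrow> g w \<noteq> 0"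
    by metis
  define h where "h = (\<lambda>z. if z \<in> ball a r then g z else p z / (z - a) ^ m)"
  have eq: "h z = p z / (z - a) ^ m" if "z \<noteq> a" for z
    using that g(5)[of z] by (auto simp: h_def)
  have "h holomorphic_on ball a r \<union> (S - {a})"
  proof (rule holomorphic_on_Un)
    show "h holomorphic_on ball a r" by (rule holomorphic_transform[OF g(4)]) (auto simp: h_def)
    have "(\<lambda>z. p z / (z - a) ^ m) holomorphic_on (S - {a})"
      by (intro holomorphic_intros holomorphic_on_subset[OF p(1)]) auto
    thus "h holomorphic_on S - {a}" by (rule holomorphic_transform) (auto simp: eq)
  qed (use p(2) in \<open>auto intro: open_delete\<close>)
  also have "ball a r \<union> (S - {a}) = S" using g a by auto
  finally have "h holomorphic_on S" .
  moreover have "p z = (z - a) ^ m * h z" if "z \<in> S" for z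
    using that g(1) a by (cases "z = a") (auto simp: eq)
  moreover have "h a \<noteq> 0" using g by (auto simp: h_def)
  ultimately show ?thesis using that by blast
qed

text \<open>Zeros of the denominator are removed one at a time: dividing by a Blaschke factor does not change the
  moduli on the circle and increases \<open>|p 0|\<close>.\<close>

lemma quotient_bound_unit_disc:
  assumes R: "R > 1" and f: "f holomorphic_on ball 0 R" and p: "p holomorphic_on ball 0 R"
    and p1: "\<And>z. norm z = 1 \<Longrightarrow> norm (p z) \<le> 1 / 2" and fp: "\<And>z. norm z = 1 \<Longrightarrow> norm (f z * p z) \<le> 1 / 2"
    and p0: "p 0 \<noteq> 0" and z: "norm z < 1"
  shows "norm (f z) \<le> exp (- ln (norm (p 0)) * ((1 + norm z) / (1 - norm z)))"
proof -
  define Zs where "Zs p = {z \<in> ball 0 1. p z = 0}" for p :: "complex \<Rightarrow> complex"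
  have fin: "finite (Zs p)" if "p holomorphic_on ball 0 R" "p 0 \<noteq> 0" for p
  proof (cases "p constant_on ball 0 R")
    case True
    hence "Zs p = {}" using that R by (force simp: constant_on_def Zs_def)
    thus ?thesis by simp
  next
    case False
    have "finite {z \<in> cball 0 1. p z = 0}"
      by (rule holomorphic_compact_finite_zeros[OF that(1) open_ball connected_ball compact_cball _ False]) (use R in auto)
    thus ?thesis by (rule finite_subset[rotated]) (auto simp: Zs_def)
  qed
  have "norm (f z) \<le> exp (- ln (norm (p 0)) * ((1 + norm z) / (1 - norm z)))" 
    if "card (Zs p) = n" "p holomorphic_on ball 0 R" "\<And>z. norm z = 1 \<Longrightarrow> norm (p z) \<le> 1 / 2" 
      "\<And>z. norm z = 1 \<Longrightarrow> norm (f z * p z) \<le> 1 / 2" "p 0 \<noteq> 0" for n p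
    using that
  proof (induction n arbitrary: p)
    case 0
    have nz: "p z \<noteq> 0" if "z \<in> ball 0 1" for z
      using 0(1) fin[OF 0(2,5)] that by (auto simp: Zs_def)
    \<comment> \<open>The bound 1/2 survives inside the disc and yields the strict inequality
      \<open>< 1\<close> of \<open>harnack_zero_free\<close>.\<close>
    have le: "norm (p z) \<le> 1 / 2" if "norm z < 1" for z
      by (rule maximum_modulus_unit_disc[OF 0(2) R 0(3) that])
    have ge: "- ln (norm (p z)) \<le> - ln (norm (p 0)) * ((1 + norm z) / (1 - norm z))"
    proof (rule harnack_zero_free)
      show "p holomorphic_on ball 0 1" using 0(2) R by (auto intro: holomorphic_on_subset)
      show "norm (p z) < 1" if "z \<in> ball 0 1" for z using le[of z] that by simp
    qed (use nz z in auto)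
    have "norm (f z * p z) \<le> 1 / 2"
      by (rule maximum_modulus_unit_disc[OF holomorphic_on_mult[OF f 0(2)] R 0(4) z])
    hence "norm (f z) \<le> 1 / norm (p z)" using nz[of z] z by (simp add: norm_mult field_simps)
    also have "\<dots> = exp (- ln (norm (p z)))" using nz[of z] z by (simp add: exp_minus inverse_eq_divide)
    also have "\<dots> \<le> exp (- ln (norm (p 0)) * ((1 + norm z) / (1 - norm z)))" using ge by simp
    finally show ?case .
  next
    case (Suc n)
    then obtain a where a: "a \<in> Zs p" by fastforce
    hence a': "norm a < 1" "p a = 0" "a \<noteq> 0" using Suc.prems(5) by (auto simp: Zs_def)
    obtain g m where g: "g holomorphic_on ball 0 R" "\<And>z. z \<in> ball 0 R \<Longrightarrow> p z = (z - a) ^ m * g z" "g a \<noteq> 0"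
      using holomorphic_factor_zero_global[OF Suc.prems(2) open_ball connected_ball, of a 0] a' R Suc.prems(5) by auto
    \<comment> \<open>The whole factor \<open>(z - a) ^ m\<close> is exchanged at once, so the
      number of distinct zeros in the disc drops by exactly one whatever the multiplicity.\<close>
    define q where "q = (\<lambda>z. g z * (1 - cnj a * z) ^ m)"
    have nz: "1 - cnj a * z \<noteq> 0" if "norm z \<le> 1" for z
    proof
      assume "1 - cnj a * z = 0"
      hence "norm a * norm z = 1" by (metis complex_mod_cnj eq_iff_diff_eq_0 norm_mult norm_one)
      thus False using a'(1) that mult_mono[of "norm a" "norm a" "norm z" 1] by simp
    qed
    have Zq: "Zs q = Zs p - {a}"
      using g(2,3) R nz by (auto simp: Zs_def q_def)
    have nq: "norm (q z) = norm (p z)" if "norm z = 1" for z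
    proof -
      have "norm (z - a) = norm (1 - cnj a * z)"
      proof -
        have "z * cnj z = 1" using that complex_norm_square[of z] by simp
        hence "1 - cnj a * z = z * cnj (z - a)" by (simp add: algebra_simps)
        thus ?thesis using that by (simp add: norm_mult del: complex_cnj_diff)
      qed
      thus ?thesis using g(2)[of z] that R by (simp add: q_def norm_mult norm_power)
    qed
    have "norm (p 0) = norm a ^ m * norm (g 0)" using g(2)[of 0] R by (simp add: norm_mult norm_power)
    also have "\<dots> \<le> 1 * norm (g 0)" using a' by (intro mult_right_mono power_le_one) auto
    finally have q0: "norm (p 0) \<le> norm (q 0)" by (simp add: q_def)
    have "norm (f z) \<le> exp (- ln (norm (q 0)) * ((1 + norm z) / (1 - norm z)))"
    proof (rule Suc.IH)
      show "card (Zs q) = n" using a Suc.prems(1) fin[OF Suc.prems(2,5)] by (simp add: Zq)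
      show "q holomorphic_on ball 0 R" unfolding q_def by (intro holomorphic_intros g)
      show "norm (q z) \<le> 1 / 2" "norm (f z * q z) \<le> 1 / 2" if "norm z = 1" for z
        using Suc.prems(3,4)[OF that] nq[OF that] by (simp_all add: norm_mult)
      show "q 0 \<noteq> 0" using q0 Suc.prems(5) by auto
    qed
    also have "\<dots> \<le> exp (- ln (norm (p 0)) * ((1 + norm z) / (1 - norm z)))"
    proof -
      have "ln (norm (p 0)) \<le> ln (norm (q 0))"
        using q0 Suc.prems(5) by (intro iffD2[OF ln_le_cancel_iff]) auto
      thus ?thesis unfolding exp_le_cancel_iff using z by (intro mult_right_mono) auto
    qed
    finally show ?case .
  qed
  thus ?thesis using p p1 fp p0 by blast
qed

lemma powr_add_le:
  fixes x y \<sigma> :: real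
  assumes "x \<ge> 0" "y \<ge> 0" "\<sigma> > 0"
  shows "(x + y) powr \<sigma> \<le> 2 powr \<sigma> * (x powr \<sigma> + y powr \<sigma>)"
proof -
  have "(x + y) powr \<sigma> \<le> (2 * max x y) powr \<sigma>" using assms by (intro powr_mono2) auto
  also have "\<dots> = 2 powr \<sigma> * max x y powr \<sigma>" using assms by (subst powr_mult) auto
  also have "\<dots> \<le> 2 powr \<sigma> * (x powr \<sigma> + y powr \<sigma>)" by (intro mult_left_mono) (auto simp: max_def)
  finally show ?thesis .
qed

text \<open>Rescaling the disc about \<open>z0\<close> of radius \<open>2 norm (z - z0) + 1\<close>
  to the unit disc puts \<open>z\<close> at distance at most 1/2 from the centre, where the Harnack
  factor is at most 3. The factor \<open>4 powr \<sigma>\<close> comes from two doublings: that of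
  the radius and the one in \<open>powr_add_le\<close>.\<close>

lemma quotient_entire_growth:
  assumes f: "f holomorphic_on UNIV" and p: "p holomorphic_on UNIV" and p0: "p z0 \<noteq> 0" and \<sigma>: "\<sigma> > 0" and \<kappa>: "\<kappa> \<ge> 0"
    and pb: "\<And>z. norm (p z) \<le> C * exp (\<kappa> * norm z powr \<sigma>)"
    and fpb: "\<And>z. norm (f z * p z) \<le> C * exp (\<kappa> * norm z powr \<sigma>)"
  shows "\<exists>C'. \<forall>z. norm (f z) \<le> C' * exp (3 * 4 powr \<sigma> * \<kappa> * norm z powr \<sigma>)"
proof -
  have C: "C > 0"
  proof -
    have "0 < norm (p z0)" using p0 by simp
    also note pb[of z0]
    finally show ?thesis by (simp add: zero_less_mult_iff)
  qed
  define b where "b = 3 * norm z0 + 1"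
  have "norm (f z) \<le> exp (3 * (ln (2 * C) - ln (norm (p z0)) + \<kappa> * 2 powr \<sigma> * b powr \<sigma>)) * exp (3 * 4 powr \<sigma> * \<kappa> * norm z powr \<sigma>)" for z
  proof -
    define \<rho> where "\<rho> = 2 * norm (z - z0) + 1"
    have \<rho>: "\<rho> > 0" by (simp add: \<rho>_def add_nonneg_pos)
    define M where "M = C * exp (\<kappa> * (norm z0 + \<rho>) powr \<sigma>)"
    have M: "M > 0" using C by (simp add: M_def)
    define s where "s = (z - z0) / of_real \<rho>"
    have s: "norm s \<le> 1 / 2" 
    proof -
      have "norm s = norm (z - z0) / \<rho>" using \<rho> by (simp add: s_def norm_divide)
      also have "\<dots> \<le> 1 / 2" using \<rho> by (subst pos_divide_le_eq) (simp_all add: \<rho>_def)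
      finally show ?thesis .
    qed
    define P where "P = (\<lambda>s. p (z0 + of_real \<rho> * s) / (2 * of_real M))"
    have le: "C * exp (\<kappa> * norm (z0 + of_real \<rho> * s) powr \<sigma>) \<le> M" if "norm s = 1" for s
      unfolding M_def using C \<kappa> \<sigma> \<rho> norm_triangle_ineq[of z0 "of_real \<rho> * s"] that
      by (intro mult_left_mono iffD2[OF exp_le_cancel_iff] powr_mono2) (auto simp: norm_mult)
    have hol: "(\<lambda>s. h (z0 + of_real \<rho> * s)) holomorphic_on ball 0 2" if "h holomorphic_on UNIV" for h
      using holomorphic_on_compose_gen[of "\<lambda>s. z0 + of_real \<rho> * s" "ball 0 2" h UNIV] that
      by (simp add: o_def holomorphic_intros)
    have P0: "norm (P 0) = norm (p z0) / (2 * M)" using M by (simp add: P_def norm_divide)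
    have "norm (f (z0 + of_real \<rho> * s)) \<le> exp (- ln (norm (P 0)) * ((1 + norm s) / (1 - norm s)))"
    proof (rule quotient_bound_unit_disc[of 2 "\<lambda>s. f (z0 + of_real \<rho> * s)" P])
      show "P holomorphic_on ball 0 2" unfolding P_def using M by (intro holomorphic_intros hol p) auto
      show "norm (P s) \<le> 1 / 2" "norm (f (z0 + of_real \<rho> * s) * P s) \<le> 1 / 2" if "norm s = 1" for s
        using order_trans[OF pb le[OF that]] order_trans[OF fpb le[OF that]] M
        by (simp_all add: P_def norm_divide norm_mult)
      show "P 0 \<noteq> 0" using p0 M by (simp add: P_def)
    qed (use s in \<open>auto intro: hol f\<close>)
    also have "z0 + of_real \<rho> * s = z" using \<rho> by (simp add: s_def)
    finally have 1: "norm (f z) \<le> exp (- ln (norm (P 0)) * ((1 + norm s) / (1 - norm s)))" .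
    have lnP: "- ln (norm (P 0)) = ln (2 * C) - ln (norm (p z0)) + \<kappa> * (norm z0 + \<rho>) powr \<sigma>"
      unfolding P0 M_def using C p0 by (simp add: ln_div ln_mult)
    have "norm (P 0) \<le> 1 / 2"
    proof -
      have "norm (p z0) \<le> C * exp (\<kappa> * norm z0 powr \<sigma>)" by (rule pb)
      also have "\<dots> \<le> M" unfolding M_def using C \<kappa> \<sigma> \<rho>
        by (intro mult_left_mono iffD2[OF exp_le_cancel_iff] powr_mono2) auto
      finally show ?thesis using M by (simp add: P0)
    qed
    hence "norm (P 0) \<le> 1" by simp
    hence "ln (norm (P 0)) \<le> 0" using ln_le_cancel_iff[of "norm (P 0)" 1] by (cases "P 0 = 0") simp_all
    hence "- ln (norm (P 0)) * ((1 + norm s) / (1 - norm s)) \<le> - ln (norm (P 0)) * 3"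
      using s by (intro mult_left_mono) (auto simp: divide_le_eq)
    also have "\<dots> = 3 * (ln (2 * C) - ln (norm (p z0)) + \<kappa> * (norm z0 + \<rho>) powr \<sigma>)" unfolding lnP by simp
    finally have 2: "- ln (norm (P 0)) * ((1 + norm s) / (1 - norm s)) \<le> 3 * (ln (2 * C) - ln (norm (p z0)) + \<kappa> * (norm z0 + \<rho>) powr \<sigma>)" .
    have "(norm z0 + \<rho>) powr \<sigma> \<le> (2 * norm z + b) powr \<sigma>"
      using norm_triangle_ineq4[of z z0] \<sigma> \<rho> by (intro powr_mono2) (auto simp: \<rho>_def b_def)
    also have "(2 * norm z + b) powr \<sigma> \<le> 2 powr \<sigma> * ((2 * norm z) powr \<sigma> + b powr \<sigma>)"
      using \<sigma> by (intro powr_add_le) (auto simp: b_def)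
    also have "\<dots> = 4 powr \<sigma> * norm z powr \<sigma> + 2 powr \<sigma> * b powr \<sigma>"
      using powr_mult[of 2 "norm z" \<sigma>] powr_mult[of 2 2 \<sigma>] by (simp add: algebra_simps)
    finally have "\<kappa> * (norm z0 + \<rho>) powr \<sigma> \<le> \<kappa> * (4 powr \<sigma> * norm z powr \<sigma> + 2 powr \<sigma> * b powr \<sigma>)"
      using \<kappa> by (rule mult_left_mono)
    with 2 have "- ln (norm (P 0)) * ((1 + norm s) / (1 - norm s)) \<le>
       3 * (ln (2 * C) - ln (norm (p z0)) + \<kappa> * 2 powr \<sigma> * b powr \<sigma>) + 3 * 4 powr \<sigma> * \<kappa> * norm z powr \<sigma>"
      by (simp add: algebra_simps)
    with 1 show ?thesis by (smt (verit) exp_add exp_le_cancel_iff)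
  qed
  thus ?thesis by blast
qed

text \<open>The Cayley map taking \<open>x0\<close> to 0 carries \<open>z\<close> to
  \<open>s0\<close> with \<open>1 - norm s0 ^ 2 = 4 x0 Re z / norm (z + x0) ^ 2\<close>. In the
  sector \<open>Re z \<ge> \<delta> norm z\<close> this is at least a constant over
  \<open>norm z\<close>, so the Harnack factor grows at most linearly.\<close>

lemma quotient_half_plane_growth:
  assumes f: "f holomorphic_on {z. Re z > 0}" and p: "p holomorphic_on {z. Re z > 0}" and x0: "x0 > 0" "p (of_real x0) \<noteq> 0"
    and pb: "\<And>z. Re z > 0 \<Longrightarrow> norm (p z) \<le> M" and fpb: "\<And>z. Re z > 0 \<Longrightarrow> norm (f z * p z) \<le> M" and \<delta>: "\<delta> > 0"
  shows "\<exists>C\<ge>0. \<forall>z. norm z \<ge> x0 \<and> Re z \<ge> \<delta> * norm z \<longrightarrow> norm (f z) \<le> exp (C * norm z)"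
proof -
  have M: "M > 0" using pb[of "of_real x0"] x0 zero_less_norm_iff[of "p (of_real x0)"] by (simp del: zero_less_norm_iff)
  define P0 where "P0 = norm (p (of_real x0)) / (2 * M)"
  have P0: "P0 > 0" "P0 \<le> 1 / 2" using M x0 pb[of "of_real x0"] by (auto simp: P0_def field_simps)
  have lnP0: "- ln P0 \<ge> 0" using P0 by simp
  have "norm (f z) \<le> exp (- ln P0 * (8 / (x0 * \<delta>)) * norm z)" if z: "norm z \<ge> x0" "Re z \<ge> \<delta> * norm z" for z
  proof -
    have nz: "norm z > 0" using z(1) x0(1) by linarith
    have Rez: "Re z > 0" by (rule less_le_trans[OF _ z(2)]) (use nz \<delta> in simp)
    have zx: "z + of_real x0 \<noteq> 0"
    proof
      assume "z + of_real x0 = 0"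
      hence "Re z + x0 = 0" by (simp add: complex_eq_iff)
      thus False using Rez x0 by simp
    qed
    define s0 where "s0 = (z - of_real x0) / (z + of_real x0)"
    have ns: "1 - (norm s0)\<^sup>2 = 4 * x0 * Re z / (norm (z + of_real x0))\<^sup>2"
    proof -
      have "(norm (z + of_real x0))\<^sup>2 - (norm (z - of_real x0))\<^sup>2 = 4 * x0 * Re z"
        unfolding cmod_power2 by (simp add: power2_eq_square algebra_simps)
      moreover have "1 - (norm s0)\<^sup>2 = ((norm (z + of_real x0))\<^sup>2 - (norm (z - of_real x0))\<^sup>2) / (norm (z + of_real x0))\<^sup>2"
        using zx unfolding s0_def norm_divide power_divide diff_divide_distrib[where 'a = real] by simp
      ultimately show ?thesis by (simp only:)
    qed
    hence "(norm s0)\<^sup>2 < 1\<^sup>2" using x0 Rez zx by (smt (verit) divide_pos_pos mult_pos_pos one_power2 zero_less_norm_iff zero_less_power)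
    hence s0: "norm s0 < 1" by (rule power_less_imp_less_base) simp
    \<comment> \<open>Halfway between \<open>norm s0\<close> and 1: shrinking by
      \<open>\<rho>\<close> makes the transplanted functions holomorphic on a disc of radius above
      1, and \<open>s0 / \<rho>\<close> still lies in the unit disc.\<close>
    define \<rho> where "\<rho> = (1 + norm s0) / 2"
    have \<rho>: "\<rho> > 0" "\<rho> < 1" "norm s0 < \<rho>" using s0 by (auto simp: \<rho>_def add_pos_nonneg)
    define \<phi> where "\<phi> = (\<lambda>s::complex. of_real x0 * (1 + of_real \<rho> * s) / (1 - of_real \<rho> * s))"
    have small: "norm (of_real \<rho> * s) < 1" if "s \<in> ball 0 (1 / \<rho>)" for s :: complex
      using that \<rho> by (simp add: norm_mult field_simps)
    have nz1: "1 - of_real \<rho> * s \<noteq> 0" if "s \<in> ball 0 (1 / \<rho>)" for s :: complex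
      using small[OF that] by auto
    have \<phi>: "Re (\<phi> s) > 0" if "s \<in> ball 0 (1 / \<rho>)" for s
    proof -
      define w where "w = of_real \<rho> * s"
      have w: "norm w < 1" "1 - w \<noteq> 0" using small[OF that] nz1[OF that] by (auto simp: w_def)
      have "Re ((1 + w) * cnj (1 - w)) = 1 - (norm w)\<^sup>2" unfolding cmod_power2 by (simp add: algebra_simps power2_eq_square)
      hence "Re ((1 + w) / (1 - w)) = (1 - (norm w)\<^sup>2) / (norm (1 - w))\<^sup>2"
        by (subst complex_div_cnj) (simp only: Re_divide_of_real)
      moreover have "(norm w)\<^sup>2 < 1" using w by (simp add: power_less_one_iff)
      ultimately have "Re ((1 + w) / (1 - w)) > 0" using w by simp
      moreover have "\<phi> s = of_real x0 * ((1 + w) / (1 - w))" by (simp add: \<phi>_def w_def)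
      hence "Re (\<phi> s) = x0 * Re ((1 + w) / (1 - w))" by (simp only: Re_complex_of_real Im_complex_of_real times_complex.simps mult_zero_left diff_zero)
      ultimately show ?thesis using x0 by simp
    qed
    have h\<phi>: "\<phi> holomorphic_on ball 0 (1 / \<rho>)" unfolding \<phi>_def using nz1 by (intro holomorphic_intros) auto
    have hol: "(\<lambda>s. h (\<phi> s)) holomorphic_on ball 0 (1 / \<rho>)" if "h holomorphic_on {z. Re z > 0}" for h
      using holomorphic_on_compose_gen[OF h\<phi> that] \<phi> by (simp add: o_def image_subset_iff)
    define s where "s = s0 / of_real \<rho>"
    have ns': "norm s = norm s0 / \<rho>" using \<rho> by (simp add: s_def norm_divide)
    have s: "norm s < 1" using \<rho> by (simp add: ns')
    have b: "s \<in> ball 0 (1 / \<rho>)" if "norm s = 1" for s :: complex using that \<rho> by simp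
    have "norm (f (\<phi> s)) \<le> exp (- ln (norm (p (\<phi> 0) / (2 * of_real M))) * ((1 + norm s) / (1 - norm s)))"
    proof (rule quotient_bound_unit_disc[of "1 / \<rho>" "\<lambda>s. f (\<phi> s)" "\<lambda>s. p (\<phi> s) / (2 * of_real M)"])
      show "(\<lambda>s. p (\<phi> s) / (2 * of_real M)) holomorphic_on ball 0 (1 / \<rho>)"
        using M by (intro holomorphic_intros hol p) auto
      fix s :: complex assume "norm s = 1"
      from \<phi>[OF b[OF this]] show "norm (p (\<phi> s) / (2 * of_real M)) \<le> 1 / 2" "norm (f (\<phi> s) * (p (\<phi> s) / (2 * of_real M))) \<le> 1 / 2"
        using pb fpb M by (simp_all add: norm_divide norm_mult)
    next
      show "p (\<phi> 0) / (2 * of_real M) \<noteq> 0" using x0 M by (simp add: \<phi>_def)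
    qed (use \<rho> s hol[OF f] in auto)
    also have "norm (p (\<phi> 0) / (2 * of_real M)) = P0" using M by (simp add: P0_def \<phi>_def norm_divide)
    also have "\<phi> s = z"
    proof -
      have "\<phi> s = of_real x0 * (1 + s0) / (1 - s0)" using \<rho> by (simp add: \<phi>_def s_def)
      also have "1 + s0 = 2 * z / (z + of_real x0)" using zx by (simp add: s0_def field_simps)
      also have "1 - s0 = 2 * of_real x0 / (z + of_real x0)" using zx by (simp add: s0_def field_simps)
      finally show ?thesis using x0 zx by simp
    qed
    finally have 1: "norm (f z) \<le> exp (- ln P0 * ((1 + norm s) / (1 - norm s)))" .
    have "(1 + norm s) / (1 - norm s) = (\<rho> + norm s0) / (\<rho> - norm s0)"
      using \<rho> by (simp add: ns' field_simps)
    also have "\<rho> - norm s0 = (1 - norm s0) / 2" by (simp add: \<rho>_def field_simps)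
    also have "(\<rho> + norm s0) / ((1 - norm s0) / 2) \<le> 2 / ((1 - norm s0) / 2)"
      using \<rho> s0 by (intro divide_right_mono) auto
    also have "\<dots> = 4 / (1 - norm s0)" by simp
    \<comment> \<open>Here \<open>norm (z + x0) \<le> 2 norm z\<close> because
      \<open>x0 \<le> norm z\<close>, and \<open>1 + norm s0 \<le> 2\<close>.\<close>
    also have "\<dots> \<le> 4 / (x0 * \<delta> / (2 * norm z))"
    proof -
      have "x0 * \<delta> / (2 * norm z) = 4 * x0 * (\<delta> * norm z) / (2 * (2 * norm z)\<^sup>2)"
        using nz by (simp add: power2_eq_square field_simps)
      also have "\<dots> \<le> 4 * x0 * Re z / (2 * (norm (z + of_real x0))\<^sup>2)"
        using x0 z zx Rez norm_triangle_ineq[of z "of_real x0"] by (intro frac_le mult_left_mono power_mono) auto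
      also have "\<dots> = (1 - (norm s0)\<^sup>2) / 2" unfolding ns by simp
      also have "\<dots> = (1 - norm s0) * ((1 + norm s0) / 2)" by (simp add: power2_eq_square algebra_simps)
      also have "\<dots> \<le> (1 - norm s0) * 1" using s0 by (intro mult_left_mono) auto
      finally have "x0 * \<delta> / (2 * norm z) \<le> 1 - norm s0" by simp
      moreover have "x0 * \<delta> / (2 * norm z) > 0" using x0 \<delta> nz by simp
      ultimately show ?thesis by (intro frac_le) auto
    qed
    also have "\<dots> = 8 / (x0 * \<delta>) * norm z" by simp
    finally have "- ln P0 * ((1 + norm s) / (1 - norm s)) \<le> - ln P0 * (8 / (x0 * \<delta>) * norm z)"
      by (rule mult_left_mono[OF _ lnP0])
    with 1 show ?thesis by (smt (verit) exp_le_cancel_iff mult.assoc)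
  qed
  moreover have "- ln P0 * (8 / (x0 * \<delta>)) \<ge> 0" using lnP0 x0 \<delta> by (intro mult_nonneg_nonneg) auto
  ultimately show ?thesis by blast
qed

section \<open>Cauchy--de Branges spaces\<close>

lemma holomorphic_on_locally:
  assumes "\<And>z. \<exists>g S. open S \<and> z \<in> S \<and> g holomorphic_on S \<and> (\<forall>w\<in>S. f w = g w)"
  shows "f holomorphic_on UNIV"
proof -
  have "f field_differentiable (at z)" for z
  proof -
    obtain g S where gS: "open S" "z \<in> S" "g holomorphic_on S" "\<And>w. w \<in> S \<Longrightarrow> f w = g w"
      using assms by meson
    have "f holomorphic_on S" using gS(3) by (rule holomorphic_transform) (simp add: gS(4))
    thus ?thesis using gS by (simp add: holomorphic_on_open field_differentiable_def)
  qed
  thus ?thesis by (simp add: holomorphic_on_def)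
qed

text \<open>The ring of entire functions has no zero divisors: \<open>g\<close> vanishes on the
  nonempty open set where \<open>f\<close> does not, hence everywhere. Identities obtained after
  multiplication by \<open>A\<close> or by another multiplier are cancelled in this way.\<close>

lemma entire_mult_eq_zeroD:
  assumes f: "f holomorphic_on UNIV" and g: "g holomorphic_on UNIV" and fg: "\<And>z. f z * g z = 0" and a: "f a \<noteq> 0"
  shows "g z = 0"
proof -
  have "continuous_on UNIV f" by (rule holomorphic_on_imp_continuous_on[OF f])
  hence o: "open {z. f z \<noteq> 0}" by (intro open_Collect_neq continuous_on_const)
  show ?thesis
    by (rule analytic_continuation_open[OF o open_UNIV _ connected_UNIV _ g holomorphic_on_const[of 0]])
       (use a fg in auto)
qed

lemma entire_divide_simple_zeros:
  assumes N: "N holomorphic_on UNIV" and A: "A holomorphic_on UNIV"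
    and z: "\<And>z. A z = 0 \<Longrightarrow> N z = 0" "\<And>z. A z = 0 \<Longrightarrow> deriv A z \<noteq> 0"
  obtains M where "M holomorphic_on UNIV" "\<And>z. N z = A z * M z"
proof -
  define M where "M = (\<lambda>z. if A z = 0 then deriv N z / deriv A z else N z / A z)"
  have "M holomorphic_on UNIV"
  proof (rule holomorphic_on_locally)
    fix a
    show "\<exists>g S. open S \<and> a \<in> S \<and> g holomorphic_on S \<and> (\<forall>w\<in>S. M w = g w)"
    proof (cases "A a = 0")
      case False
      have o: "open {z. A z \<noteq> 0}"
        by (intro open_Collect_neq continuous_on_const holomorphic_on_imp_continuous_on A)
      have "(\<lambda>z. N z / A z) holomorphic_on {z. A z \<noteq> 0}"
        by (intro holomorphic_on_divide holomorphic_on_subset[OF A] holomorphic_on_subset[OF N]) auto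
      thus ?thesis using o False by (intro exI[of _ "\<lambda>z. N z / A z"] exI[of _ "{z. A z \<noteq> 0}"]) (auto simp: M_def)
    next
      case True
      define q where "q = (\<lambda>f z. if z = a then deriv f a else (f z - f a) / (z - a))"
      have q: "q f holomorphic_on UNIV" if "f holomorphic_on UNIV" for f
        unfolding q_def using pole_lemma_open[OF that open_UNIV, of a] by simp
      have o: "open {z. q A z \<noteq> 0}"
        by (intro open_Collect_neq continuous_on_const holomorphic_on_imp_continuous_on q A)
      have "(\<lambda>z. q N z / q A z) holomorphic_on {z. q A z \<noteq> 0}"
        by (intro holomorphic_on_divide holomorphic_on_subset[OF q[OF A]] holomorphic_on_subset[OF q[OF N]]) auto
      moreover have "M w = q N w / q A w" if "q A w \<noteq> 0" for w
        using that True z(1)[OF True] by (auto simp: M_def q_def)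
      moreover have "q A a \<noteq> 0" using z(2)[OF True] by (simp add: q_def)
      ultimately show ?thesis using o by (intro exI[of _ "\<lambda>z. q N z / q A z"] exI[of _ "{z. q A z \<noteq> 0}"]) auto
    qed
  qed
  moreover have "N w = A w * M w" for w using z(1)[of w] by (simp add: M_def)
  ultimately show ?thesis using that by blast
qed

section \<open>Cauchy sums over the nodes\<close>

locale nodes =
  fixes t :: "nat \<Rightarrow> complex"
  assumes inj_t: "inj t" and t_nonzero: "t n \<noteq> 0" and t_at_top: "filterlim (\<lambda>n. norm (t n)) at_top sequentially"
begin

lemma t_lower_bound: obtains c where "c > 0" "\<And>n. norm (t n) \<ge> c"
proof -
  obtain N where N: "\<And>n. n \<ge> N \<Longrightarrow> norm (t n) \<ge> 1"
    using t_at_top by (auto simp: filterlim_at_top eventually_sequentially)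
  define c where "c = Min (insert 1 ((\<lambda>n. norm (t n)) ` {..<N}))"
  have "c > 0" unfolding c_def using t_nonzero by (subst Min_gr_iff) auto
  moreover have "norm (t n) \<ge> c" for n
  proof (cases "n < N")
    case True thus ?thesis unfolding c_def by (intro Min_le) auto
  next
    case False
    have "c \<le> 1" unfolding c_def by (intro Min_le) auto
    thus ?thesis using N[of n] False by simp
  qed
  ultimately show ?thesis using that by blast
qed

text \<open>\<open>csum Z u\<close> is the entire function \<open>Z(w) \<Sum>\<^sub>n u\<^sub>n / (w - t\<^sub>n)\<close>.\<close>

definition csum :: "(complex \<Rightarrow> complex) \<Rightarrow> (nat \<Rightarrow> complex) \<Rightarrow> complex \<Rightarrow> complex" where
  "csum Z u w = (\<Sum>n. u n * cdb_kernel t Z n w)"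

context
  fixes Z :: "complex \<Rightarrow> complex"
  assumes Z: "Z holomorphic_on UNIV" and Zt: "\<And>n. Z (t n) = 0"
begin

lemma kernel_holomorphic: "cdb_kernel t Z n holomorphic_on UNIV"
proof -
  have "cdb_kernel t Z n = (\<lambda>z. if z = t n then deriv Z (t n) else (Z z - Z (t n)) / (z - t n))"
    by (auto simp: cdb_kernel_def Zt fun_eq_iff)
  thus ?thesis using pole_lemma_open[OF Z open_UNIV, of "t n"] by simp
qed

lemma kernel_mult: "(w - t n) * cdb_kernel t Z n w = Z w"
  by (simp add: cdb_kernel_def Zt)

lemma kernel_at_node: "cdb_kernel t Z n (t m) = (if n = m then deriv Z (t m) else 0)"
  using inj_t by (auto simp: cdb_kernel_def Zt inj_eq)

text \<open>The factor \<open>norm (t n)\<close> matches the summability of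
  \<open>u n / t n\<close>. At distance at least 1 from the node the triangle inequality is enough.
  Closer to it, the maximum principle on the unit disc about \<open>t n\<close> replaces the small
  denominator by 1, and that disc stays within radius \<open>norm w + 2\<close>.\<close>

lemma kernel_bound:
  assumes B: "\<And>z. norm z \<le> norm w + 2 \<Longrightarrow> norm (Z z) \<le> B"
  shows "norm (cdb_kernel t Z n w) * norm (t n) \<le> (norm w + 1) * B"
proof -
  have B0: "B \<ge> 0" by (rule order_trans[OF norm_ge_zero B[of 0]]) (simp add: add_nonneg_nonneg)
  have tn: "norm (t n) \<le> norm w + norm (w - t n)"
    using norm_triangle_ineq4[of w "w - t n"] by simp
  show ?thesis
  proof (cases "norm (w - t n) \<ge> 1")
    case True
    hence "w \<noteq> t n" by auto
    hence k: "norm (cdb_kernel t Z n w) = norm (Z w) / norm (w - t n)" by (simp add: cdb_kernel_def norm_divide)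
    have "norm (t n) \<le> norm w * norm (w - t n) + norm (w - t n)"
      using tn mult_left_mono[OF True, of "norm w"] by simp
    hence t1: "norm (t n) / norm (w - t n) \<le> norm w + 1"
      using \<open>w \<noteq> t n\<close> by (simp add: divide_simps algebra_simps)
    have "norm (cdb_kernel t Z n w) * norm (t n) = (norm (t n) / norm (w - t n)) * norm (Z w)" by (simp add: k)
    also have "\<dots> \<le> (norm w + 1) * B" using t1 B0 B[of w] by (intro mult_mono) auto
    finally show ?thesis .
  next
    case False
    have "norm (cdb_kernel t Z n w) \<le> B"
    proof (rule maximum_modulus_frontier[of "cdb_kernel t Z n" "ball (t n) 1"])
      show "cdb_kernel t Z n holomorphic_on interior (ball (t n) 1)" "continuous_on (closure (ball (t n) 1)) (cdb_kernel t Z n)"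
        using kernel_holomorphic by (auto intro!: holomorphic_on_imp_continuous_on intro: holomorphic_on_subset)
      fix z assume "z \<in> frontier (ball (t n) 1)"
      hence z: "norm (z - t n) = 1" by (simp add: dist_norm norm_minus_commute)
      hence "norm z \<le> norm w + 2" using tn False norm_triangle_ineq[of "z - t n" "t n"] by simp
      moreover have "norm (cdb_kernel t Z n z) = norm (Z z)"
        using z by (auto simp: cdb_kernel_def norm_divide)
      ultimately show "norm (cdb_kernel t Z n z) \<le> B" using B by simp
    qed (use False in \<open>auto simp: dist_norm norm_minus_commute\<close>)
    moreover have "norm (t n) \<le> norm w + 1" using tn False by simp
    ultimately have "norm (cdb_kernel t Z n w) * norm (t n) \<le> B * (norm w + 1)" using B0 by (intro mult_mono) auto
    thus ?thesis by (simp add: mult.commute)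
  qed
qed

lemma term_bound:
  assumes B: "\<And>z. norm z \<le> norm w + 2 \<Longrightarrow> norm (Z z) \<le> B"
  shows "norm (u n * cdb_kernel t Z n w) \<le> norm (u n) / norm (t n) * ((norm w + 1) * B)"
proof -
  have "norm (u n * cdb_kernel t Z n w) = norm (u n) / norm (t n) * (norm (cdb_kernel t Z n w) * norm (t n))"
    using t_nonzero[of n] by (simp add: norm_mult)
  also have "\<dots> \<le> norm (u n) / norm (t n) * ((norm w + 1) * B)"
    by (intro mult_left_mono kernel_bound B) auto
  finally show ?thesis .
qed

lemma Z_bounded: obtains B where "\<And>z. norm z \<le> R \<Longrightarrow> norm (Z z) \<le> B"
proof -
  have "bounded (Z ` cball 0 R)"
    using Z by (intro compact_imp_bounded compact_continuous_image holomorphic_on_imp_continuous_on compact_cball)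
       (auto intro: holomorphic_on_subset)
  then obtain b where "\<forall>x\<in>cball 0 R. norm (Z x) \<le> b" by (auto simp: bounded_iff)
  thus ?thesis by (intro that[of b]) auto
qed

context
  fixes u :: "nat \<Rightarrow> complex"
  assumes u: "summable (\<lambda>n. norm (u n) / norm (t n))"
begin

lemma csum_summable: "summable (\<lambda>n. norm (u n * cdb_kernel t Z n w))"
proof -
  obtain B where B: "\<And>z. norm z \<le> norm w + 2 \<Longrightarrow> norm (Z z) \<le> B" using Z_bounded by metis
  show ?thesis
    by (rule summable_comparison_test'[OF summable_mult2[OF u]]) (use term_bound[OF B] in simp)
qed

lemma csum_bound:
  assumes B: "\<And>z. norm z \<le> norm w + 2 \<Longrightarrow> norm (Z z) \<le> B"
  shows "norm (csum Z u w) \<le> (\<Sum>n. norm (u n) / norm (t n)) * ((norm w + 1) * B)"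
proof -
  have "norm (csum Z u w) \<le> (\<Sum>n. norm (u n * cdb_kernel t Z n w))"
    unfolding csum_def by (rule summable_norm[OF csum_summable])
  also have "\<dots> \<le> (\<Sum>n. norm (u n) / norm (t n) * ((norm w + 1) * B))"
    by (intro suminf_le csum_summable summable_mult2 u term_bound B)
  also have "\<dots> = (\<Sum>n. norm (u n) / norm (t n)) * ((norm w + 1) * B)" by (rule suminf_mult2[symmetric, OF u])
  finally show ?thesis .
qed

lemma csum_holomorphic: "csum Z u holomorphic_on UNIV"
proof (rule holomorphic_uniform_sequence[of UNIV "\<lambda>N w. \<Sum>n<N. u n * cdb_kernel t Z n w"])
  show "(\<lambda>w. \<Sum>n<N. u n * cdb_kernel t Z n w) holomorphic_on UNIV" for N
    by (intro holomorphic_intros kernel_holomorphic)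
  fix x :: complex
  obtain B where B: "\<And>z. norm z \<le> norm x + 1 + 2 \<Longrightarrow> norm (Z z) \<le> B" using Z_bounded by metis
  have B0: "B \<ge> 0" by (rule order_trans[OF norm_ge_zero B[of 0]]) (simp add: add_nonneg_nonneg)
  have "uniform_limit (cball x 1) (\<lambda>N w. \<Sum>n<N. u n * cdb_kernel t Z n w) (\<lambda>w. \<Sum>n. u n * cdb_kernel t Z n w) sequentially"
  proof (rule Weierstrass_m_test)
    show "summable (\<lambda>n. norm (u n) / norm (t n) * ((norm x + 2) * B))" by (intro summable_mult2 u)
    fix n w assume "w \<in> cball x 1"
    hence w: "norm w \<le> norm x + 1" using norm_triangle_ineq2[of w x] by (simp add: dist_norm norm_minus_commute)
    have "norm (u n * cdb_kernel t Z n w) \<le> norm (u n) / norm (t n) * ((norm w + 1) * B)"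
      by (rule term_bound) (use w B in auto)
    also have "\<dots> \<le> norm (u n) / norm (t n) * ((norm x + 2) * B)"
      using w B0 by (intro mult_left_mono mult_right_mono) auto
    finally show "norm (u n * cdb_kernel t Z n w) \<le> norm (u n) / norm (t n) * ((norm x + 2) * B)" .
  qed
  thus "\<exists>d>0. cball x d \<subseteq> UNIV \<and> uniform_limit (cball x d) (\<lambda>N w. \<Sum>n<N. u n * cdb_kernel t Z n w) (csum Z u) sequentially"
    by (intro exI[of _ 1]) (simp add: csum_def[abs_def])
qed auto

end

lemma csum_at_node: "csum Z u (t m) = u m * deriv Z (t m)"
proof -
  have "csum Z u (t m) = (\<Sum>n\<in>{m}. u n * cdb_kernel t Z n (t m))"
    unfolding csum_def by (rule suminf_finite) (auto simp: kernel_at_node)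
  thus ?thesis by (simp add: kernel_at_node)
qed

lemma csum_off_nodes: "w \<notin> range t \<Longrightarrow> summable (\<lambda>n. norm (u n) / norm (t n)) \<Longrightarrow> csum Z u w = Z w * (\<Sum>n. u n / (w - t n))"
proof -
  assume w: "w \<notin> range t" and u: "summable (\<lambda>n. norm (u n) / norm (t n))"
  have eq: "u n * cdb_kernel t Z n w = Z w * (u n / (w - t n))" for n
    using w by (auto simp: cdb_kernel_def)
  show ?thesis
  proof (cases "Z w = 0")
    case False
    have "summable (\<lambda>n. Z w * (u n / (w - t n)))"
      using summable_norm_cancel[OF csum_summable[OF u, of w]] by (simp only: eq)
    hence "summable (\<lambda>n. u n / (w - t n))" using False summable_cmult_iff[of "Z w" "\<lambda>n. u n / (w - t n)"] by blast
    thus ?thesis unfolding csum_def eq by (rule suminf_mult)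
  qed (simp add: csum_def eq)
qed

text \<open>Termwise, \<open>(t n - w0) / (w - t n) = (w - w0) / (w - t n) - 1\<close>. The
  correction is the total sum of \<open>u\<close>, which orthogonality will make zero.\<close>

lemma csum_shift:
  assumes u: "summable (\<lambda>n. norm (u n))"
  shows "csum Z (\<lambda>n. (t n - w0) * u n) w = (w - w0) * csum Z u w - Z w * (\<Sum>n. u n)"
proof -
  obtain c where c: "c > 0" "\<And>n. norm (t n) \<ge> c" using t_lower_bound by blast
  have "summable (\<lambda>n. norm (u n) / norm (t n))"
  proof (rule summable_comparison_test'[OF summable_divide[OF u, of c]])
    show "norm (norm (u n) / norm (t n)) \<le> norm (u n) / c" for n using c t_nonzero[of n] by (auto intro!: divide_left_mono mult_pos_pos)
  qed
  hence s: "summable (\<lambda>n. u n * cdb_kernel t Z n w)" by (rule summable_norm_cancel[OF csum_summable])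
  have "(t n - w0) * u n * cdb_kernel t Z n w = (w - w0) * (u n * cdb_kernel t Z n w) - Z w * u n" for n
    using kernel_mult[of w n] by (simp add: algebra_simps)
  moreover note su = summable_norm_cancel[OF u]
  ultimately show ?thesis unfolding csum_def
    by (simp only: suminf_diff[OF summable_mult[OF s] summable_mult[OF su], symmetric] suminf_mult[OF s] suminf_mult[OF su])
qed

end

text \<open>Up to the multiplier, a Cauchy sum is the same meromorphic function. This permits
  passing from \<open>A\<close> to any entire function that vanishes at the nodes and has better
  growth.\<close>

lemma csum_change_multiplier:
  assumes "Z holomorphic_on UNIV" "\<And>n. Z (t n) = 0" "Y holomorphic_on UNIV" "\<And>n. Y (t n) = 0"
    and u: "summable (\<lambda>n. norm (u n) / norm (t n))"
  shows "csum Z u w * Y w = csum Y u w * Z w"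
proof -
  have "cdb_kernel t Z n w * Y w = cdb_kernel t Y n w * Z w" for n
    using assms(2,4) by (auto simp: cdb_kernel_def)
  hence eq: "u n * cdb_kernel t Z n w * Y w = u n * cdb_kernel t Y n w * Z w" for n
    by (metis mult.assoc)
  have "csum Z u w * Y w = (\<Sum>n. u n * cdb_kernel t Z n w * Y w)"
    unfolding csum_def by (rule suminf_mult2[OF summable_norm_cancel[OF csum_summable[OF assms(1,2) u]]])
  also have "\<dots> = csum Y u w * Z w"
    unfolding csum_def eq by (rule suminf_mult2[symmetric, OF summable_norm_cancel[OF csum_summable[OF assms(3,4) u]]])
  finally show ?thesis .
qed

end

section \<open>Coefficients, annihilators and their Cauchy transforms\<close>

locale cdb = nodes +
  fixes A :: "complex \<Rightarrow> complex" and \<mu> :: "nat \<Rightarrow> real"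
  assumes A_entire: "A holomorphic_on UNIV" and A_zero: "A z = 0 \<longleftrightarrow> z \<in> range t" and A_simple: "deriv A (t n) \<noteq> 0"
    and mu_pos: "\<mu> n > 0" and mu_sum: "summable (\<lambda>n. \<mu> n / ((norm (t n))\<^sup>2 + 1))"
begin

lemma A_node: "A (t n) = 0" by (simp add: A_zero)

text \<open>At a node all kernels but one vanish, so sampling isolates one coefficient of a function
  of the space. The formula applies to every function and is linear in it.\<close>

definition coef :: "(complex \<Rightarrow> complex) \<Rightarrow> nat \<Rightarrow> complex" where
  "coef f n = f (t n) / (of_real (sqrt (\<mu> n)) * deriv A (t n))"

lemma coef_eq: "coef f n * of_real (sqrt (\<mu> n)) * deriv A (t n) = f (t n)"
  using mu_pos[of n] A_simple[of n] by (simp add: coef_def)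

lemma coef_add: "coef (\<lambda>z. f z + g z) n = coef f n + coef g n"
  by (simp add: coef_def add_divide_distrib)

lemma coef_cmult: "coef (\<lambda>z. c * f z) n = c * coef f n"
  by (simp add: coef_def)

lemma mu_summable: "summable (\<lambda>n. \<mu> n / (norm (t n))\<^sup>2)"
proof -
  obtain c where c: "c > 0" "\<And>n. norm (t n) \<ge> c" using t_lower_bound by blast
  show ?thesis
  proof (rule summable_comparison_test'[OF summable_mult[OF mu_sum, of "1 + 1 / c\<^sup>2"]])
    fix n
    have t: "norm (t n) > 0" using t_nonzero by simp
    have c2: "c\<^sup>2 \<le> (norm (t n))\<^sup>2" using c by (intro power_mono) auto
    have "(norm (t n))\<^sup>2 + 1 \<le> (1 + 1 / c\<^sup>2) * (norm (t n))\<^sup>2"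
      using c2 c(1) by (simp add: field_simps)
    hence "1 / (norm (t n))\<^sup>2 \<le> (1 + 1 / c\<^sup>2) / ((norm (t n))\<^sup>2 + 1)"
      using t by (simp add: divide_simps add_pos_pos split: if_splits)
    hence "\<mu> n * (1 / (norm (t n))\<^sup>2) \<le> \<mu> n * ((1 + 1 / c\<^sup>2) / ((norm (t n))\<^sup>2 + 1))"
      using mu_pos[of n] by (intro mult_left_mono) auto
    thus "norm (\<mu> n / (norm (t n))\<^sup>2) \<le> (1 + 1 / c\<^sup>2) * (\<mu> n / ((norm (t n))\<^sup>2 + 1))"
      using mu_pos[of n] by (simp add: mult.commute)
  qed
qed

text \<open>\<open>2 x y \<le> x^2 + y^2\<close> for \<open>x = norm (a n)\<close> and
  \<open>y = sqrt (\<mu> n) / norm (t n)\<close>.\<close>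

lemma weight_summable:
  assumes "l2seq a"
  shows "summable (\<lambda>n. norm (a n * of_real (sqrt (\<mu> n))) / norm (t n))"
proof (rule summable_comparison_test')
  show "summable (\<lambda>n. (norm (a n))\<^sup>2 + \<mu> n / (norm (t n))\<^sup>2)"
    using assms mu_summable by (auto simp: l2seq_def intro: summable_add)
  fix n
  have "2 * (norm (a n) * (sqrt (\<mu> n) / norm (t n))) \<le> (norm (a n))\<^sup>2 + (sqrt (\<mu> n) / norm (t n))\<^sup>2"
    using sum_squares_bound[of "norm (a n)" "sqrt (\<mu> n) / norm (t n)"] by (simp only: mult.assoc)
  moreover have "0 \<le> norm (a n) * (sqrt (\<mu> n) / norm (t n))" using mu_pos[of n] by simp
  moreover have "(sqrt (\<mu> n) / norm (t n))\<^sup>2 = \<mu> n / (norm (t n))\<^sup>2" using mu_pos[of n] by (simp add: power_divide)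
  ultimately have "norm (a n) * (sqrt (\<mu> n) / norm (t n)) \<le> (norm (a n))\<^sup>2 + \<mu> n / (norm (t n))\<^sup>2" by linarith
  thus "norm (norm (a n * of_real (sqrt (\<mu> n))) / norm (t n)) \<le> (norm (a n))\<^sup>2 + \<mu> n / (norm (t n))\<^sup>2"
    using mu_pos[of n] by (simp add: norm_mult)
qed

lemma l1_summable:
  assumes "summable (\<lambda>n. norm (u n))"
  shows "summable (\<lambda>n. norm (u n) / norm (t n))"
proof -
  obtain c where c: "c > 0" "\<And>n. norm (t n) \<ge> c" using t_lower_bound by blast
  show ?thesis
  proof (rule summable_comparison_test'[OF summable_divide[OF assms, of c]])
    show "norm (norm (u n) / norm (t n)) \<le> norm (u n) / c" for n
      using c t_nonzero[of n] by (auto intro!: divide_left_mono mult_pos_pos)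
  qed
qed

lemma repr_coef:
  assumes "cdb_repr t A \<mu> a f"
  shows "a = coef f"
proof
  fix m
  have "f (t m) = csum A (\<lambda>n. a n * of_real (sqrt (\<mu> n))) (t m)"
    using assms by (simp add: cdb_repr_def csum_def)
  also have "\<dots> = a m * of_real (sqrt (\<mu> m)) * deriv A (t m)"
    by (rule csum_at_node[OF A_entire A_node])
  finally show "a m = coef f m" using mu_pos[of m] A_simple[of m] by (simp add: coef_def)
qed

lemma space_l2: "f \<in> cdb_space t A \<mu> \<Longrightarrow> l2seq (coef f)"
  using repr_coef by (auto simp: cdb_space_def cdb_repr_def)

lemma space_repr: "f \<in> cdb_space t A \<mu> \<Longrightarrow> cdb_repr t A \<mu> (coef f) f"
  using repr_coef by (auto simp: cdb_space_def)

lemma space_csum: "f \<in> cdb_space t A \<mu> \<Longrightarrow> f = csum A (\<lambda>n. coef f n * of_real (sqrt (\<mu> n)))"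
  using space_repr[of f] by (auto simp: cdb_repr_def csum_def fun_eq_iff)

lemma space_entire: "f \<in> cdb_space t A \<mu> \<Longrightarrow> f holomorphic_on UNIV"
  using csum_holomorphic[OF A_entire A_node weight_summable[OF space_l2]] space_csum by metis

text \<open>The pairing is bilinear, so that \<open>\<Sum>n. coef f n * b n\<close> is what
  \<open>w\<close> times the Cauchy transform with numerators \<open>coef f n * b n\<close>
  approaches on large circles away from the nodes.\<close>

definition perp :: "(complex \<Rightarrow> complex) set \<Rightarrow> (nat \<Rightarrow> complex) \<Rightarrow> bool" where
  "perp H b \<longleftrightarrow> l2seq b \<and> (\<forall>f\<in>H. (\<Sum>n. coef f n * b n) = 0)"

text \<open>\<open>coef\<close> carries \<open>H\<close> onto a closed subspace of the sequence
  space: a limit of coefficient sequences represents a function, which lies in \<open>H\<close>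
  because \<open>H\<close> is closed in the norm.\<close>

lemma separation:
  assumes H: "cdb_closed_subspace t A \<mu> H" and g: "g \<in> cdb_space t A \<mu>" "g \<notin> H"
  obtains b where "perp H b" "(\<Sum>n. coef g n * b n) \<noteq> 0"
proof -
  have Hs: "f \<in> H \<Longrightarrow> f \<in> cdb_space t A \<mu>" for f using H by (auto simp: cdb_closed_subspace_def)
  have inj: "f = g" if "f \<in> H" "coef g = coef f" for f
    using space_csum[OF Hs[OF that(1)]] space_csum[OF g(1)] that(2) by metis
  show thesis
  proof (rule l2_separation[of "coef ` H" "coef g" thesis])
    show "l2seq m" if "m \<in> coef ` H" for m using that space_l2 Hs by auto
    have "coef (\<lambda>z. 0) = (\<lambda>n. 0)" by (simp add: coef_def[abs_def])
    moreover have "(\<lambda>z. 0) \<in> H" using H by (simp add: cdb_closed_subspace_def)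
    ultimately show "(\<lambda>n. 0) \<in> coef ` H" by (metis imageI)
    show "(\<lambda>n. a n + b n) \<in> coef ` H" if ab: "a \<in> coef ` H" "b \<in> coef ` H" for a b
    proof -
      obtain f h where fh: "f \<in> H" "h \<in> H" "a = coef f" "b = coef h" using ab by auto
      have "(\<lambda>z. f z + h z) \<in> H" using H fh by (simp add: cdb_closed_subspace_def)
      moreover have "(\<lambda>n. a n + b n) = coef (\<lambda>z. f z + h z)" by (simp add: coef_add fh fun_eq_iff)
      ultimately show ?thesis by simp
    qed
    show "(\<lambda>n. c * a n) \<in> coef ` H" if a: "a \<in> coef ` H" for a c
    proof -
      obtain f where f: "f \<in> H" "a = coef f" using a by auto
      have "(\<lambda>z. c * f z) \<in> H" using H f by (simp add: cdb_closed_subspace_def)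
      moreover have "(\<lambda>n. c * a n) = coef (\<lambda>z. c * f z)" by (simp add: coef_cmult f fun_eq_iff)
      ultimately show ?thesis by simp
    qed
    show "y \<in> coef ` H" if x: "\<And>k. x k \<in> coef ` H" and y: "l2seq y" and lim: "(\<lambda>k. l2sq (\<lambda>n. x k n - y n)) \<longlonglongrightarrow> 0" for x y
    proof -
      have "\<exists>F. F \<in> H \<and> x k = coef F" for k using x[of k] by auto
      then obtain F where F: "\<And>k. F k \<in> H" "\<And>k. x k = coef (F k)" by metis
      define G where "G = csum A (\<lambda>n. y n * of_real (sqrt (\<mu> n)))"
      have G: "cdb_repr t A \<mu> y G" using y by (simp add: cdb_repr_def G_def csum_def)
      have "(\<lambda>k. sqrt (l2sq (\<lambda>n. x k n - y n))) \<longlonglongrightarrow> sqrt 0" by (intro tendsto_real_sqrt lim)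
      moreover have "cdb_repr t A \<mu> (x k) (F k)" for k using space_repr[OF Hs[OF F(1)]] by (simp add: F(2))
      moreover have "\<forall>F a b g. (\<forall>k. F k \<in> H \<and> cdb_repr t A \<mu> (a k) (F k)) \<and> cdb_repr t A \<mu> b g
          \<and> (\<lambda>k. sqrt (\<Sum>n. (norm (a k n - b n))\<^sup>2)) \<longlonglongrightarrow> 0 \<longrightarrow> g \<in> H"
        using H unfolding cdb_closed_subspace_def by blast
      ultimately have "G \<in> H" using F(1) G unfolding l2sq_def real_sqrt_zero by blast
      thus ?thesis using repr_coef[OF G] by auto
    qed
    show "l2seq (coef g)" by (rule space_l2[OF g(1)])
    show "coef g \<notin> coef ` H" using inj g(2) by auto
    fix b assume b: "l2seq b" "\<And>m. m \<in> coef ` H \<Longrightarrow> (\<Sum>n. m n * b n) = 0" "(\<Sum>n. coef g n * b n) \<noteq> 0"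
    have "perp H b" using b(1,2) by (simp add: perp_def)
    thus thesis using b(3) by (rule that)
  qed
qed

text \<open>Off the nodes this is \<open>A\<close> times the Cauchy transform; the factor
  \<open>A\<close> cancels the poles and makes it entire.\<close>

definition pairing :: "(complex \<Rightarrow> complex) \<Rightarrow> (nat \<Rightarrow> complex) \<Rightarrow> complex \<Rightarrow> complex" where
  "pairing f b = csum A (\<lambda>n. coef f n * b n)"

lemma pairing_summable:
  assumes "f \<in> cdb_space t A \<mu>" "l2seq b"
  shows "summable (\<lambda>n. norm (coef f n * b n))"
  by (rule l2seq_mult_summable[OF space_l2[OF assms(1)] assms(2)])

lemma pairing_entire: "f \<in> cdb_space t A \<mu> \<Longrightarrow> l2seq b \<Longrightarrow> pairing f b holomorphic_on UNIV"
  unfolding pairing_def by (intro csum_holomorphic[OF A_entire A_node l1_summable[OF pairing_summable]])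

lemma pairing_at_node: "pairing f b (t m) = coef f m * b m * deriv A (t m)"
  unfolding pairing_def by (rule csum_at_node[OF A_entire A_node])

text \<open>Dividing by \<open>z - w\<^sub>0\<close> repeatedly shows that \<open>S K\<^sub>F - F K\<^sub>S\<close>, where \<open>K\<^sub>F = pairing F b\<close>, vanishes at \<open>w\<^sub>0\<close> to infinite order.\<close>

lemma pairing_proportional_aux:
  assumes ni: "nearly_invariant t A \<mu> H" and b: "perp H b" and nz: "no_common_zeros H"
  obtains S s where "S \<in> H" "S s \<noteq> 0" "\<And>F w. F \<in> H \<Longrightarrow> S w * pairing F b w = F w * pairing S b w"
proof -
  have cl: "cdb_closed_subspace t A \<mu> H" using ni by (simp add: nearly_invariant_def)
  have Hs: "f \<in> H \<Longrightarrow> f \<in> cdb_space t A \<mu>" for f using cl by (auto simp: cdb_closed_subspace_def)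
  have Hadd: "f \<in> H \<Longrightarrow> g \<in> H \<Longrightarrow> (\<lambda>z. f z + g z) \<in> H" and Hcm: "f \<in> H \<Longrightarrow> (\<lambda>z. c * f z) \<in> H" for f g c
    using cl by (auto simp: cdb_closed_subspace_def)
  obtain w0 where w0: "\<And>f. f \<in> H \<Longrightarrow> f w0 = 0 \<Longrightarrow> (\<lambda>z. if z = w0 then deriv f w0 else f z / (z - w0)) \<in> H"
    using ni by (auto simp: nearly_invariant_def)
  obtain S0 where S0: "S0 \<in> H" "S0 w0 \<noteq> 0" using nz by (auto simp: no_common_zeros_def)
  define S where "S = (\<lambda>z. inverse (S0 w0) * S0 z)"
  have S: "S \<in> H" "S w0 = 1" using S0 Hcm by (auto simp: S_def)
  have l2b: "l2seq b" and b0: "\<And>f. f \<in> H \<Longrightarrow> (\<Sum>n. coef f n * b n) = 0" using b by (auto simp: perp_def)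
  define D where "D = (\<lambda>F w. S w * pairing F b w - F w * pairing S b w)"
  have Dent: "D F holomorphic_on UNIV" if "F \<in> H" for F
    unfolding D_def by (intro holomorphic_intros pairing_entire space_entire Hs that S l2b)
  \<comment> \<open>Since \<open>S w0 = 1\<close>, subtracting \<open>F w0 * S\<close> creates a
    zero at \<open>w0\<close>, and near invariance keeps the quotient in \<open>H\<close>.\<close>
  define Q where "Q = (\<lambda>F z. if z = w0 then deriv (\<lambda>z. F z - F w0 * S z) w0 else (F z - F w0 * S z) / (z - w0))"
  have step: "Q F \<in> H" "D F w = (w - w0) * D (Q F) w" if F: "F \<in> H" for F w
  proof -
    have "(\<lambda>z. F z + (- F w0) * S z) \<in> H" by (intro Hadd Hcm F S)
    hence H0: "(\<lambda>z. F z - F w0 * S z) \<in> H" by simp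
    from w0[OF this] S(2) show QH: "Q F \<in> H" by (simp add: Q_def)
    have FQ: "F z = F w0 * S z + (z - w0) * Q F z" for z
      using S(2) by (simp add: Q_def)
    have cFb: "coef F n * b n = F w0 * (coef S n * b n) + (t n - w0) * (coef (Q F) n * b n)" for n
    proof -
      have "coef F n = F w0 * coef S n + (t n - w0) * coef (Q F) n"
        by (subst coef_def, subst FQ) (simp add: coef_def add_divide_distrib)
      hence "coef F n * b n = (F w0 * coef S n + (t n - w0) * coef (Q F) n) * b n" by (simp only:)
      also have "\<dots> = F w0 * (coef S n * b n) + (t n - w0) * (coef (Q F) n * b n)" by (simp add: algebra_simps)
      finally show ?thesis .
    qed
    hence "pairing F b w = csum A (\<lambda>n. F w0 * (coef S n * b n) + (t n - w0) * (coef (Q F) n * b n)) w"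
      by (simp add: pairing_def)
    also have "\<dots> = F w0 * pairing S b w + csum A (\<lambda>n. (t n - w0) * (coef (Q F) n * b n)) w"
    proof -
      have s1: "summable (\<lambda>n. coef S n * b n * cdb_kernel t A n w)"
        by (rule summable_norm_cancel[OF csum_summable[OF A_entire A_node l1_summable[OF pairing_summable[OF Hs[OF S(1)] l2b]]]])
      have s2: "summable (\<lambda>n. coef F n * b n * cdb_kernel t A n w)"
        by (rule summable_norm_cancel[OF csum_summable[OF A_entire A_node l1_summable[OF pairing_summable[OF Hs[OF F] l2b]]]])
      have eq: "(t n - w0) * (coef (Q F) n * b n) * cdb_kernel t A n w =
         coef F n * b n * cdb_kernel t A n w - F w0 * (coef S n * b n * cdb_kernel t A n w)" for n
        by (simp only: cFb) (simp add: algebra_simps)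
      have "csum A (\<lambda>n. (t n - w0) * (coef (Q F) n * b n)) w = pairing F b w - F w0 * pairing S b w"
        unfolding csum_def pairing_def eq
        by (simp only: suminf_diff[OF s2 summable_mult[OF s1], symmetric] suminf_mult[OF s1])
      moreover have "csum A (\<lambda>n. F w0 * (coef S n * b n) + (t n - w0) * (coef (Q F) n * b n)) w = pairing F b w"
        using \<open>pairing F b w = csum A _ w\<close> by simp
      ultimately show ?thesis by simp
    qed
    also have "csum A (\<lambda>n. (t n - w0) * (coef (Q F) n * b n)) w = (w - w0) * pairing (Q F) b w - A w * (\<Sum>n. coef (Q F) n * b n)"
      unfolding pairing_def by (rule csum_shift[OF A_entire A_node pairing_summable[OF Hs[OF QH] l2b]])
    \<comment> \<open>Orthogonality enters here: \<open>Q F\<close> stays in \<open>H\<close>, so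
      the correction term of \<open>csum_shift\<close> disappears.\<close>
    also have "(\<Sum>n. coef (Q F) n * b n) = 0" by (rule b0[OF QH])
    finally have "pairing F b w = F w0 * pairing S b w + (w - w0) * pairing (Q F) b w" by simp
    thus "D F w = (w - w0) * D (Q F) w"
      unfolding D_def by (simp only: FQ[of w]) (simp add: algebra_simps)
  qed
  have D0: "D F w = 0" if F: "F \<in> H" for F w
  proof (rule ccontr)
    assume nz: "D F w \<noteq> 0"
    have iter: "(Q ^^ k) F \<in> H \<and> D F z = (z - w0) ^ k * D ((Q ^^ k) F) z" for k z
    proof (induction k)
      case (Suc k)
      have "D F z = (z - w0) ^ k * ((z - w0) * D (Q ((Q ^^ k) F)) z)"
        using Suc step(2)[of "(Q ^^ k) F" z] by simp
      thus ?case using Suc step(1)[of "(Q ^^ k) F"] by simp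
    qed (simp add: F)
    have "D F w0 = 0" using iter[where k = 1 and z = w0] by simp
    then obtain g m where g: "g holomorphic_on UNIV" "\<And>z. D F z = (z - w0) ^ m * g z" "g w0 \<noteq> 0"
      using holomorphic_factor_zero_global[OF Dent[OF F] open_UNIV connected_UNIV, of w0 w] nz by auto
    \<comment> \<open>One division more than the order \<open>m\<close> of the zero of
      \<open>D F\<close> at \<open>w0\<close> leaves a factor \<open>z - w0\<close> in
      \<open>g\<close>, against \<open>g w0 \<noteq> 0\<close>.\<close>
    define h where "h = D ((Q ^^ Suc m) F)"
    have h: "h holomorphic_on UNIV" unfolding h_def using iter by (intro Dent) blast
    have eq: "g z = (z - w0) * h z" if "z \<noteq> w0" for z
      using g(2)[of z] iter[where k = "Suc m" and z = z] that by (simp add: h_def)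
    have cont: "(k \<longlongrightarrow> k w0) (at w0)" if "k holomorphic_on UNIV" for k
      using holomorphic_on_imp_continuous_on[OF that] by (simp add: continuous_on_eq_continuous_at isCont_def)
    have "((\<lambda>z. (z - w0) * h z) \<longlongrightarrow> (w0 - w0) * h w0) (at w0)" by (intro tendsto_intros cont[OF h])
    moreover have "((\<lambda>z. (z - w0) * h z) \<longlongrightarrow> g w0) (at w0)"
      using cont[OF g(1)]
      by (rule Lim_transform_eventually) (auto simp: eventually_at_filter eq)
    ultimately have "g w0 = 0" using tendsto_unique[of "at w0"] by fastforce
    thus False using g(3) by simp
  qed
  show ?thesis
  proof (rule that[OF S(1), of w0])
    show "S w0 \<noteq> 0" using S by simp
    show "S w * pairing F b w = F w * pairing S b w" if "F \<in> H" for F w using D0[OF that, of w] by (simp add: D_def)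
  qed
qed

text \<open>Both pairings are proportional to that of the same \<open>S\<close>, which is not
  identically zero and can be cancelled.\<close>

lemma pairing_proportional:
  assumes ni: "nearly_invariant t A \<mu> H" and b: "perp H b" and nz: "no_common_zeros H"
    and F: "F \<in> H" and F': "F' \<in> H"
  shows "F' w * pairing F b w = F w * pairing F' b w"
proof -
  obtain S s where S: "S \<in> H" "S s \<noteq> 0" "\<And>F w. F \<in> H \<Longrightarrow> S w * pairing F b w = F w * pairing S b w"
    using pairing_proportional_aux[OF ni b nz] by metis
  have Hs: "f \<in> H \<Longrightarrow> f \<in> cdb_space t A \<mu>" for f
    using ni by (auto simp: nearly_invariant_def cdb_closed_subspace_def)
  have l2b: "l2seq b" using b by (simp add: perp_def)
  have "F' w * pairing F b w - F w * pairing F' b w = 0"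
  proof (rule entire_mult_eq_zeroD[of S "\<lambda>w. F' w * pairing F b w - F w * pairing F' b w" s])
    show "S holomorphic_on UNIV" by (intro space_entire Hs S)
    show "(\<lambda>w. F' w * pairing F b w - F w * pairing F' b w) holomorphic_on UNIV"
      by (intro holomorphic_intros pairing_entire space_entire Hs F F' l2b)
    fix z
    have "S z * (F' z * pairing F b z - F z * pairing F' b z) = F' z * (S z * pairing F b z) - F z * (S z * pairing F' b z)"
      by (simp add: algebra_simps)
    also have "\<dots> = 0" by (simp only: S(3)[OF F] S(3)[OF F']) simp
    finally show "S z * (F' z * pairing F b z - F z * pairing F' b z) = 0" .
  qed (rule S(2))
  thus ?thesis by simp
qed

lemma exists_off_node: obtains a where "A a \<noteq> 0"
proof -
  have "range t \<noteq> UNIV" using uncountable_UNIV_complex by (metis countable_image countableI_type)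
  thus ?thesis using that A_zero by blast
qed

text \<open>At a node both products on the right take the same value, so the simple zeros of
  \<open>A\<close> divide the difference; call the quotient \<open>M F\<close>. By
  \<open>pairing_proportional\<close> the ratio \<open>M F / F\<close> is the same for all
  \<open>F\<close> in \<open>H\<close>. It is holomorphic near every point, because some member of
  \<open>H\<close> is nonzero there.\<close>

lemma comparison_function:
  assumes ni: "nearly_invariant t A \<mu> H" and b: "perp H b" and nz: "no_common_zeros H"
    and G: "G \<in> cdb_space t A \<mu>"
  obtains f where "f holomorphic_on UNIV"
    "\<And>F w. F \<in> H \<Longrightarrow> f w * F w * A w = F w * pairing G b w - G w * pairing F b w"
proof -
  have Hs: "f \<in> H \<Longrightarrow> f \<in> cdb_space t A \<mu>" for f
    using ni by (auto simp: nearly_invariant_def cdb_closed_subspace_def)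
  have l2b: "l2seq b" using b by (simp add: perp_def)
  define N where "N = (\<lambda>F w. F w * pairing G b w - G w * pairing F b w)"
  have Nent: "N F holomorphic_on UNIV" if "F \<in> H" for F
    unfolding N_def by (intro holomorphic_intros pairing_entire space_entire Hs that G l2b)
  have Nt: "N F (t m) = 0" for F m
    unfolding N_def pairing_at_node coef_eq[of F m, symmetric] coef_eq[of G m, symmetric] by (simp add: algebra_simps)
  have "\<exists>M. M holomorphic_on UNIV \<and> (\<forall>z. N F z = A z * M z)" if "F \<in> H" for F
    by (rule entire_divide_simple_zeros[OF Nent[OF that] A_entire]) (use A_zero A_simple Nt in auto)
  then obtain M where M: "\<And>F. F \<in> H \<Longrightarrow> M F holomorphic_on UNIV" "\<And>F z. F \<in> H \<Longrightarrow> N F z = A z * M F z" by metis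
  obtain a where a: "A a \<noteq> 0" by (rule exists_off_node)
  have cross: "M F w * F' w = M F' w * F w" if F: "F \<in> H" "F' \<in> H" for F F' w
  proof -
    have "M F w * F' w - M F' w * F w = 0"
    proof (rule entire_mult_eq_zeroD[of A "\<lambda>w. M F w * F' w - M F' w * F w" a])
      show "(\<lambda>w. M F w * F' w - M F' w * F w) holomorphic_on UNIV"
        by (intro holomorphic_intros space_entire Hs F M)
      fix z
      have "A z * (M F z * F' z - M F' z * F z) = N F z * F' z - N F' z * F z"
        by (simp add: M(2) F algebra_simps)
      also have "\<dots> = G z * (F z * pairing F' b z - F' z * pairing F b z)" by (simp add: N_def algebra_simps)
      also have "\<dots> = 0" using pairing_proportional[OF ni b nz F, of z] by simp
      finally show "A z * (M F z * F' z - M F' z * F z) = 0" .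
    qed (use A_entire a in auto)
    thus ?thesis by simp
  qed
  have "\<exists>F\<in>H. F z \<noteq> 0" for z using nz by (auto simp: no_common_zeros_def)
  then obtain Fz where Fz: "\<And>z. Fz z \<in> H" "\<And>z. Fz z z \<noteq> 0" by metis
  define f where "f z = M (Fz z) z / Fz z z" for z
  have f: "f w * F w = M F w" if "F \<in> H" for F w
    using cross[OF that Fz(1)[of w], of w] Fz(2)[of w] by (simp add: f_def field_simps)
  have "f holomorphic_on UNIV"
  proof (rule holomorphic_on_locally)
    fix z
    have o: "open {w. Fz z w \<noteq> 0}"
      by (intro open_Collect_neq continuous_on_const holomorphic_on_imp_continuous_on space_entire Hs Fz)
    have "(\<lambda>w. M (Fz z) w / Fz z w) holomorphic_on {w. Fz z w \<noteq> 0}"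
      by (intro holomorphic_on_divide holomorphic_on_subset[OF M(1)[OF Fz(1)]] holomorphic_on_subset[OF space_entire[OF Hs[OF Fz(1)]]]) auto
    moreover have "f w = M (Fz z) w / Fz z w" if "Fz z w \<noteq> 0" for w
      using f[OF Fz(1), of w z] that by (simp add: field_simps)
    ultimately show "\<exists>g S. open S \<and> z \<in> S \<and> g holomorphic_on S \<and> (\<forall>w\<in>S. f w = g w)"
      using o Fz(2) by (intro exI[of _ "\<lambda>w. M (Fz z) w / Fz z w"] exI[of _ "{w. Fz z w \<noteq> 0}"]) auto
  qed
  moreover have "f w * F w * A w = F w * pairing G b w - G w * pairing F b w" if "F \<in> H" for F w
    using M(2)[OF that, of w] by (simp only: f[OF that] N_def mult.commute[of "M F w"])
  ultimately show ?thesis using that by blast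
qed

end

section \<open>Circles avoiding the nodes\<close>

lemma abs_exp_minus_1_ge:
  fixes y :: real
  shows "\<bar>exp y - 1\<bar> \<ge> min 1 \<bar>y\<bar> / 2"
proof (cases "y \<ge> 0")
  case True
  have "y \<le> exp y - 1" using exp_ge_add_one_self[of y] by linarith
  thus ?thesis using True by (auto simp: min_def)
next
  case False
  define x where "x = - y"
  have x: "x > 0" using False by (simp add: x_def)
  have "exp y = 1 / exp x" by (simp add: x_def exp_minus inverse_eq_divide)
  also have "\<dots> \<le> 1 / (1 + x)" using exp_ge_add_one_self[of x] x by (intro divide_left_mono) auto
  finally have "1 - exp y \<ge> x / (1 + x)" using x by (simp add: field_simps)
  moreover have "x / (1 + x) \<ge> min 1 x / 2"
  proof (cases "x \<le> 1")
    case True thus ?thesis using x by (intro order_trans[OF _ divide_left_mono[of "1 + x" 2 x]]) auto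
  next
    case False thus ?thesis using x by (simp add: field_simps)
  qed
  ultimately have "min 1 x / 2 \<le> 1 - exp y" by linarith
  moreover have "\<bar>y\<bar> = x" "1 - exp y \<le> \<bar>exp y - 1\<bar>" using False by (auto simp: x_def)
  ultimately show ?thesis by simp
qed

lemma nn_integral_inverse_annulus:
  fixes x \<delta> :: real
  assumes \<delta>: "0 < \<delta>" "\<delta> \<le> 1"
  shows "(\<integral>\<^sup>+s. ennreal (indicator {s. \<delta> \<le> \<bar>s - x\<bar> \<and> \<bar>s - x\<bar> < 1} s / \<bar>s - x\<bar>) \<partial>lborel) \<le> ennreal (2 * ln (1 / \<delta>))"
proof -
  have 1: "(\<integral>\<^sup>+s. ennreal (1 / (s - x)) * indicator {x + \<delta>..x + 1} s \<partial>lborel) = ennreal (ln ((x + 1) - x) - ln ((x + \<delta>) - x))"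
    by (rule nn_integral_FTC_Icc) (use \<delta> in \<open>auto intro!: derivative_eq_intros\<close>)
  have 2: "(\<integral>\<^sup>+s. ennreal (1 / (x - s)) * indicator {x - 1..x - \<delta>} s \<partial>lborel) = ennreal (- ln (x - (x - \<delta>)) - - ln (x - (x - 1)))"
    by (rule nn_integral_FTC_Icc) (use \<delta> in \<open>auto intro!: derivative_eq_intros\<close>)
  have "(\<integral>\<^sup>+s. ennreal (indicator {s. \<delta> \<le> \<bar>s - x\<bar> \<and> \<bar>s - x\<bar> < 1} s / \<bar>s - x\<bar>) \<partial>lborel) \<le>
    (\<integral>\<^sup>+s. ennreal (1 / (s - x)) * indicator {x + \<delta>..x + 1} s + ennreal (1 / (x - s)) * indicator {x - 1..x - \<delta>} s \<partial>lborel)"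
    by (intro nn_integral_mono) (auto simp: indicator_def abs_if)
  also have "\<dots> = ennreal (ln ((x + 1) - x) - ln ((x + \<delta>) - x)) + ennreal (- ln (x - (x - \<delta>)) - - ln (x - (x - 1)))"
    by (subst nn_integral_add) (simp_all add: 1 2)
  also have "\<dots> = ennreal (2 * ln (1 / \<delta>))"
    using \<delta> by (subst ennreal_plus[symmetric]) (auto simp: ln_div)
  finally show ?thesis .
qed

locale nodes_exp = nodes +
  fixes K :: real
  assumes K: "K > 0" "summable (\<lambda>n. norm (t n) powr (- K))"
begin

text \<open>Half-width, on the logarithmic scale of radii, of the interval removed around a node. It
  is summable by the choice of \<open>K\<close>, yet only polynomially small in
  \<open>norm (t n)\<close>.\<close>

definition gap where "gap n = norm (t n) powr (- K)"
definition lt where "lt n = ln (norm (t n))"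

definition exc :: "real set" where "exc = (\<Union>n. {lt n - gap n<..<lt n + gap n})"

lemma gap_pos: "gap n > 0" using t_nonzero[of n] by (simp add: gap_def)

lemma gap_summable: "summable gap" using K(2) by (simp add: gap_def[abs_def])

lemma gap_eq: "gap n = exp (- K * lt n)" using t_nonzero[of n] by (simp add: gap_def lt_def powr_def)

lemma exc_open: "open exc" by (auto simp: exc_def)

lemma exc_emeasure: "emeasure lborel exc \<le> ennreal (2 * (\<Sum>n. gap n))"
proof -
  have "emeasure lborel exc \<le> (\<Sum>n. emeasure lborel {lt n - gap n<..<lt n + gap n})"
    unfolding exc_def by (rule emeasure_subadditive_countably) auto
  also have "\<dots> = (\<Sum>n. ennreal (2 * gap n))" using gap_pos by (simp add: less_imp_le)
  also have "\<dots> = ennreal (\<Sum>n. 2 * gap n)"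
    using K(2) gap_pos by (intro suminf_ennreal2) (auto simp: gap_def less_imp_le summable_mult)
  also have "(\<Sum>n. 2 * gap n) = 2 * (\<Sum>n. gap n)" using K(2) by (intro suminf_mult) (simp add: gap_def)
  finally show ?thesis .
qed

text \<open>\<open>C\<close> will consist of the logarithms of the moduli of the zeros of two
  functions; removing these radii as well costs no measure.\<close>

lemma exc_Un_countable:
  assumes "countable C"
  shows "exc \<union> C \<in> lmeasurable" "exc \<union> C \<in> sets borel" "emeasure lborel (exc \<union> C) \<le> ennreal (2 * (\<Sum>n. gap n))"
proof -
  have b: "exc \<in> sets borel" using exc_open by simp
  have cb: "C \<in> sets borel" using assms by (rule sets.countable[rotated]) auto
  show s: "exc \<union> C \<in> sets borel" using b cb by simp
  have "emeasure lborel (exc \<union> C) \<le> emeasure lborel exc + emeasure lborel C"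
    by (rule emeasure_subadditive) (use b cb in auto)
  also have "emeasure lborel C = 0" by (rule emeasure_lborel_countable[OF assms])
  finally show le: "emeasure lborel (exc \<union> C) \<le> ennreal (2 * (\<Sum>n. gap n))" using exc_emeasure by simp
  have "emeasure lebesgue (exc \<union> C) < \<infinity>"
    using le s by (simp add: le_less_trans[OF _ ennreal_less_top])
  thus "exc \<union> C \<in> lmeasurable" using s by (auto simp: fmeasurable_def)
qed

lemma dist_node_ge:
  assumes "w \<noteq> 0"
  shows "norm (w - t n) \<ge> norm (t n) * (min 1 \<bar>ln (norm w) - lt n\<bar> / 2)" "norm (w - t n) \<ge> norm w * (min 1 \<bar>ln (norm w) - lt n\<bar> / 2)"
proof -
  define y where "y = ln (norm w) - lt n"
  have ey: "exp y = norm w / norm (t n)" "exp (- y) = norm (t n) / norm w"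
    using assms t_nonzero[of n] by (simp_all add: y_def lt_def exp_diff exp_minus)
  have ge: "norm (w - t n) \<ge> \<bar>norm w - norm (t n)\<bar>" by (rule norm_triangle_ineq3)
  have "\<bar>norm w - norm (t n)\<bar> = norm (t n) * \<bar>exp y - 1\<bar>"
  proof -
    have "norm w - norm (t n) = norm (t n) * (exp y - 1)" using t_nonzero[of n] by (simp add: ey field_simps)
    thus ?thesis by (simp add: abs_mult)
  qed
  also have "\<dots> \<ge> norm (t n) * (min 1 \<bar>y\<bar> / 2)" by (intro mult_left_mono abs_exp_minus_1_ge) auto
  finally show "norm (w - t n) \<ge> norm (t n) * (min 1 \<bar>ln (norm w) - lt n\<bar> / 2)" using ge by (simp add: y_def)
  have "\<bar>norm w - norm (t n)\<bar> = norm w * \<bar>exp (- y) - 1\<bar>"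
  proof -
    have "norm (t n) - norm w = norm w * (exp (- y) - 1)" using assms by (simp add: ey field_simps)
    thus ?thesis by (metis abs_minus_commute abs_mult abs_norm_cancel)
  qed
  also have "\<dots> \<ge> norm w * (min 1 \<bar>- y\<bar> / 2)" by (intro mult_left_mono abs_exp_minus_1_ge) auto
  also have "\<bar>- y\<bar> = \<bar>ln (norm w) - lt n\<bar>" by (simp only: abs_minus_cancel y_def)
  finally show "norm (w - t n) \<ge> norm w * (min 1 \<bar>ln (norm w) - lt n\<bar> / 2)" using ge by (simp add: y_def)
qed

text \<open>A node with \<open>norm (t n) \<ge> 2 norm w\<close> is at distance at least 1. For
  every other node the excluded interval has half-width at least
  \<open>(2 norm w) powr (- K)\<close>, and K is rounded up to obtain an integer power.\<close>

lemma off_exc_poly: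
  obtains B m where "B > 0" "\<And>w n. norm w \<ge> 1 \<Longrightarrow> ln (norm w) \<notin> exc \<Longrightarrow> 1 \<le> norm (w - t n) * (B * norm w ^ m)"
proof -
  define m where "m = nat \<lceil>K\<rceil>"
  have mK: "real m \<ge> K" unfolding m_def by (rule real_nat_ceiling_ge)
  have "1 \<le> norm (w - t n) * (2 * 2 ^ m * norm w ^ m)" if w: "norm w \<ge> 1" "ln (norm w) \<notin> exc" for w n
  proof -
    have w0: "w \<noteq> 0" using w by auto
    have pow1: "1 \<le> 2 ^ m * norm w ^ m" using w(1) mult_mono[of 1 "2 ^ m" 1 "norm w ^ m"] by (simp add: one_le_power)
    show ?thesis
    proof (cases "norm (t n) \<ge> 2 * norm w")
      case True
      have "1 * 1 \<le> norm (w - t n) * (2 * 2 ^ m * norm w ^ m)"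
      proof (intro mult_mono)
        show "1 \<le> norm (w - t n)" using True w(1) norm_triangle_ineq2[of "t n" w] by (simp add: norm_minus_commute)
      qed (use pow1 in auto)
      thus ?thesis by simp
    next
      case False
      have "\<bar>ln (norm w) - lt n\<bar> \<ge> gap n" 
      proof -
        have "ln (norm w) \<notin> {lt n - gap n<..<lt n + gap n}" using w(2) by (auto simp: exc_def)
        thus ?thesis by auto
      qed
      hence "min 1 \<bar>ln (norm w) - lt n\<bar> \<ge> min 1 (gap n)" by simp
      also have "min 1 (gap n) \<ge> 1 / (2 ^ m * norm w ^ m)"
      proof -
        have "gap n \<ge> (2 * norm w) powr (- K)"
          unfolding gap_def using False K(1) t_nonzero[of n] by (intro powr_mono2') auto
        moreover have "(2 * norm w) powr (- K) \<ge> (2 * norm w) powr (- real m)"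
          using w(1) mK by (intro powr_mono) auto
        moreover have "(2 * norm w) powr (- real m) = 1 / (2 ^ m * norm w ^ m)"
          using w0 by (simp add: powr_minus powr_realpow power_mult_distrib inverse_eq_divide)
        ultimately show ?thesis using pow1 by simp
      qed
      finally have 1: "1 / (2 ^ m * norm w ^ m) \<le> min 1 \<bar>ln (norm w) - lt n\<bar>" .
      have "1 * (1 / (2 ^ m * norm w ^ m) / 2) \<le> norm w * (min 1 \<bar>ln (norm w) - lt n\<bar> / 2)"
        using w(1) 1 by (intro mult_mono divide_right_mono) auto
      also have "\<dots> \<le> norm (w - t n)" by (rule dist_node_ge(2)[OF w0])
      finally have "1 / (2 * 2 ^ m * norm w ^ m) \<le> norm (w - t n)" by (simp add: mult.commute mult.left_commute)
      moreover have "2 * 2 ^ m * norm w ^ m > 0" using w0 by simp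
      ultimately show ?thesis by (simp add: pos_divide_le_eq)
    qed
  qed
  thus ?thesis using that[of "2 * 2 ^ m" m] by simp
qed

text \<open>The part of \<open>norm (t n) / norm (w - t n)\<close>, up to a factor and a bounded
  term, that is large when ln |w| is close to ln |t n|.\<close>

definition near :: "nat \<Rightarrow> real \<Rightarrow> real" where
  "near n s = indicator {s. gap n \<le> \<bar>s - lt n\<bar> \<and> \<bar>s - lt n\<bar> < 1} s / \<bar>s - lt n\<bar>"

lemma near_measurable [measurable]: "near n \<in> borel_measurable borel"
  unfolding near_def by measurable

lemma near_nonneg: "near n s \<ge> 0"
  by (simp add: near_def)

text \<open>The plain integral of \<open>near n\<close> is \<open>2 K lt n\<close>, growing with the
  node, but on its support \<open>s\<close> is at least \<open>lt n / 2\<close>, so the weight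
  \<open>1 / s\<close> yields a bound uniform in \<open>n\<close>. For a node in the closed unit
  disc the gap is at least 1 and \<open>near n\<close> vanishes.\<close>

lemma near_weighted_integral:
  "(\<integral>\<^sup>+s. ennreal (near n s / s) * indicator {1..} s \<partial>lborel) \<le> ennreal (4 * K)"
proof (cases "lt n > 0")
  case False
  have "gap n \<ge> 1" using False K(1) by (simp add: gap_eq mult_nonneg_nonpos)
  hence "near n s = 0" for s by (auto simp: near_def)
  thus ?thesis by simp
next
  case True
  have g: "gap n \<le> 1" using True K(1) by (simp add: gap_eq)
  have "ennreal (near n s / s) * indicator {1..} s \<le> ennreal (2 / lt n) * ennreal (near n s)" for s
  proof (cases "s \<ge> 1 \<and> near n s \<noteq> 0")
    case s: True
    hence "\<bar>s - lt n\<bar> < 1" by (auto simp: near_def split: split_indicator_asm)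
    hence "lt n \<le> 2 * s" using s by (auto simp: abs_if split: if_splits)
    hence "1 / s \<le> 2 / lt n" using s True by (simp add: field_simps)
    hence "near n s * (1 / s) \<le> near n s * (2 / lt n)" by (intro mult_left_mono near_nonneg)
    hence "near n s / s \<le> 2 / lt n * near n s" by (simp add: mult.commute)
    thus ?thesis using s True near_nonneg[of n s] by (simp add: ennreal_mult[symmetric] ennreal_leI)
  qed (auto simp: indicator_def)
  hence "(\<integral>\<^sup>+s. ennreal (near n s / s) * indicator {1..} s \<partial>lborel) \<le> (\<integral>\<^sup>+s. ennreal (2 / lt n) * ennreal (near n s) \<partial>lborel)"
    by (rule nn_integral_mono)
  also have "\<dots> = ennreal (2 / lt n) * (\<integral>\<^sup>+s. ennreal (near n s) \<partial>lborel)"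
    by (rule nn_integral_cmult) simp
  also have "\<dots> \<le> ennreal (2 / lt n) * ennreal (2 * ln (1 / gap n))"
    unfolding near_def by (intro mult_left_mono nn_integral_inverse_annulus gap_pos g) auto
  also have "ln (1 / gap n) = K * lt n" by (simp add: gap_eq ln_div)
  also have "ennreal (2 / lt n) * ennreal (2 * (K * lt n)) = ennreal (4 * K)"
    using True K(1) by (subst ennreal_mult[symmetric]) auto
  finally show ?thesis .
qed

text \<open>The average of the near-node contribution with respect to \<open>ds/s\<close> is finite while \<open>\<integral> ds/s\<close> diverges
  off the exceptional set, so it becomes arbitrarily small along a sequence of radii.\<close>

lemma near_small:
  fixes \<eta> :: "nat \<Rightarrow> real"
  assumes \<eta>: "\<And>n. \<eta> n \<ge> 0" "summable \<eta>" and C: "countable C" and \<epsilon>: "\<epsilon> > 0"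
  obtains s where "s \<ge> T" "s \<notin> exc \<union> C" "summable (\<lambda>n. \<eta> n * near n s)" "(\<Sum>n. \<eta> n * near n s) \<le> \<epsilon>"
proof -
  define \<Phi> where "\<Phi> = (\<lambda>s. \<Sum>n. ennreal (\<eta> n * near n s))"
  have \<Phi>_meas [measurable]: "\<Phi> \<in> borel_measurable borel" unfolding \<Phi>_def by measurable
  define S where "S = (\<Sum>n. \<eta> n)"
  have "(\<integral>\<^sup>+s. \<Phi> s * (ennreal (1 / s) * indicator {1..} s) \<partial>lborel) \<le> ennreal (4 * K * S)"
  proof -
    have "(\<integral>\<^sup>+s. \<Phi> s * (ennreal (1 / s) * indicator {1..} s) \<partial>lborel)
       = (\<integral>\<^sup>+s. (\<Sum>n. ennreal (\<eta> n) * (ennreal (near n s / s) * indicator {1..} s)) \<partial>lborel)"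
    proof (intro nn_integral_cong)
      fix s :: real
      have "ennreal (\<eta> n * near n s) * (ennreal (1 / s) * indicator {1..} s) = ennreal (\<eta> n) * (ennreal (near n s / s) * indicator {1..} s)" for n
      proof (cases "s \<ge> 1")
        case True
        thus ?thesis using \<eta>(1)[of n] near_nonneg[of n s] by (simp add: ennreal_mult[symmetric])
      qed simp
      thus "\<Phi> s * (ennreal (1 / s) * indicator {1..} s) = (\<Sum>n. ennreal (\<eta> n) * (ennreal (near n s / s) * indicator {1..} s))"
        unfolding \<Phi>_def by (simp add: ennreal_suminf_multc[symmetric])
    qed
    also have "\<dots> = (\<Sum>n. \<integral>\<^sup>+s. ennreal (\<eta> n) * (ennreal (near n s / s) * indicator {1..} s) \<partial>lborel)"
      by (rule nn_integral_suminf) measurable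
    also have "\<dots> = (\<Sum>n. ennreal (\<eta> n) * (\<integral>\<^sup>+s. ennreal (near n s / s) * indicator {1..} s \<partial>lborel))"
      by (intro suminf_cong nn_integral_cmult) measurable
    also have "\<dots> \<le> (\<Sum>n. ennreal (\<eta> n) * ennreal (4 * K))"
      by (intro suminf_le mult_left_mono near_weighted_integral) auto
    also have "\<dots> = (\<Sum>n. ennreal (\<eta> n * (4 * K)))" using \<eta>(1) K(1) by (simp add: ennreal_mult)
    also have "\<dots> = ennreal (\<Sum>n. \<eta> n * (4 * K))"
      using \<eta> K(1) by (intro suminf_ennreal2) (auto intro: summable_mult2)
    also have "(\<Sum>n. \<eta> n * (4 * K)) = 4 * K * S" unfolding S_def using \<eta>(2) by (subst suminf_mult2[symmetric]) auto
    finally show ?thesis .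
  qed
  note int\<Phi> = this
  have S0: "S \<ge> 0" unfolding S_def using \<eta> by (intro suminf_nonneg)
  have "\<exists>s\<ge>T. s \<notin> exc \<union> C \<and> \<Phi> s \<le> ennreal \<epsilon>"
  proof (rule ccontr)
    assume "\<not> ?thesis"
    hence big: "\<And>s. s \<ge> T \<Longrightarrow> s \<notin> exc \<union> C \<Longrightarrow> \<Phi> s > ennreal \<epsilon>" by force
    define T0 where "T0 = max 1 T"
    define m where "m = 2 * (\<Sum>n. gap n)"
    have m0: "m \<ge> 0" unfolding m_def using gap_summable gap_pos by (auto intro!: suminf_nonneg simp: less_imp_le)
    \<comment> \<open>The integral of \<open>1 / s\<close> over \<open>T0..Y\<close> is
      \<open>4 K S / \<epsilon> + m + 1\<close>, one more than the contributions of large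
      \<open>\<Phi>\<close> and of the exceptional set together allow.\<close>
    define Y where "Y = T0 * exp (4 * K * S / \<epsilon> + m + 1)"
    have T0: "T0 \<ge> 1" "T0 \<ge> T" by (auto simp: T0_def)
    have Y: "Y \<ge> T0"
    proof -
      have "1 \<le> exp (4 * K * S / \<epsilon> + m + 1)" using K(1) S0 \<epsilon> m0 by (simp add: add_nonneg_nonneg)
      thus ?thesis using T0 by (simp add: Y_def)
    qed
    have "ennreal (4 * K * S / \<epsilon> + m + 1) = ennreal (ln Y - ln T0)"
      using T0 by (simp add: Y_def ln_mult)
    also have "\<dots> = (\<integral>\<^sup>+s. ennreal (1 / s) * indicator {T0..Y} s \<partial>lborel)"
      by (rule nn_integral_FTC_Icc[symmetric]) (use T0 Y in \<open>auto intro!: derivative_eq_intros\<close>)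
    also have "\<dots> \<le> (\<integral>\<^sup>+s. ennreal (1 / \<epsilon>) * (\<Phi> s * (ennreal (1 / s) * indicator {1..} s)) + indicator (exc \<union> C) s \<partial>lborel)"
    proof (intro nn_integral_mono)
      fix s :: real
      show "ennreal (1 / s) * indicator {T0..Y} s \<le> ennreal (1 / \<epsilon>) * (\<Phi> s * (ennreal (1 / s) * indicator {1..} s)) + indicator (exc \<union> C) s"
      proof (cases "s \<in> {T0..Y}")
        case True
        hence s: "s \<ge> 1" "s \<ge> T" using T0 by auto
        show ?thesis
        proof (cases "s \<in> exc \<union> C")
          case inE: True
          have "ennreal (1 / s) \<le> ennreal 1" using s by (intro ennreal_leI) simp
          also have "\<dots> \<le> ennreal (1 / \<epsilon>) * (\<Phi> s * (ennreal (1 / s) * indicator {1..} s)) + indicator (exc \<union> C) s"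
            using inE by (simp only: indicator_simps ennreal_1) (rule add_increasing, simp, simp)
          finally show ?thesis using True by simp
        next
          case notE: False
          have "ennreal (1 / s) = ennreal (1 / \<epsilon>) * (ennreal \<epsilon> * ennreal (1 / s))"
            using \<epsilon> s by (simp add: ennreal_mult[symmetric])
          also have "\<dots> \<le> ennreal (1 / \<epsilon>) * (\<Phi> s * ennreal (1 / s))"
            using big[OF s(2) notE] by (intro mult_left_mono mult_right_mono) auto
          finally show ?thesis using True s notE by simp
        qed
      qed simp
    qed
    also have "\<dots> = ennreal (1 / \<epsilon>) * (\<integral>\<^sup>+s. \<Phi> s * (ennreal (1 / s) * indicator {1..} s) \<partial>lborel) + emeasure lborel (exc \<union> C)"
      using exc_Un_countable(2)[OF C] by (subst nn_integral_add) (simp_all add: nn_integral_cmult)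
    also have "\<dots> \<le> ennreal (1 / \<epsilon>) * ennreal (4 * K * S) + ennreal m"
      unfolding m_def by (intro add_mono mult_left_mono int\<Phi> exc_Un_countable(3) C) auto
    also have "\<dots> = ennreal (4 * K * S / \<epsilon> + m)"
      using \<epsilon> K(1) S0 m0 by (simp add: ennreal_mult[symmetric] ennreal_plus[symmetric] del: ennreal_plus)
    finally show False using K(1) S0 \<epsilon> m0 by (subst (asm) ennreal_le_iff) auto
  qed
  then obtain s where s: "s \<ge> T" "s \<notin> exc \<union> C" "\<Phi> s \<le> ennreal \<epsilon>" by blast
  have nn: "\<eta> n * near n s \<ge> 0" for n using \<eta>(1) near_nonneg by simp
  have fin: "(\<Sum>n. ennreal (\<eta> n * near n s)) \<noteq> top" using s(3) unfolding \<Phi>_def by (auto simp: top_unique)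
  have sm: "summable (\<lambda>n. \<eta> n * near n s)" by (rule summable_suminf_not_top[OF nn fin])
  have "ennreal (\<Sum>n. \<eta> n * near n s) \<le> ennreal \<epsilon>"
    using s(3) unfolding \<Phi>_def by (subst (asm) suminf_ennreal2[OF nn sm])
  hence "(\<Sum>n. \<eta> n * near n s) \<le> \<epsilon>" using \<epsilon> by (simp add: ennreal_le_iff)
  thus ?thesis using that s sm by blast
qed

text \<open>The first \<open>N\<close> nodes are made negligible by taking the radius large. For the
  remaining ones \<open>norm (t n) / norm (w - t n)\<close> is at most \<open>2 + 2 near n s\<close>
  uniformly on the circle, so a small tail of \<open>\<eta>\<close> and \<open>near_small\<close>
  suffice.\<close>

lemma good_radius:
  fixes \<eta> :: "nat \<Rightarrow> real"
  assumes \<eta>: "\<And>n. \<eta> n \<ge> 0" "summable \<eta>" and C: "countable C" and \<epsilon>: "\<epsilon> > 0"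
  shows "\<exists>s\<ge>T. s \<notin> exc \<union> C \<and> (\<forall>w. norm w = exp s \<longrightarrow>
    summable (\<lambda>n. \<eta> n * (norm (t n) / norm (w - t n))) \<and>
    (\<Sum>n. \<eta> n * (norm (t n) / norm (w - t n))) \<le> \<epsilon>)"
proof -
  define S where "S = (\<Sum>n. \<eta> n)"
  have S0: "S \<ge> 0" unfolding S_def using \<eta> by (intro suminf_nonneg)
  obtain N where N: "(\<Sum>n. \<eta> (n + N)) \<le> \<epsilon> / 8"
  proof -
    have "(\<lambda>N. \<Sum>n. \<eta> (n + N)) \<longlonglongrightarrow> 0" by (rule suminf_exist_split2[OF \<eta>(2)])
    hence "eventually (\<lambda>N. (\<Sum>n. \<eta> (n + N)) < \<epsilon> / 8) sequentially" using \<epsilon> by (intro order_tendstoD(2)) auto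
    then obtain N where "(\<Sum>n. \<eta> (n + N)) < \<epsilon> / 8" by (auto simp: eventually_sequentially)
    thus ?thesis by (intro that[of N]) simp
  qed
  define \<delta> where "\<delta> = \<epsilon> / (4 * (S + 1))"
  have \<delta>: "\<delta> > 0" "\<delta> * S \<le> \<epsilon> / 4" using \<epsilon> S0 by (auto simp: \<delta>_def field_simps)
  define T1 where "T1 = max T (Max (insert 0 ((\<lambda>n. lt n + ln (1 + 1 / \<delta>)) ` {..<N})))"
  have T1: "T \<le> T1" "\<And>n. n < N \<Longrightarrow> lt n + ln (1 + 1 / \<delta>) \<le> T1"
    by (auto simp: T1_def intro!: max.coboundedI2 Max_ge)
  have "\<epsilon> / 8 > 0" using \<epsilon> by simp
  from near_small[OF \<eta> C this, of T1] obtain s where s: "s \<ge> T1" "s \<notin> exc \<union> C" "summable (\<lambda>n. \<eta> n * near n s)" "(\<Sum>n. \<eta> n * near n s) \<le> \<epsilon> / 8"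
    by metis
  have snear: "summable (\<lambda>n. \<eta> n * near n s)" by fact
  \<comment> \<open>The three summands contribute at most \<open>\<epsilon> / 4\<close> each:
    \<open>\<delta> S\<close>, twice the tail of \<open>\<eta>\<close>, and twice the sum with
    \<open>near\<close>.\<close>
  define B where "B n = (if n < N then \<eta> n * \<delta> else 0) + (if n < N then 0 else 2 * \<eta> n) + 2 * (\<eta> n * near n s)" for n
  have le: "\<eta> n * (norm (t n) / norm (w - t n)) \<le> B n" if w: "norm w = exp s" for n w
  proof (cases "n < N")
    case True
    have "1 + 1 / \<delta> = exp (ln (1 + 1 / \<delta>))" using \<delta>(1) by (simp add: add_pos_pos)
    also have "\<dots> \<le> exp (s - lt n)" using T1(2)[OF True] s(1) by simp
    also have "\<dots> = norm w / norm (t n)" using w t_nonzero[of n] by (simp add: exp_diff lt_def)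
    finally have "norm (t n) / \<delta> \<le> norm w - norm (t n)" using t_nonzero[of n] \<delta>(1) by (simp add: field_simps)
    also have "\<dots> \<le> norm (w - t n)" by (rule norm_triangle_ineq2)
    finally have h: "norm (t n) \<le> \<delta> * norm (w - t n)" using \<delta>(1) by (simp add: field_simps)
    moreover have "norm (w - t n) > 0"
      using h t_nonzero[of n] \<delta>(1) by (smt (verit) mult_nonneg_nonpos zero_less_norm_iff)
    ultimately have "norm (t n) / norm (w - t n) \<le> \<delta>" by (simp add: pos_divide_le_eq)
    hence "\<eta> n * (norm (t n) / norm (w - t n)) \<le> \<eta> n * \<delta>" by (intro mult_left_mono \<eta>)
    moreover have "0 \<le> 2 * (\<eta> n * near n s)" using \<eta>(1)[of n] near_nonneg[of n s] by simp
    ultimately show ?thesis using True unfolding B_def by (simp only: if_True)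
  next
    case False
    have w0: "w \<noteq> 0" using w by auto
    define y where "y = \<bar>s - lt n\<bar>"
    have lnw: "ln (norm w) = s" using w by simp
    have y: "y \<ge> gap n"
    proof -
      have "s \<notin> {lt n - gap n<..<lt n + gap n}" using s(2) by (auto simp: exc_def)
      thus ?thesis by (auto simp: y_def)
    qed
    hence y0: "y > 0" using gap_pos[of n] by simp
    have "norm (w - t n) \<ge> norm (t n) * (min 1 y / 2)" using dist_node_ge(1)[OF w0, of n] by (simp add: lnw y_def)
    moreover have "norm (t n) * (min 1 y / 2) > 0" using y0 t_nonzero[of n] by simp
    ultimately have "norm (t n) / norm (w - t n) \<le> norm (t n) / (norm (t n) * (min 1 y / 2))"
      by (intro frac_le) auto
    also have "\<dots> = 2 / min 1 y" using t_nonzero[of n] by simp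
    also have "\<dots> \<le> 2 + 2 * (if y < 1 then 1 / y else 0)" using y0 by (auto simp: min_def)
    finally have 1: "norm (t n) / norm (w - t n) \<le> 2 + 2 * (if y < 1 then 1 / y else 0)" .
    have nr: "near n s = (if y < 1 then 1 / y else 0)" using y by (simp add: near_def y_def indicator_def)
    have "\<eta> n * (norm (t n) / norm (w - t n)) \<le> \<eta> n * (2 + 2 * near n s)"
      unfolding nr by (rule mult_left_mono[OF 1 \<eta>(1)])
    also have "\<dots> = B n" using False by (simp add: B_def algebra_simps)
    finally show ?thesis .
  qed
  have B1: "(\<lambda>n. if n < N then \<eta> n * \<delta> else 0) sums (\<Sum>n<N. \<eta> n * \<delta>)"
    using sums_If_finite_set[of "{..<N}" "\<lambda>n. \<eta> n * \<delta>"] by simp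
  have B2: "(\<lambda>n. if n < N then 0 else 2 * \<eta> n) sums (2 * (\<Sum>n. \<eta> (n + N)))"
  proof -
    have "(\<lambda>n. 2 * \<eta> (n + N)) sums (2 * (\<Sum>n. \<eta> (n + N)))"
      using \<eta>(2) by (intro sums_mult summable_sums) (simp add: summable_iff_shift)
    hence "(\<lambda>n. (\<lambda>n. if n < N then 0 else 2 * \<eta> n) (n + N)) sums (2 * (\<Sum>n. \<eta> (n + N)))" by simp
    thus ?thesis by (subst (asm) sums_iff_shift) simp
  qed
  have sB: "B sums ((\<Sum>n<N. \<eta> n * \<delta>) + 2 * (\<Sum>n. \<eta> (n + N)) + 2 * (\<Sum>n. \<eta> n * near n s))"
    unfolding B_def[abs_def] by (intro sums_add B1 B2 sums_mult summable_sums snear)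
  have "(\<Sum>n<N. \<eta> n * \<delta>) \<le> S * \<delta>"
    unfolding sum_distrib_right[symmetric] S_def using \<eta> \<delta>(1) by (intro mult_right_mono sum_le_suminf) auto
  hence Bsum: "suminf B \<le> \<epsilon>" "summable B"
    using sB N s(4) \<delta>(2) \<epsilon> by (auto simp: sums_iff mult.commute)
  have sm: "summable (\<lambda>n. \<eta> n * (norm (t n) / norm (w - t n)))" if w: "norm w = exp s" for w
    by (rule summable_comparison_test'[OF Bsum(2)]) (use le[OF w] \<eta>(1) in auto)
  moreover have "(\<Sum>n. \<eta> n * (norm (t n) / norm (w - t n))) \<le> \<epsilon>" if w: "norm w = exp s" for w
    using suminf_le[OF le[OF w] sm[OF w] Bsum(2)] Bsum(1) by simp
  moreover have "s \<ge> T" using s(1) T1(1) by simp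
  ultimately show ?thesis using s(2) by blast
qed

end

section \<open>Canonical products\<close>

lemma powr_summable_larger:
  assumes t: "filterlim (\<lambda>n. norm (t n :: complex)) at_top sequentially" and s: "summable (\<lambda>n. norm (t n) powr (- K))" and le: "K \<le> L"
  shows "summable (\<lambda>n. norm (t n) powr (- L))"
proof (rule summable_comparison_test_ev[OF _ s])
  have "eventually (\<lambda>n. norm (t n) \<ge> 1) sequentially" using t by (simp add: filterlim_at_top)
  thus "\<forall>\<^sub>F n in sequentially. norm (norm (t n) powr - L) \<le> norm (t n) powr - K"
    by eventually_elim (use le in \<open>auto intro!: powr_mono\<close>)
qed

lemma powr_neg_Suc: "x > 0 \<Longrightarrow> x powr (- (real p + 1)) = 1 / x ^ (p + 1)" for x :: real
proof -
  assume x: "x > 0"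
  have "x powr (- (real p + 1)) = inverse (x powr (real (p + 1)))" by (subst powr_minus) (simp add: add.commute)
  also have "\<dots> = 1 / x ^ (p + 1)" using x by (simp only: powr_realpow inverse_eq_divide)
  finally show ?thesis .
qed

lemma genus_summable:
  assumes "admissible_set t"
  shows "summable (\<lambda>n. norm (t n) powr (- (real (genus t) + 1)))"
proof -
  have t: "filterlim (\<lambda>n. norm (t n)) at_top sequentially" and nz: "\<And>n. t n \<noteq> 0"
    using assms by (auto simp: admissible_set_def)
  obtain K where K: "K > 0" "summable (\<lambda>n. norm (t n) powr (- K))" using assms by (auto simp: admissible_set_def)
  have eq: "(\<lambda>n. 1 / norm (t n) ^ (p + 1)) = (\<lambda>n. norm (t n) powr (- (real p + 1)))" for p
    by (rule ext) (simp only: powr_neg_Suc zero_less_norm_iff nz not_False_eq_True)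
  have "K \<le> real (nat \<lceil>K\<rceil>) + 1" using real_nat_ceiling_ge[of K] by simp
  hence "summable (\<lambda>n. 1 / norm (t n) ^ (nat \<lceil>K\<rceil> + 1))"
    unfolding eq by (rule powr_summable_larger[OF t K(2)])
  hence "summable (\<lambda>n. 1 / norm (t n) ^ (genus t + 1))"
    unfolding genus_def by (rule LeastI[of "\<lambda>p. summable (\<lambda>n. 1 / norm (t n) ^ (p + 1))"])
  thus ?thesis unfolding eq .
qed

text \<open>If the genus exceeded \<open>K\<close>, the series with exponent \<open>genus t\<close>
  would converge already, against minimality.\<close>

lemma genus_le:
  assumes t: "admissible_set t" and K: "K > 0" "summable (\<lambda>n. norm (t n) powr (- K))"
  shows "real (genus t) \<le> K"
proof (rule ccontr)
  assume "\<not> ?thesis"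
  then obtain p where p: "genus t = Suc p" "K \<le> real p + 1" by (cases "genus t") (use K in auto)
  have ft: "filterlim (\<lambda>n. norm (t n)) at_top sequentially" and nz: "\<And>n. t n \<noteq> 0"
    using t by (auto simp: admissible_set_def)
  have "summable (\<lambda>n. norm (t n) powr (- (real p + 1)))" by (rule powr_summable_larger[OF ft K(2) p(2)])
  also have "(\<lambda>n. norm (t n) powr (- (real p + 1))) = (\<lambda>n. 1 / norm (t n) ^ (p + 1))"
    by (rule ext) (simp only: powr_neg_Suc zero_less_norm_iff nz not_False_eq_True)
  finally have "genus t \<le> p" unfolding genus_def by (rule Least_le)
  thus False using p by simp
qed

lemma weierstrass_factor_eq: "Defs.weierstrass_factor = Weierstrass_Factorization.weierstrass_factor"
  by (simp add: fun_eq_iff Defs.weierstrass_factor_def Weierstrass_Factorization.weierstrass_factor_def)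

text \<open>Identification with a Weierstrass product of constant genus gives the zeros with their
  multiplicities; \<open>zorder\<close> counts the indices of a node, and injectivity of
  \<open>t\<close> makes the count one.\<close>

lemma canonical_product_props:
  assumes t: "admissible_set t" and A: "canonical_product t A"
  shows "A holomorphic_on UNIV" "A z = 0 \<longleftrightarrow> z \<in> range t" "deriv A (t n) \<noteq> 0"
proof -
  have ft: "filterlim (\<lambda>n. norm (t n)) at_top sequentially" and nz: "\<And>n. t n \<noteq> 0" and inj: "inj t"
    using t by (auto simp: admissible_set_def)
  interpret W: weierstrass_product t "\<lambda>_. genus t"
  proof
    show "t n \<noteq> 0" for n by (rule nz)
    show "filterlim t at_infinity sequentially" using ft by (rule filterlim_norm_at_top_imp_at_infinity)
    fix r :: real assume "r > 0"
    have "(\<lambda>n. (r / norm (t n)) ^ Suc (genus t)) = (\<lambda>n. r ^ Suc (genus t) * norm (t n) powr (- (real (genus t) + 1)))"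
      by (rule ext) (simp only: powr_neg_Suc zero_less_norm_iff nz not_False_eq_True power_divide Suc_eq_plus1 times_divide_eq_right mult_1_right)
    thus "summable (\<lambda>n. (r / norm (t n)) ^ Suc (genus t))"
      using summable_mult[OF genus_summable[OF t], of "r ^ Suc (genus t)"] by (simp only:)
  qed
  have Af: "A = W.f"
  proof
    fix z
    have "(\<lambda>N. \<Prod>n<N. Weierstrass_Factorization.weierstrass_factor (genus t) (z / t n)) \<longlonglongrightarrow> A z"
      using A by (simp add: canonical_product_def weierstrass_factor_eq)
    moreover have "(\<lambda>N. \<Prod>n<N. Weierstrass_Factorization.weierstrass_factor (genus t) (z / t n)) \<longlonglongrightarrow> W.f z"
      by (rule has_prod_imp_tendsto'[OF W.has_prod])
    ultimately show "A z = W.f z" by (rule LIMSEQ_unique)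
  qed
  show hol: "A holomorphic_on UNIV" unfolding Af by (rule W.holomorphic)
  show zero: "A z = 0 \<longleftrightarrow> z \<in> range t" for z unfolding Af by (rule W.zero)
  obtain b where b: "A b \<noteq> 0"
  proof -
    have "range t \<noteq> UNIV" using uncountable_UNIV_complex by (metis countable_image countableI_type)
    thus ?thesis using that zero by blast
  qed
  obtain g m where g: "g holomorphic_on UNIV" "\<And>z. A z = (z - t n) ^ m * g z" "g (t n) \<noteq> 0"
    using holomorphic_factor_zero_global[OF hol open_UNIV connected_UNIV, of "t n" b] b zero by auto
  have "zorder A (t n) = int m"
    by (rule zorder_eqI[OF open_UNIV _ g(1,3)]) (use g(2) in auto)
  moreover have "zorder A (t n) = int (card (t -` {t n}))" unfolding Af by (rule W.zorder)
  moreover have "t -` {t n} = {n}" using inj by (auto simp: inj_eq)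
  ultimately have m: "m = 1" by simp
  have "((\<lambda>z. (z - t n) * g z) has_field_derivative (1 * g (t n) + deriv g (t n) * (t n - t n))) (at (t n))"
    using g(1) by (intro DERIV_mult derivative_eq_intros holomorphic_derivI[of g UNIV]) auto
  also have "(\<lambda>z. (z - t n) * g z) = A" using g(2) by (simp add: m fun_eq_iff)
  finally show "deriv A (t n) \<noteq> 0" using g(3) DERIV_imp_deriv by fastforce
qed

text \<open>Absorbs a linear factor at arbitrarily small cost in the type.\<close>

lemma one_plus_le_exp_powr:
  fixes \<epsilon> \<sigma> :: real
  assumes "\<epsilon> > 0" "\<sigma> > 0"
  obtains C where "C > 0" "\<And>x. x \<ge> 0 \<Longrightarrow> 1 + x \<le> C * exp (\<epsilon> * x powr \<sigma>)"
proof -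
  \<comment> \<open>\<open>a \<le> 1\<close> serves \<open>a (1 + y) \<le> 1 + a y\<close>;
    \<open>a \<le> \<epsilon> \<sigma>\<close> makes the root of order \<open>\<sigma>\<close> end
    with exponent at most \<open>\<epsilon>\<close>.\<close>
  define a where "a = min 1 (\<epsilon> * \<sigma>)"
  have a: "0 < a" "a \<le> 1" "a \<le> \<epsilon> * \<sigma>" using assms by (auto simp: a_def)
  define C where "C = (2 powr \<sigma> / a) powr (1 / \<sigma>)"
  have "1 + x \<le> C * exp (\<epsilon> * x powr \<sigma>)" if x: "x \<ge> 0" for x
  proof -
    have "(1 + x) powr \<sigma> \<le> 2 powr \<sigma> * (1 powr \<sigma> + x powr \<sigma>)" using x assms by (intro powr_add_le) auto
    also have "1 powr \<sigma> + x powr \<sigma> \<le> exp (a * x powr \<sigma>) / a"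
    proof -
      have "a * (1 + x powr \<sigma>) \<le> 1 + a * x powr \<sigma>" using a by (simp add: algebra_simps)
      also have "\<dots> \<le> exp (a * x powr \<sigma>)" by (rule exp_ge_add_one_self)
      finally show ?thesis using a(1) by (simp add: field_simps)
    qed
    finally have "(1 + x) powr \<sigma> \<le> 2 powr \<sigma> / a * exp (a * x powr \<sigma>)" by simp
    also have "\<dots> \<le> 2 powr \<sigma> / a * exp (\<epsilon> * \<sigma> * x powr \<sigma>)"
      using a by (intro mult_left_mono iffD2[OF exp_le_cancel_iff] mult_right_mono) auto
    finally have "((1 + x) powr \<sigma>) powr (1 / \<sigma>) \<le> (2 powr \<sigma> / a * exp (\<epsilon> * \<sigma> * x powr \<sigma>)) powr (1 / \<sigma>)"
      using assms by (intro powr_mono2) auto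
    also have "\<dots> = C * exp (\<epsilon> * x powr \<sigma>)"
      using a assms unfolding C_def by (subst powr_mult) (auto simp: exp_powr_real)
    finally show ?thesis using x assms by (simp add: powr_powr)
  qed
  moreover have "C > 0" using a by (simp add: C_def)
  ultimately show ?thesis using that by blast
qed

text \<open>Near 0 the factor differs from 1 by O(u^(p+1)), which needs
  \<open>\<tau> \<le> p + 1\<close>; away from 0 the exponent is a polynomial of degree at most
  \<open>p\<close>, which needs \<open>p \<le> \<tau>\<close>.\<close>

lemma weierstrass_factor_growth:
  assumes \<tau>: "\<tau> > 0" "real p \<le> \<tau>" "\<tau> \<le> real p + 1"
  obtains c where "c > 0" "\<And>u. norm (Weierstrass_Factorization.weierstrass_factor p u) \<le> exp (c * norm u powr \<tau>)"
proof -
  obtain C where C: "C > 0" "\<And>x. x \<ge> 0 \<Longrightarrow> 1 + x \<le> C * exp (1 * x powr \<tau>)"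
    using one_plus_le_exp_powr[of 1 \<tau>] \<tau> by auto
  define c where "c = 3 + 1 + C * 2 powr \<tau> + real p * 2 powr \<tau>"
  have "0 \<le> C * 2 powr \<tau>" "0 \<le> real p * 2 powr \<tau>" using C(1) by simp_all
  hence c: "c > 0" unfolding c_def by linarith
  have "norm (Weierstrass_Factorization.weierstrass_factor p u) \<le> exp (c * norm u powr \<tau>)" for u
  proof (cases "norm u \<le> 1 / 2")
    case True
    have "norm (Weierstrass_Factorization.weierstrass_factor p u) \<le> 1 + norm (Weierstrass_Factorization.weierstrass_factor p u - 1)"
      using norm_triangle_ineq[of 1 "Weierstrass_Factorization.weierstrass_factor p u - 1"] by simp
    also have "\<dots> \<le> 1 + 3 * norm u ^ Suc p" using weierstrass_factor_bound[OF True, of p] by simp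
    also have "norm u ^ Suc p \<le> norm u powr \<tau>"
    proof (cases "u = 0")
      case False
      hence "norm u ^ Suc p = norm u powr (real p + 1)" using powr_realpow[of "norm u" "Suc p"] by (simp add: add.commute)
      also have "\<dots> \<le> norm u powr \<tau>" using True \<tau> by (intro powr_mono') auto
      finally show ?thesis .
    qed simp
    also have "1 + 3 * norm u powr \<tau> \<le> exp (3 * norm u powr \<tau>)" by (rule exp_ge_add_one_self)
    also have "\<dots> \<le> exp (c * norm u powr \<tau>)" using C by (auto simp: c_def intro!: mult_right_mono add_nonneg_nonneg)
    finally show ?thesis by simp
  next
    case False
    have pk: "norm u ^ k \<le> 2 powr \<tau> * norm u powr \<tau>" if k: "k \<le> p" for k
    proof (cases "norm u \<ge> 1")
      case True
      have "norm u ^ k = norm u powr real k" using True by (subst powr_realpow) auto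
      also have "\<dots> \<le> norm u powr \<tau>" using True k \<tau> by (intro powr_mono) auto
      also have "\<dots> \<le> 2 powr \<tau> * norm u powr \<tau>" using \<tau> ge_one_powr_ge_zero[of 2 \<tau>] by (simp add: mult_le_cancel_right1)
      finally show ?thesis .
    next
      case le: False
      have "norm u ^ k \<le> 1" using le by (intro power_le_one) auto
      also have "1 \<le> (2 * norm u) powr \<tau>" using False \<tau> by (intro ge_one_powr_ge_zero) auto
      also have "\<dots> = 2 powr \<tau> * norm u powr \<tau>" by (simp add: powr_mult)
      finally show ?thesis .
    qed
    have "norm (\<Sum>k=1..p. u ^ k / of_nat k) \<le> (\<Sum>k=1..p. 2 powr \<tau> * norm u powr \<tau>)"
    proof (rule sum_norm_le)
      fix k assume k: "k \<in> {1..p}"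
      have "norm (u ^ k / of_nat k) \<le> norm u ^ k / 1" using k by (simp add: norm_divide norm_power divide_le_eq mult_le_cancel_left1)
      thus "norm (u ^ k / of_nat k) \<le> 2 powr \<tau> * norm u powr \<tau>" using pk[of k] k by simp
    qed
    also have "\<dots> = real p * 2 powr \<tau> * norm u powr \<tau>" by simp
    finally have e: "norm (exp (\<Sum>k=1..p. u ^ k / of_nat k)) \<le> exp (real p * 2 powr \<tau> * norm u powr \<tau>)"
      using norm_exp[of "\<Sum>k=1..p. u ^ k / of_nat k"] by (smt (verit) exp_le_cancel_iff)
    have "norm (1 - u) \<le> 1 + norm u" using norm_triangle_ineq4[of 1 u] by simp
    also have "\<dots> \<le> C * exp (norm u powr \<tau>)" using C(2)[of "norm u"] by simp
    also have "\<dots> \<le> exp (C * 2 powr \<tau> * norm u powr \<tau>) * exp (norm u powr \<tau>)"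
    proof (intro mult_right_mono)
      have "C \<le> exp (C * 1)" unfolding mult_1_right using exp_ge_add_one_self[of C] by linarith
      also have "1 \<le> (2 * norm u) powr \<tau>" using False \<tau> by (intro ge_one_powr_ge_zero) auto
      also have "(2 * norm u) powr \<tau> = 2 powr \<tau> * norm u powr \<tau>" by (simp add: powr_mult)
      finally show "C \<le> exp (C * 2 powr \<tau> * norm u powr \<tau>)" using C(1) by (simp add: mult.assoc)
    qed auto
    finally have "norm (Weierstrass_Factorization.weierstrass_factor p u) \<le>
       (exp (C * 2 powr \<tau> * norm u powr \<tau>) * exp (norm u powr \<tau>)) * exp (real p * 2 powr \<tau> * norm u powr \<tau>)"
      unfolding Weierstrass_Factorization.weierstrass_factor_def norm_mult using e by (intro mult_mono) auto
    also have "\<dots> = exp ((C * 2 powr \<tau> + 1 + real p * 2 powr \<tau>) * norm u powr \<tau>)"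
      by (simp add: exp_add[symmetric] algebra_simps)
    also have "\<dots> \<le> exp (c * norm u powr \<tau>)" unfolding exp_le_cancel_iff c_def by (intro mult_right_mono) auto
    finally show ?thesis .
  qed
  thus ?thesis using that c by blast
qed

lemma canonical_product_growth:
  assumes t: "admissible_set t" and A: "canonical_product t A" and K: "K > 0" "summable (\<lambda>n. norm (t n) powr (- K))"
  obtains \<tau> \<kappa> where "0 < \<tau>" "\<tau> \<le> K" "\<kappa> > 0" "\<And>z. norm (A z) \<le> exp (\<kappa> * norm z powr \<tau>)"
proof -
  define \<tau> where "\<tau> = min K (real (genus t) + 1)"
  have \<tau>: "0 < \<tau>" "\<tau> \<le> K" "real (genus t) \<le> \<tau>" "\<tau> \<le> real (genus t) + 1"
    using K(1) genus_le[OF t K] by (auto simp: \<tau>_def)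
  have sm: "summable (\<lambda>n. norm (t n) powr (- \<tau>))"
    using K(2) genus_summable[OF t] by (cases "K \<le> real (genus t) + 1") (simp_all add: \<tau>_def min_def)
  obtain c where c: "c > 0" "\<And>u. norm (Weierstrass_Factorization.weierstrass_factor (genus t) u) \<le> exp (c * norm u powr \<tau>)"
    using weierstrass_factor_growth[OF \<tau>(1,3,4)] by metis
  define S where "S = (\<Sum>n. norm (t n) powr (- \<tau>))"
  have S: "S \<ge> 0" unfolding S_def by (intro suminf_nonneg sm) auto
  have "norm (A z) \<le> exp (c * (S + 1) * norm z powr \<tau>)" for z
  proof (rule tendsto_upperbound)
    have "(\<lambda>N. \<Prod>n<N. Weierstrass_Factorization.weierstrass_factor (genus t) (z / t n)) \<longlonglongrightarrow> A z"
      using A by (simp add: canonical_product_def weierstrass_factor_eq)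
    thus "(\<lambda>N. norm (\<Prod>n<N. Weierstrass_Factorization.weierstrass_factor (genus t) (z / t n))) \<longlonglongrightarrow> norm (A z)"
      by (rule tendsto_norm)
    have "norm (\<Prod>n<N. Weierstrass_Factorization.weierstrass_factor (genus t) (z / t n)) \<le> exp (c * (S + 1) * norm z powr \<tau>)" for N
    proof -
      have "norm (\<Prod>n<N. Weierstrass_Factorization.weierstrass_factor (genus t) (z / t n)) \<le> (\<Prod>n<N. exp (c * norm (z / t n) powr \<tau>))"
        unfolding prod_norm[symmetric] by (intro prod_mono) (auto simp: c)
      also have "\<dots> = exp (\<Sum>n<N. c * norm (z / t n) powr \<tau>)" by (simp add: exp_sum)
      also have "(\<Sum>n<N. c * norm (z / t n) powr \<tau>) = c * norm z powr \<tau> * (\<Sum>n<N. norm (t n) powr (- \<tau>))"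
        unfolding sum_distrib_left by (intro sum.cong) (auto simp: norm_divide powr_divide powr_minus field_simps)
      also have "\<dots> \<le> c * norm z powr \<tau> * (S + 1)"
        using sum_le_suminf[OF sm, of "{..<N}"] c(1) by (intro mult_left_mono) (auto simp: S_def)
      finally show ?thesis by (simp add: mult_ac)
    qed
    thus "\<forall>\<^sub>F N in sequentially. norm (\<Prod>n<N. Weierstrass_Factorization.weierstrass_factor (genus t) (z / t n)) \<le> exp (c * (S + 1) * norm z powr \<tau>)"
      by simp
  qed simp
  moreover have "c * (S + 1) > 0" using c S by (intro mult_pos_pos) auto
  ultimately show ?thesis using that \<tau> by blast
qed

section \<open>Growth of the comparison function\<close>

context nodes
begin

text \<open>The radius \<open>norm w + 2\<close> of \<open>csum_bound\<close> costs the factor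
  \<open>2 powr \<sigma>\<close> through \<open>powr_add_le\<close>; its linear factor is absorbed
  by \<open>\<epsilon>\<close>.\<close>

lemma csum_growth:
  assumes Y: "Y holomorphic_on UNIV" "\<And>n. Y (t n) = 0" and u: "summable (\<lambda>n. norm (u n) / norm (t n))"
    and \<sigma>: "\<sigma> > 0" and \<kappa>: "\<kappa> \<ge> 0" and \<epsilon>: "\<epsilon> > 0"
    and Yb: "\<And>z. norm (Y z) \<le> C * exp (\<kappa> * norm z powr \<sigma>)"
  obtains D where "D \<ge> 0" "\<And>w. norm (csum Y u w) \<le> D * exp ((2 powr \<sigma> * \<kappa> + \<epsilon>) * norm w powr \<sigma>)"
proof -
  have C: "C \<ge> 0"
  proof -
    have "0 \<le> C * exp (\<kappa> * norm (0 :: complex) powr \<sigma>)" by (rule order_trans[OF norm_ge_zero Yb])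
    thus ?thesis by (simp add: zero_le_mult_iff)
  qed
  obtain C1 where C1: "C1 > 0" "\<And>x. x \<ge> 0 \<Longrightarrow> 1 + x \<le> C1 * exp (\<epsilon> * x powr \<sigma>)"
    using one_plus_le_exp_powr[OF \<epsilon> \<sigma>] by metis
  define S where "S = (\<Sum>n. norm (u n) / norm (t n))"
  have S: "S \<ge> 0" unfolding S_def by (intro suminf_nonneg u) auto
  define D where "D = S * (C1 * (C * exp (\<kappa> * 2 powr \<sigma> * 2 powr \<sigma>)))"
  have "norm (csum Y u w) \<le> D * exp ((2 powr \<sigma> * \<kappa> + \<epsilon>) * norm w powr \<sigma>)" for w
  proof -
    have "norm (csum Y u w) \<le> S * ((norm w + 1) * (C * exp (\<kappa> * (norm w + 2) powr \<sigma>)))"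
      unfolding S_def
    proof (rule csum_bound[OF Y u])
      fix z :: complex assume z: "norm z \<le> norm w + 2"
      have "norm (Y z) \<le> C * exp (\<kappa> * norm z powr \<sigma>)" by (rule Yb)
      also have "\<dots> \<le> C * exp (\<kappa> * (norm w + 2) powr \<sigma>)"
        using z C \<kappa> \<sigma> by (intro mult_left_mono iffD2[OF exp_le_cancel_iff] powr_mono2) auto
      finally show "norm (Y z) \<le> C * exp (\<kappa> * (norm w + 2) powr \<sigma>)" .
    qed
    also have "\<dots> \<le> S * ((C1 * exp (\<epsilon> * norm w powr \<sigma>)) * (C * exp (\<kappa> * (2 powr \<sigma> * (norm w powr \<sigma> + 2 powr \<sigma>)))))"
      using C1(2)[of "norm w"] C1(1) C S \<kappa> \<sigma>
      by (intro mult_left_mono mult_mono iffD2[OF exp_le_cancel_iff] powr_add_le) auto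
    also have "\<dots> = D * exp ((2 powr \<sigma> * \<kappa> + \<epsilon>) * norm w powr \<sigma>)"
      by (simp add: D_def exp_add[symmetric] algebra_simps)
    finally show ?thesis .
  qed
  moreover have "D \<ge> 0" using S C C1 by (simp add: D_def)
  ultimately show ?thesis using that by blast
qed

end

context cdb
begin

abbreviation wt :: "(complex \<Rightarrow> complex) \<Rightarrow> nat \<Rightarrow> complex" where
  "wt f \<equiv> (\<lambda>n. coef f n * of_real (sqrt (\<mu> n)))"

text \<open>Writes \<open>f\<close> as a quotient in which every occurrence of \<open>A\<close> is
  replaced by \<open>Y\<close>, so that bounds for \<open>Y\<close> alone control numerator and
  denominator. After multiplication by the square of \<open>A\<close> this is the defining identity
  of \<open>f\<close>.\<close>

lemma comparison_quotient:
  assumes Y: "Y holomorphic_on UNIV" "\<And>n. Y (t n) = 0"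
    and F: "F \<in> cdb_space t A \<mu>" and G: "G \<in> cdb_space t A \<mu>" and b: "l2seq b" and f: "f holomorphic_on UNIV"
    and eq: "\<And>w. f w * F w * A w = F w * pairing G b w - G w * pairing F b w" and a: "A a \<noteq> 0"
  shows "f w * (Y w * csum Y (wt F) w) =
     csum Y (wt F) w * csum Y (\<lambda>n. coef G n * b n) w - csum Y (wt G) w * csum Y (\<lambda>n. coef F n * b n) w"
proof -
  define D where "D = (\<lambda>w. f w * (Y w * csum Y (wt F) w) -
     (csum Y (wt F) w * csum Y (\<lambda>n. coef G n * b n) w - csum Y (wt G) w * csum Y (\<lambda>n. coef F n * b n) w))"
  note su = weight_summable[OF space_l2[OF F]] weight_summable[OF space_l2[OF G]]
    l1_summable[OF pairing_summable[OF F b]] l1_summable[OF pairing_summable[OF G b]]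
  have D: "D holomorphic_on UNIV"
    unfolding D_def by (intro holomorphic_intros csum_holomorphic[OF Y] f Y su)
  have ch: "csum Y u w * A w = csum A u w * Y w" if "summable (\<lambda>n. norm (u n) / norm (t n))" for u w
    by (rule csum_change_multiplier[OF Y A_entire A_node that])
  have c1: "csum Y (wt F) w * A w = F w * Y w" for w
    using ch[OF su(1)] space_csum[OF F] by metis
  have c2: "csum Y (wt G) w * A w = G w * Y w" for w
    using ch[OF su(2)] space_csum[OF G] by metis
  have c3: "csum Y (\<lambda>n. coef F n * b n) w * A w = pairing F b w * Y w" for w
    using ch[OF su(3)] by (simp add: pairing_def)
  have c4: "csum Y (\<lambda>n. coef G n * b n) w * A w = pairing G b w * Y w" for w
    using ch[OF su(4)] by (simp add: pairing_def)
  have AD: "A w * (A w * D w) = 0" for w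
  proof -
    have "A w * (A w * D w) = f w * Y w * A w * (csum Y (wt F) w * A w) -
      ((csum Y (wt F) w * A w) * (csum Y (\<lambda>n. coef G n * b n) w * A w) - (csum Y (wt G) w * A w) * (csum Y (\<lambda>n. coef F n * b n) w * A w))"
      by (simp add: D_def algebra_simps)
    also have "\<dots> = Y w * Y w * (f w * F w * A w - (F w * pairing G b w - G w * pairing F b w))"
      unfolding c1 c2 c3 c4 by (simp add: algebra_simps)
    also have "\<dots> = 0" by (simp add: eq)
    finally show ?thesis .
  qed
  have "A w * D w = 0" for w
    by (rule entire_mult_eq_zeroD[of A "\<lambda>w. A w * D w" a]) (use A_entire D a AD in \<open>auto intro: holomorphic_intros\<close>)
  hence "D w = 0"
    by (intro entire_mult_eq_zeroD[of A D a]) (use A_entire D a in auto)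
  thus ?thesis by (simp add: D_def)
qed

text \<open>Numerator and denominator are built from products of two functions of type
  \<open>2 powr \<sigma> * \<kappa> + \<epsilon>\<close>; this doubles the type, and
  \<open>quotient_entire_growth\<close> contributes \<open>3 * 4 powr \<sigma>\<close>.\<close>

lemma comparison_growth:
  assumes Y: "Y holomorphic_on UNIV" "\<And>n. Y (t n) = 0" "Y y0 \<noteq> 0"
    and F: "F \<in> cdb_space t A \<mu>" "F x0 \<noteq> 0" and G: "G \<in> cdb_space t A \<mu>" and b: "l2seq b" and f: "f holomorphic_on UNIV"
    and eq: "\<And>w. f w * F w * A w = F w * pairing G b w - G w * pairing F b w"
    and \<sigma>: "\<sigma> > 0" and \<kappa>: "\<kappa> \<ge> 0" and \<epsilon>: "\<epsilon> > 0"
    and Yb: "\<And>z. norm (Y z) \<le> C * exp (\<kappa> * norm z powr \<sigma>)"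
  shows "\<exists>C'. \<forall>z. norm (f z) \<le> C' * exp (6 * 4 powr \<sigma> * (2 powr \<sigma> * \<kappa> + \<epsilon>) * norm z powr \<sigma>)"
proof -
  obtain a where a: "A a \<noteq> 0" by (rule exists_off_node)
  note su = weight_summable[OF space_l2[OF F(1)]] weight_summable[OF space_l2[OF G]]
    l1_summable[OF pairing_summable[OF F(1) b]] l1_summable[OF pairing_summable[OF G b]]
  define l where "l = 2 powr \<sigma> * \<kappa> + \<epsilon>"
  have l: "l \<ge> 0" using \<kappa> \<epsilon> by (simp add: l_def)
  note gr = csum_growth[OF Y(1,2) _ \<sigma> \<kappa> \<epsilon> Yb, folded l_def]
  obtain D1 where D1: "D1 \<ge> 0" "\<And>w. norm (csum Y (wt F) w) \<le> D1 * exp (l * norm w powr \<sigma>)" using gr[OF su(1)] by metis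
  obtain D2 where D2: "D2 \<ge> 0" "\<And>w. norm (csum Y (wt G) w) \<le> D2 * exp (l * norm w powr \<sigma>)" using gr[OF su(2)] by metis
  obtain D3 where D3: "D3 \<ge> 0" "\<And>w. norm (csum Y (\<lambda>n. coef F n * b n) w) \<le> D3 * exp (l * norm w powr \<sigma>)" using gr[OF su(3)] by metis
  obtain D4 where D4: "D4 \<ge> 0" "\<And>w. norm (csum Y (\<lambda>n. coef G n * b n) w) \<le> D4 * exp (l * norm w powr \<sigma>)" using gr[OF su(4)] by metis
  have C: "C \<ge> 0"
  proof -
    have "0 \<le> C * exp (\<kappa> * norm (0 :: complex) powr \<sigma>)" by (rule order_trans[OF norm_ge_zero Yb])
    thus ?thesis by (simp add: zero_le_mult_iff)
  qed
  have YC: "norm (Y w) \<le> C * exp (l * norm w powr \<sigma>)" for w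
  proof -
    have "\<kappa> \<le> l" using \<kappa> \<epsilon> \<sigma> mult_right_mono[OF ge_one_powr_ge_zero[of 2 \<sigma>] \<kappa>] by (simp add: l_def)
    hence "C * exp (\<kappa> * norm w powr \<sigma>) \<le> C * exp (l * norm w powr \<sigma>)"
      using C by (intro mult_left_mono iffD2[OF exp_le_cancel_iff] mult_right_mono) auto
    thus ?thesis using Yb[of w] by linarith
  qed
  define p where "p = (\<lambda>w. Y w * csum Y (wt F) w)"
  have p: "p holomorphic_on UNIV" unfolding p_def by (intro holomorphic_intros csum_holomorphic[OF Y(1,2)] Y su)
  obtain z0 where z0: "p z0 \<noteq> 0"
  proof -
    have "\<exists>z. p z \<noteq> 0"
    proof (rule ccontr)
      assume "\<not> ?thesis"
      hence p0: "p z = 0" for z by blast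
      have "csum Y (wt F) z = 0" for z
        by (rule entire_mult_eq_zeroD[of Y _ y0]) (use p0 Y csum_holomorphic[OF Y(1,2) su(1)] in \<open>auto simp: p_def\<close>)
      hence "Y z * F z = 0" for z
        using csum_change_multiplier[OF Y(1,2) A_entire A_node su(1), of z] space_csum[OF F(1)] by (metis mult.commute mult_zero_left)
      hence "F x0 = 0" by (intro entire_mult_eq_zeroD[of Y F y0]) (use Y space_entire[OF F(1)] in auto)
      thus False using F(2) by simp
    qed
    thus ?thesis using that by blast
  qed
  define M where "M = C * D1 + (D1 * D4 + D2 * D3)"
  define e where "e = (\<lambda>w :: complex. exp (l * norm w powr \<sigma>))"
  have e2: "e w * e w = exp (2 * l * norm w powr \<sigma>)" for w by (simp add: e_def exp_add[symmetric])
  have e0: "e w \<ge> 0" for w by (simp add: e_def)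
  have mm: "norm (x * y) \<le> (X * X') * (e w * e w)" if "norm x \<le> X * e w" "norm y \<le> X' * e w" for x y :: complex and X X' w
  proof -
    have "norm x * norm y \<le> (X * e w) * (X' * e w)"
      using that by (intro mult_mono) (auto intro: order_trans[OF norm_ge_zero])
    thus ?thesis by (simp add: norm_mult mult_ac)
  qed
  have bd: "norm (csum Y (wt F) w) \<le> D1 * e w" "norm (csum Y (wt G) w) \<le> D2 * e w"
    "norm (csum Y (\<lambda>n. coef F n * b n) w) \<le> D3 * e w" "norm (csum Y (\<lambda>n. coef G n * b n) w) \<le> D4 * e w"
    "norm (Y w) \<le> C * e w" for w
    unfolding e_def by (rule D1(2) D2(2) D3(2) D4(2) YC)+
  have MN: "0 \<le> C * D1" "0 \<le> D1 * D4" "0 \<le> D2 * D3" using C D1 D2 D3 D4 by auto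
  have "\<exists>C'. \<forall>z. norm (f z) \<le> C' * exp (3 * 4 powr \<sigma> * (2 * l) * norm z powr \<sigma>)"
  proof (rule quotient_entire_growth[OF f p z0 \<sigma>])
    show "0 \<le> 2 * l" using l by simp
    fix z
    have "norm (p z) \<le> (C * D1) * (e z * e z)" unfolding p_def by (rule mm[OF bd(5) bd(1)])
    also have "\<dots> \<le> M * (e z * e z)" using MN e0 by (intro mult_right_mono) (auto simp: M_def)
    finally show "norm (p z) \<le> M * exp (2 * l * norm z powr \<sigma>)" by (simp only: e2)
    have "norm (f z * p z) = norm (csum Y (wt F) z * csum Y (\<lambda>n. coef G n * b n) z - csum Y (wt G) z * csum Y (\<lambda>n. coef F n * b n) z)"
      unfolding p_def by (simp only: comparison_quotient[OF Y(1,2) F(1) G b f eq a])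
    also have "\<dots> \<le> (D1 * D4) * (e z * e z) + (D2 * D3) * (e z * e z)"
      by (intro order_trans[OF norm_triangle_ineq4] add_mono mm bd)
    also have "\<dots> = (D1 * D4 + D2 * D3) * (e z * e z)" by (simp only: distrib_right)
    also have "\<dots> \<le> M * (e z * e z)" using MN e0 by (intro mult_right_mono) (auto simp: M_def)
    finally show "norm (f z * p z) \<le> M * exp (2 * l * norm z powr \<sigma>)" by (simp only: e2)
  qed
  moreover have "3 * 4 powr \<sigma> * (2 * l) = 6 * 4 powr \<sigma> * (2 powr \<sigma> * \<kappa> + \<epsilon>)" by (simp add: l_def)
  ultimately show ?thesis by (simp only:)
qed

text \<open>The multiplier is the function supplied by \<open>condZ\<close>; as its type is
  arbitrarily small, the fixed factor lost in \<open>comparison_growth\<close> does no harm.\<close>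

lemma comparison_zero_type_condZ:
  assumes Z: "condZ t"
    and F: "F \<in> cdb_space t A \<mu>" "F x0 \<noteq> 0" and G: "G \<in> cdb_space t A \<mu>" and b: "l2seq b" and f: "f holomorphic_on UNIV"
    and eq: "\<And>w. f w * F w * A w = F w * pairing G b w - G w * pairing F b w"
  shows "zero_exp_type f"
  unfolding zero_exp_type_def
proof (intro allI impI)
  fix \<epsilon> :: real assume \<epsilon>: "\<epsilon> > 0"
  obtain Y where Y: "Y holomorphic_on UNIV" "{z. Y z = 0} = range t" "\<And>\<epsilon>. \<epsilon> > 0 \<Longrightarrow> \<exists>C. \<forall>z. norm (Y z) \<le> C * exp (\<epsilon> * norm z)"
    using Z by (auto simp: condZ_def)
  obtain a where "A a \<noteq> 0" by (rule exists_off_node)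
  hence a: "Y a \<noteq> 0" using A_zero Y(2) by blast
  have Yt: "Y (t n) = 0" for n using Y(2) by blast
  \<comment> \<open>For \<open>\<sigma> = 1\<close> and \<open>\<kappa> = \<epsilon> = k\<close> the
    type in \<open>comparison_growth\<close> is \<open>6 * 4 * 3 * k = 72 k\<close>.\<close>
  define k where "k = \<epsilon> / 72"
  have k: "k > 0" using \<epsilon> by (simp add: k_def)
  obtain C where C: "\<And>z. norm (Y z) \<le> C * exp (k * norm z)" using Y(3)[OF k] by blast
  have "\<exists>C'. \<forall>z. norm (f z) \<le> C' * exp (6 * 4 powr 1 * (2 powr 1 * k + k) * norm z powr 1)"
    by (rule comparison_growth[OF Y(1) Yt a F G b f eq]) (use k C in \<open>auto simp: less_imp_le\<close>)
  moreover have "6 * 4 powr 1 * (2 powr 1 * k + k) = \<epsilon>" by (simp add: k_def)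
  ultimately show "\<exists>C. \<forall>z. norm (f z) \<le> C * exp (\<epsilon> * norm z)" by simp
qed

end

section \<open>Nodes in an angle\<close>

lemma cos_le_cos_of_mem:
  assumes "0 \<le> \<delta>" "\<delta> \<le> x" "x \<le> 2 * pi - \<delta>"
  shows "cos x \<le> cos \<delta>"
proof (cases "x \<le> pi")
  case True thus ?thesis using assms by (intro cos_monotone_0_pi_le) auto
next
  case False
  have "cos x = cos (2 * pi - x)" by (simp add: cos_diff)
  also have "\<dots> \<le> cos \<delta>" using assms False by (intro cos_monotone_0_pi_le) auto
  finally show ?thesis .
qed

lemma Re_eq_norm_cos_Arg: "Re z = norm z * cos (Arg z)"
proof (cases "z = 0")
  case False
  have "z = of_real (norm z) * exp (\<i> * of_real (Arg z))" by (rule Arg_eq[OF False])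
  hence "Re z = Re (of_real (norm z) * exp (\<i> * of_real (Arg z)))" by simp
  also have "\<dots> = norm z * cos (Arg z)" by (simp add: Re_exp)
  finally show ?thesis .
qed simp

lemma abs_Arg_le_iff:
  assumes "z \<noteq> 0" "0 \<le> \<alpha>" "\<alpha> \<le> pi"
  shows "\<bar>Arg z\<bar> \<le> \<alpha> \<longleftrightarrow> norm z * cos \<alpha> \<le> Re z"
proof -
  have "norm z * cos \<alpha> \<le> Re z \<longleftrightarrow> cos \<alpha> \<le> cos \<bar>Arg z\<bar>"
    using assms(1) by (simp add: Re_eq_norm_cos_Arg[of z])
  also have "\<dots> \<longleftrightarrow> \<bar>Arg z\<bar> \<le> \<alpha>"
    using assms mpi_less_Arg[of z] Arg_le_pi[of z] by (intro cos_mono_le_eq) auto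
  finally show ?thesis by simp
qed

text \<open>Multiply \<open>g\<close> by the exponential of
  \<open>- (\<epsilon> / cos \<alpha>) v - \<eta> v^\<sigma>\<close>. On the edges
  \<open>Re v = norm v * cos \<alpha>\<close>, so the linear term cancels
  \<open>\<epsilon> norm v\<close> exactly; the power tames the far arc, and at the end
  \<open>\<eta>\<close> tends to 0.\<close>

lemma phragmen_lindelof_sector:
  fixes g :: "complex \<Rightarrow> complex"
  assumes g: "g holomorphic_on UNIV" and \<alpha>: "0 < \<alpha>" "\<alpha> < pi / 2" and \<tau>: "\<tau> > 0" "\<tau> * \<alpha> < pi / 2"
    and gr: "\<And>v. norm (g v) \<le> C * exp (K * norm v powr \<tau>)"
    and edge: "\<And>v. Re v = norm v * cos \<alpha> \<Longrightarrow> norm (g v) \<le> D * exp (\<epsilon> * norm v)" and \<epsilon>: "\<epsilon> > 0"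
  obtains M where "\<And>v. Re v \<ge> norm v * cos \<alpha> \<Longrightarrow> norm (g v) \<le> M * exp (\<epsilon> / cos \<alpha> * norm v)"
proof -
  have ca: "cos \<alpha> > 0" using \<alpha> by (intro cos_gt_zero) auto
  obtain B where B: "B > 0" "\<And>z. norm z \<le> 1 \<Longrightarrow> norm (g z) \<le> B" using entire_bounded_cball[OF g, of 1] by metis
  define M where "M = max 1 (max B \<bar>D\<bar>)"
  \<comment> \<open>The midpoint exceeds the growth exponent \<open>\<tau>\<close>, while
    \<open>cos (\<sigma> Arg v)\<close> keeps a positive lower bound in the sector.\<close>
  define \<sigma> where "\<sigma> = (\<tau> + pi / (2 * \<alpha>)) / 2"
  have "\<tau> < \<sigma>" "\<sigma> * \<alpha> < pi / 2" using \<alpha> \<tau> by (auto simp: \<sigma>_def field_simps)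
  hence \<sigma>: "\<tau> < \<sigma>" "\<sigma> * \<alpha> < pi / 2" "\<sigma> > 0" using \<tau>(1) by linarith+
  define c0 where "c0 = cos (\<sigma> * \<alpha>)"
  have c0: "c0 > 0" unfolding c0_def using \<sigma> \<alpha> by (intro cos_gt_zero) auto
  define pw where "pw = (\<lambda>v :: complex. exp (of_real \<sigma> * Ln v))"
  have pw: "Re (pw v) \<ge> norm v powr \<sigma> * c0" if "Re v \<ge> norm v * cos \<alpha>" "v \<noteq> 0" for v
  proof -
    have "\<bar>Arg v\<bar> \<le> \<alpha>" using that abs_Arg_le_iff[of v \<alpha>] \<alpha> by auto
    hence "\<bar>\<sigma> * Arg v\<bar> \<le> \<sigma> * \<alpha>" using \<sigma> by (simp add: abs_mult)
    hence "cos (\<sigma> * \<alpha>) \<le> cos \<bar>\<sigma> * Arg v\<bar>" using \<sigma> \<alpha> by (intro cos_monotone_0_pi_le) auto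
    moreover have "Re (pw v) = norm v powr \<sigma> * cos (\<sigma> * Arg v)"
      using that(2) by (simp add: pw_def Re_exp Arg_eq_Im_Ln powr_def)
    ultimately show ?thesis by (simp add: c0_def mult_left_mono)
  qed
  have main: "norm (g v) * exp (- (\<epsilon> / cos \<alpha> * Re v) - \<eta> * Re (pw v)) \<le> M"
    if \<eta>: "\<eta> > 0" and v: "Re v \<ge> norm v * cos \<alpha>" "norm v > 1" for v \<eta>
  proof (cases "Re v = norm v * cos \<alpha>")
    case True
    have "norm (g v) * exp (- (\<epsilon> / cos \<alpha> * Re v) - \<eta> * Re (pw v)) \<le> (\<bar>D\<bar> * exp (\<epsilon> * norm v)) * exp (- (\<epsilon> * norm v))"
    proof (intro mult_mono)
      show "norm (g v) \<le> \<bar>D\<bar> * exp (\<epsilon> * norm v)"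
        by (rule order_trans[OF edge[OF True]]) (intro mult_right_mono, auto)
      have "0 \<le> norm v powr \<sigma> * c0" using c0 by simp
      hence "0 \<le> Re (pw v)" using pw[OF v(1)] v(2) by force
      hence "0 \<le> \<eta> * Re (pw v)" using \<eta> by simp
      moreover have "\<epsilon> / cos \<alpha> * Re v = \<epsilon> * norm v" using True ca by simp
      ultimately show "exp (- (\<epsilon> / cos \<alpha> * Re v) - \<eta> * Re (pw v)) \<le> exp (- (\<epsilon> * norm v))" by simp
    qed auto
    also have "\<dots> = \<bar>D\<bar>" by (simp add: exp_minus)
    finally show ?thesis by (simp add: M_def)
  next
    case False
    \<comment> \<open>As \<open>\<sigma> > \<tau>\<close>, on an arc far enough out the decay of the
      power term beats the growth assumed for \<open>g\<close>.\<close>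
    obtain R where R: "\<bar>C\<bar> * exp (K * R powr \<tau> - \<eta> * c0 * R powr \<sigma>) < 1" "R > norm v"
    proof -
      have a0: "\<eta> * c0 > 0" using \<eta> c0 by simp
      have t0: "((\<lambda>r :: real. r powr p) \<longlongrightarrow> 0) at_top" if "p < 0" for p
        by (rule tendsto_neg_powr[OF that filterlim_ident])
      have "eventually (\<lambda>r :: real. r powr (\<tau> - \<sigma>) < \<eta> * c0 / (\<bar>K\<bar> + 1)) at_top"
        using order_tendstoD(2)[OF t0[of "\<tau> - \<sigma>"]] \<sigma> a0 by simp
      moreover have "eventually (\<lambda>r :: real. r powr (- \<tau>) < 1 / (\<bar>C\<bar> + 1)) at_top"
        using order_tendstoD(2)[OF t0[of "- \<tau>"]] \<tau> by simp
      moreover have "eventually (\<lambda>r. r > norm v) at_top" by (rule eventually_gt_at_top)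
      ultimately have "eventually (\<lambda>r. r powr (\<tau> - \<sigma>) < \<eta> * c0 / (\<bar>K\<bar> + 1) \<and> r powr (- \<tau>) < 1 / (\<bar>C\<bar> + 1) \<and> r > norm v) at_top"
        by (intro eventually_conj)
      then obtain R where R: "R powr (\<tau> - \<sigma>) < \<eta> * c0 / (\<bar>K\<bar> + 1)" "R powr (- \<tau>) < 1 / (\<bar>C\<bar> + 1)" "R > norm v"
        unfolding eventually_at_top_linorder by blast
      have R0: "R > 0" using R(3) v(2) by linarith
      have "R powr \<tau> / R powr \<sigma> < \<eta> * c0 / (\<bar>K\<bar> + 1)" using R(1) by (simp add: powr_diff)
      hence "R powr \<tau> < \<eta> * c0 / (\<bar>K\<bar> + 1) * R powr \<sigma>" using R0 by (subst (asm) pos_divide_less_eq) auto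
      hence "R powr \<tau> < (\<eta> * c0 * R powr \<sigma>) / (\<bar>K\<bar> + 1)" by simp
      hence "R powr \<tau> * (\<bar>K\<bar> + 1) < \<eta> * c0 * R powr \<sigma>" by (subst (asm) pos_less_divide_eq) auto
      moreover have "K * R powr \<tau> \<le> \<bar>K\<bar> * R powr \<tau>" by (intro mult_right_mono) auto
      ultimately have 1: "K * R powr \<tau> - \<eta> * c0 * R powr \<sigma> < - (R powr \<tau>)" by (simp add: distrib_left mult.commute)
      have "inverse (R powr \<tau>) < inverse (\<bar>C\<bar> + 1)" using R(2) by (simp add: powr_minus inverse_eq_divide)
      hence "\<bar>C\<bar> + 1 < R powr \<tau>" by (rule inverse_less_imp_less) (use R0 in simp)
      hence "exp (K * R powr \<tau> - \<eta> * c0 * R powr \<sigma>) \<le> exp (- \<bar>C\<bar>)" using 1 by simp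
      hence "\<bar>C\<bar> * exp (K * R powr \<tau> - \<eta> * c0 * R powr \<sigma>) \<le> \<bar>C\<bar> * exp (- \<bar>C\<bar>)" by (intro mult_left_mono) auto
      also have "\<dots> < exp \<bar>C\<bar> * exp (- \<bar>C\<bar>)"
        using exp_ge_add_one_self[of "\<bar>C\<bar>"] by (intro mult_strict_right_mono) (linarith, simp)
      also have "\<dots> = 1" by (simp add: exp_minus)
      finally show ?thesis using that R(3) by blast
    qed
    define S where "S = {z. 1 < norm z \<and> norm z < R \<and> norm z * cos \<alpha> < Re z}"
    define T where "T = {z. 1 \<le> norm z \<and> norm z \<le> R \<and> norm z * cos \<alpha> \<le> Re z}"
    have oS: "open S" unfolding S_def by (intro open_Collect_conj open_Collect_less continuous_intros)
    have cT: "closed T" unfolding T_def by (intro closed_Collect_conj closed_Collect_le continuous_intros)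
    have ST: "closure S \<subseteq> T" using cT by (intro closure_minimal) (auto simp: S_def T_def)
    have T0: "Re z > 0" if "z \<in> T" for z
    proof -
      have "0 < norm z * cos \<alpha>" using that ca by (intro mult_pos_pos) (auto simp: T_def intro: less_le_trans[of 0 1])
      thus ?thesis using that by (simp add: T_def)
    qed
    have TR: "z \<notin> \<real>\<^sub>\<le>\<^sub>0" if "z \<in> T" for z using T0[OF that] by (auto simp: complex_nonpos_Reals_iff)
    define h where "h = (\<lambda>v. g v * exp (- of_real (\<epsilon> / cos \<alpha>) * v - of_real \<eta> * pw v))"
    have nh: "norm (h z) = norm (g z) * exp (- (\<epsilon> / cos \<alpha> * Re z) - \<eta> * Re (pw z))" for z
      by (simp add: h_def norm_mult)
    have hol: "h holomorphic_on (- \<real>\<^sub>\<le>\<^sub>0)" unfolding h_def pw_def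
      by (intro holomorphic_intros holomorphic_on_subset[OF g]) auto
    have "norm (h v) \<le> M"
    proof (rule maximum_modulus_frontier[of h S])
      show "h holomorphic_on interior S"
        using hol TR ST closure_subset interior_subset by (blast intro: holomorphic_on_subset)
      show "continuous_on (closure S) h"
        using hol TR ST by (intro holomorphic_on_imp_continuous_on[OF holomorphic_on_subset[OF hol]]) blast
      show "bounded S" by (rule bounded_subset[OF bounded_ball[of 0 R]]) (auto simp: S_def)
      show "v \<in> S" using v False R(2) by (auto simp: S_def)
      fix z assume "z \<in> frontier S"
      hence z: "z \<in> T" "z \<notin> S" using ST oS by (auto simp: frontier_def interior_open)
      have zc: "Re z \<ge> norm z * cos \<alpha>" "norm z \<ge> 1" "norm z \<le> R" "z \<noteq> 0" using z(1) by (auto simp: T_def)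
      have "0 \<le> norm z powr \<sigma> * c0" using c0 by simp
      hence pw0: "0 \<le> \<eta> * Re (pw z)" using pw[OF zc(1,4)] \<eta> by (intro mult_nonneg_nonneg) linarith+
      have e0: "0 \<le> \<epsilon> / cos \<alpha> * Re z" using \<epsilon> ca T0[OF z(1)] by simp
      consider "norm z = 1" | "norm z = R" | "Re z = norm z * cos \<alpha>" using z by (force simp: S_def T_def)
      thus "norm (h z) \<le> M"
      proof cases
        case 1
        have "norm (h z) \<le> B * 1" unfolding nh using B 1 pw0 e0 by (intro mult_mono) auto
        thus ?thesis by (simp add: M_def)
      next
        case 2
        have "norm (h z) \<le> (\<bar>C\<bar> * exp (K * R powr \<tau>)) * exp (- (\<eta> * c0 * R powr \<sigma>))"
          unfolding nh
        proof (intro mult_mono)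
          show "norm (g z) \<le> \<bar>C\<bar> * exp (K * R powr \<tau>)"
            using order_trans[OF gr[of z] mult_right_mono[OF abs_ge_self]] 2 by simp
          have "\<eta> * (R powr \<sigma> * c0) \<le> \<eta> * Re (pw z)" using pw[OF zc(1,4)] \<eta> 2 by (intro mult_left_mono) auto
          thus "exp (- (\<epsilon> / cos \<alpha> * Re z) - \<eta> * Re (pw z)) \<le> exp (- (\<eta> * c0 * R powr \<sigma>))"
            using e0 by (simp add: mult_ac)
        qed auto
        also have "\<dots> = \<bar>C\<bar> * exp (K * R powr \<tau> - \<eta> * c0 * R powr \<sigma>)" by (simp add: exp_diff exp_minus field_simps)
        finally show ?thesis using R(1) by (simp add: M_def)
      next
        case 3
        have "norm (h z) \<le> (\<bar>D\<bar> * exp (\<epsilon> * norm z)) * exp (- (\<epsilon> * norm z))"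
          unfolding nh
        proof (intro mult_mono)
          show "norm (g z) \<le> \<bar>D\<bar> * exp (\<epsilon> * norm z)"
            by (rule order_trans[OF edge[OF 3]]) (intro mult_right_mono, auto)
          have "\<epsilon> / cos \<alpha> * Re z = \<epsilon> * norm z" using 3 ca by simp
          thus "exp (- (\<epsilon> / cos \<alpha> * Re z) - \<eta> * Re (pw z)) \<le> exp (- (\<epsilon> * norm z))" using pw0 by simp
        qed auto
        also have "\<dots> = \<bar>D\<bar>" by (simp add: exp_minus)
        finally show ?thesis by (simp add: M_def)
      qed
    qed
    thus ?thesis by (simp add: nh)
  qed
  have "norm (g v) \<le> M * exp (\<epsilon> / cos \<alpha> * norm v)" if v: "Re v \<ge> norm v * cos \<alpha>" for v
  proof (cases "norm v > 1")
    case False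
    have "norm (g v) \<le> B * 1" using B(2)[of v] False by simp
    also have "\<dots> \<le> M * exp (\<epsilon> / cos \<alpha> * norm v)" using \<epsilon> ca B by (intro mult_mono) (auto simp: M_def)
    finally show ?thesis .
  next
    case True
    have "((\<lambda>\<eta>. norm (g v) * exp (- (\<epsilon> / cos \<alpha> * Re v) - \<eta> * Re (pw v))) \<longlongrightarrow> norm (g v) * exp (- (\<epsilon> / cos \<alpha> * Re v) - 0 * Re (pw v))) (at_right 0)"
      by (intro tendsto_intros)
    moreover have "eventually (\<lambda>\<eta>. norm (g v) * exp (- (\<epsilon> / cos \<alpha> * Re v) - \<eta> * Re (pw v)) \<le> M) (at_right 0)"
      using main[OF _ v True] by (auto simp: eventually_at_right_field intro!: exI[of _ 1])
    ultimately have "norm (g v) * exp (- (\<epsilon> / cos \<alpha> * Re v) - 0 * Re (pw v)) \<le> M"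
      by (rule tendsto_upperbound) simp
    hence "norm (g v) \<le> M * exp (\<epsilon> / cos \<alpha> * Re v)" by (simp add: exp_minus field_simps)
    also have "\<dots> \<le> M * exp (\<epsilon> / cos \<alpha> * norm v)"
      using \<epsilon> ca complex_Re_le_cmod[of v]
      by (intro mult_left_mono iffD2[OF exp_le_cancel_iff]) (auto simp: M_def)
    finally show ?thesis .
  qed
  thus ?thesis using that by blast
qed

text \<open>The map \<open>\<zeta> \<mapsto> -\<zeta>\<^sup>\<kappa>\<close> takes the right half-plane onto the complement of the angle \<open>|arg z| \<le> \<alpha>1\<close>; there
  \<open>\<kappa> > 1\<close>, which turns exponential growth in \<open>\<zeta>\<close> into order less than one in \<open>z\<close>.\<close>

lemma quotient_sector_growth:
  fixes f P :: "complex \<Rightarrow> complex"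
  assumes \<alpha>: "0 < \<alpha>1" "\<alpha>1 < \<alpha>2" "\<alpha>2 < pi / 2"
    and f: "f holomorphic_on {z. Re z < norm z * cos \<alpha>1}" and P: "P holomorphic_on {z. Re z < norm z * cos \<alpha>1}"
    and Pb: "\<And>z. Re z < norm z * cos \<alpha>1 \<Longrightarrow> norm (P z) \<le> M" and fPb: "\<And>z. Re z < norm z * cos \<alpha>1 \<Longrightarrow> norm (f z * P z) \<le> M"
    and x: "x > 0" "P (- of_real x) \<noteq> 0"
  obtains C l where "C \<ge> 0" "0 < l" "l < 1" "\<And>z. norm z \<ge> x \<Longrightarrow> Re z \<le> norm z * cos \<alpha>2 \<Longrightarrow> norm (f z) \<le> exp (C * norm z powr l)"
proof -
  \<comment> \<open>Determined by \<open>\<kappa> * pi / 2 = pi - \<alpha>1\<close>, half the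
    opening of the domain.\<close>
  define \<kappa> where "\<kappa> = 2 * (pi - \<alpha>1) / pi"
  have \<kappa>: "\<kappa> > 1" using \<alpha> by (simp add: \<kappa>_def field_simps)
  define \<phi> where "\<phi> = (\<lambda>z :: complex. - exp (of_real \<kappa> * Ln z))"
  have Re\<phi>: "Re (\<phi> z) < norm (\<phi> z) * cos \<alpha>1" if z: "Re z > 0" for z
  proof -
    have z0: "z \<noteq> 0" using z by auto
    have "\<bar>Im (Ln z)\<bar> < pi / 2" using Re_Ln_pos_lt[OF z0] z by simp
    hence "\<kappa> * \<bar>Im (Ln z)\<bar> < \<kappa> * (pi / 2)" using \<kappa> by (intro mult_strict_left_mono) auto
    moreover have "\<kappa> * (pi / 2) = pi - \<alpha>1" by (simp add: \<kappa>_def)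
    moreover have "\<bar>\<kappa> * Im (Ln z)\<bar> = \<kappa> * \<bar>Im (Ln z)\<bar>" using \<kappa> by (simp add: abs_mult)
    ultimately have "\<bar>\<kappa> * Im (Ln z)\<bar> < pi - \<alpha>1" by linarith
    hence "cos (pi - \<alpha>1) < cos \<bar>\<kappa> * Im (Ln z)\<bar>" using \<alpha> by (intro cos_monotone_0_pi) auto
    hence "- cos (\<kappa> * Im (Ln z)) < cos \<alpha>1" by simp
    from mult_strict_left_mono[OF this exp_gt_zero[of "\<kappa> * Re (Ln z)"]] show ?thesis by (simp add: \<phi>_def Re_exp)
  qed
  have hol\<phi>: "\<phi> holomorphic_on {z. Re z > 0}"
    unfolding \<phi>_def by (intro holomorphic_intros) (auto simp: complex_nonpos_Reals_iff)
  have hol: "(\<lambda>z. h (\<phi> z)) holomorphic_on {z. Re z > 0}" if "h holomorphic_on {z. Re z < norm z * cos \<alpha>1}" for h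
    using holomorphic_on_compose_gen[OF hol\<phi> that] Re\<phi> by (simp add: o_def image_subset_iff)
  define x0 where "x0 = x powr (1 / \<kappa>)"
  have x0: "x0 > 0" using x by (simp add: x0_def)
  have \<phi>x0: "\<phi> (of_real x0) = - of_real x"
  proof -
    have "Ln (of_real x0 :: complex) = of_real (ln x0)" using x0 by (rule Ln_of_real)
    also have "ln x0 = ln x / \<kappa>" using x by (simp add: x0_def ln_powr)
    finally have "of_real \<kappa> * Ln (of_real x0 :: complex) = of_real (ln x)" using \<kappa> by (simp add: of_real_divide)
    thus ?thesis using x by (simp add: \<phi>_def exp_of_real)
  qed
  \<comment> \<open>Points with \<open>Re z \<le> norm z * cos \<alpha>2\<close> pull back to
    arguments of modulus at most \<open>(pi - \<alpha>2) / \<kappa>\<close>, which is below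
    \<open>pi / 2\<close>: a proper subsector, as \<open>quotient_half_plane_growth\<close>
    demands.\<close>
  define \<delta> where "\<delta> = cos ((pi - \<alpha>2) / \<kappa>)"
  have ang: "(pi - \<alpha>2) / \<kappa> < pi / 2" "0 < (pi - \<alpha>2) / \<kappa>" using \<alpha> \<kappa> by (auto simp: \<kappa>_def field_simps)
  have \<delta>: "\<delta> > 0" unfolding \<delta>_def using ang by (intro cos_gt_zero)
  obtain C where C: "C \<ge> 0" "\<And>z. norm z \<ge> x0 \<Longrightarrow> Re z \<ge> \<delta> * norm z \<Longrightarrow> norm (f (\<phi> z)) \<le> exp (C * norm z)"
    using quotient_half_plane_growth[OF hol[OF f] hol[OF P] x0 _ _ _ \<delta>, of M] x \<phi>x0 Pb fPb Re\<phi> by auto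
  have "norm (f z) \<le> exp (C * norm z powr (1 / \<kappa>))" if z: "norm z \<ge> x" "Re z \<le> norm z * cos \<alpha>2" for z
  proof -
    define s where "s = - z"
    have s0: "s \<noteq> 0" using z x by (auto simp: s_def)
    have "\<bar>Arg s\<bar> \<le> pi - \<alpha>2" using abs_Arg_le_iff[OF s0, of "pi - \<alpha>2"] z(2) \<alpha> by (simp add: s_def)
    hence as: "\<bar>Im (Ln s)\<bar> \<le> pi - \<alpha>2" using s0 by (simp add: Arg_eq_Im_Ln)
    define w where "w = exp (Ln s / of_real \<kappa>)"
    have aw: "\<bar>Im (Ln s) / \<kappa>\<bar> \<le> (pi - \<alpha>2) / \<kappa>" using as \<kappa> by (simp add: divide_right_mono)
    have Lnw: "Ln w = Ln s / of_real \<kappa>"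
    proof -
      have "- pi < Im (Ln s) / \<kappa>" "Im (Ln s) / \<kappa> \<le> pi" using aw ang by linarith+
      thus ?thesis unfolding w_def by (intro Ln_exp) simp_all
    qed
    have "\<phi> w = z" using \<kappa> s0 by (simp add: \<phi>_def Lnw s_def)
    have nw: "norm w = norm z powr (1 / \<kappa>)"
    proof -
      have "norm w = exp (ln (norm s) / \<kappa>)" using s0 by (simp add: w_def)
      thus ?thesis using s0 by (simp add: powr_def s_def)
    qed
    have "x0 \<le> norm w" unfolding nw x0_def using z x \<kappa> by (intro powr_mono2) auto
    moreover have "\<delta> * norm w \<le> Re w"
    proof -
      have "(pi - \<alpha>2) / \<kappa> \<le> pi" using ang by linarith
      from cos_monotone_0_pi_le[OF abs_ge_zero aw this] have "\<delta> \<le> cos (Im (Ln s) / \<kappa>)"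
        unfolding \<delta>_def cos_abs_real .
      from mult_left_mono[OF this norm_ge_zero[of w]] show ?thesis
        by (simp add: w_def Re_exp mult.commute)
    qed
    ultimately show ?thesis using C(2)[of w] by (simp add: \<open>\<phi> w = z\<close> nw)
  qed
  thus ?thesis using that[of C "1 / \<kappa>"] C(1) \<kappa> by simp
qed

lemma powr_sublinear:
  fixes C l \<epsilon> :: real
  assumes "C \<ge> 0" "0 < l" "l < 1" "\<epsilon> > 0"
  obtains D where "\<And>x. x \<ge> 0 \<Longrightarrow> C * x powr l \<le> \<epsilon> * x + D"
proof -
  define X where "X = (C / \<epsilon>) powr (1 / (1 - l))"
  have "C * x powr l \<le> \<epsilon> * x + C * X powr l" if x: "x \<ge> 0" for x
  proof (cases "x \<le> X")
    case True
    have "C * x powr l \<le> C * X powr l" using True x assms by (intro mult_left_mono powr_mono2) auto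
    moreover have "0 \<le> \<epsilon> * x" using x assms by simp
    ultimately show ?thesis by linarith
  next
    case False
    have X0: "X \<ge> 0" by (simp add: X_def)
    have "C / \<epsilon> = X powr (1 - l)" using assms by (simp add: X_def powr_powr)
    also have "\<dots> \<le> x powr (1 - l)" using False X0 assms by (intro powr_mono2) auto
    finally have "C \<le> \<epsilon> * x powr (1 - l)" using assms by (simp add: field_simps)
    hence "C * x powr l \<le> \<epsilon> * x powr (1 - l) * x powr l" by (intro mult_right_mono) auto
    also have "\<dots> = \<epsilon> * x" using False X0 by (simp add: mult.assoc powr_add[symmetric])
    moreover have "0 \<le> C * X powr l" using assms by simp
    ultimately show ?thesis by linarith
  qed
  thus ?thesis using that by blast
qed

lemma norm_diff_ge_of_angle:
  assumes "0 \<le> c0" "c0 < 1" "Re (z * cnj w) \<le> c0 * (norm z * norm w)"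
  shows "norm (z - w) \<ge> sqrt (1 - c0\<^sup>2) * norm w"
proof -
  have "(sqrt (1 - c0\<^sup>2) * norm w)\<^sup>2 = (1 - c0\<^sup>2) * (norm w)\<^sup>2"
    using assms by (simp add: power_mult_distrib power_le_one)
  also have "\<dots> \<le> (norm z - c0 * norm w)\<^sup>2 + (1 - c0\<^sup>2) * (norm w)\<^sup>2" by simp
  also have "\<dots> = (norm z)\<^sup>2 - 2 * (c0 * (norm z * norm w)) + (norm w)\<^sup>2" by (simp add: power2_eq_square algebra_simps)
  also have "\<dots> \<le> (norm z)\<^sup>2 - 2 * Re (z * cnj w) + (norm w)\<^sup>2" using assms(3) by simp
  also have "\<dots> = (norm (z - w))\<^sup>2" unfolding cmod_power2 by (simp add: power2_eq_square algebra_simps)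
  finally show ?thesis by (rule power2_le_imp_le) simp
qed

context cdb
begin

text \<open>After rotation by \<open>\<omega>\<close> the nodes lie in |arg z| < \<alpha>. Off the
  angle \<alpha>1 the distance to a node is at least a fixed multiple of its modulus, so
  \<open>F / A\<close>, \<open>G / A\<close> and the Cauchy transforms are bounded; \<open>f\<close>
  is then a quotient of bounded functions and has order below one off \<alpha>2. Growth of order
  \<tau> is admissible for Phragmen-Lindelof in the remaining angle.\<close>

lemma comparison_zero_type_sector:
  assumes ang: "0 < \<alpha>" "\<And>n. t n = of_real (norm (t n)) * (\<omega> * cis (\<phi> n))" "\<And>n. \<bar>\<phi> n\<bar> < \<alpha>" "norm \<omega> = 1"
    and \<tau>: "\<tau> > 0" "\<tau> * \<alpha> < pi / 2" "\<alpha> < pi / 2"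
    and F: "F \<in> cdb_space t A \<mu>" "F x0 \<noteq> 0" and G: "G \<in> cdb_space t A \<mu>" and b: "l2seq b" and f: "f holomorphic_on UNIV"
    and eq: "\<And>w. f w * F w * A w = F w * pairing G b w - G w * pairing F b w"
    and gr: "\<And>z. norm (f z) \<le> C0 * exp (K0 * norm z powr \<tau>)"
  shows "zero_exp_type f"
proof -
  \<comment> \<open>The largest half-opening allowed both by the half-plane and by order \<tau>.
    Thirds of the interval from \<alpha> to \<beta> leave room for two intermediate angles.\<close>
  define \<beta> where "\<beta> = min (pi / 2) (pi / (2 * \<tau>))"
  have \<beta>: "\<alpha> < \<beta>" "\<beta> \<le> pi / 2" "\<tau> * \<beta> \<le> pi / 2"
    using \<tau> by (auto simp: \<beta>_def min_def field_simps)
  define \<alpha>1 where "\<alpha>1 = \<alpha> + (\<beta> - \<alpha>) / 3"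
  define \<alpha>2 where "\<alpha>2 = \<alpha> + 2 * (\<beta> - \<alpha>) / 3"
  have \<alpha>12: "\<alpha> < \<alpha>1" "\<alpha>1 < \<alpha>2" "\<alpha>2 < \<beta>" "0 < \<alpha>1" "\<alpha>2 < pi / 2" "0 < \<alpha>2" "\<alpha>1 < pi / 2"
    using \<beta> ang(1) by (auto simp: \<alpha>1_def \<alpha>2_def field_simps)
  have \<tau>2: "\<tau> * \<alpha>2 < pi / 2" using mult_strict_left_mono[OF \<alpha>12(3) \<tau>(1)] \<beta>(3) by linarith
  define c0 where "c0 = cos (\<alpha>1 - \<alpha>)"
  have c0: "0 \<le> c0" "c0 < 1"
  proof -
    show "0 \<le> c0" unfolding c0_def using \<alpha>12 ang(1) by (intro cos_ge_zero) auto
    have "cos (\<alpha>1 - \<alpha>) < cos 0" using \<alpha>12 ang(1) by (intro cos_monotone_0_pi) auto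
    thus "c0 < 1" by (simp add: c0_def)
  qed
  define c where "c = sqrt (1 - c0\<^sup>2)"
  have c: "c > 0" using c0 by (simp add: c_def power_less_one_iff abs_square_less_1)
  have \<omega>0: "\<omega> \<noteq> 0" using ang(4) by auto
  have far: "norm (\<omega> * z - t n) \<ge> c * norm (t n)" if z: "Re z < norm z * cos \<alpha>1" for z n
  proof -
    have z0: "z \<noteq> 0" using z by auto
    define r where "r = norm (t n)"
    have "\<not> \<bar>Arg z\<bar> \<le> \<alpha>1" using abs_Arg_le_iff[OF z0, of \<alpha>1] z \<alpha>12 by auto
    hence az: "\<bar>Arg z\<bar> > \<alpha>1" "\<bar>Arg z\<bar> \<le> pi" using mpi_less_Arg[of z] Arg_le_pi[of z] by auto
    have "cos \<bar>Arg z - \<phi> n\<bar> \<le> c0"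
      unfolding c0_def using az ang(3)[of n] \<alpha>12 ang(1) by (intro cos_le_cos_of_mem) linarith+
    hence cle: "cos (Arg z - \<phi> n) \<le> c0" by simp
    have zeq: "z = of_real (norm z) * cis (Arg z)" using Arg_eq[OF z0] by (simp add: cis_conv_exp)
    have "Re (z * cnj (of_real r * cis (\<phi> n))) = r * norm z * cos (Arg z - \<phi> n)"
    proof -
      have "z * cnj (of_real r * cis (\<phi> n)) = of_real (norm z) * cis (Arg z) * (of_real r * cis (- \<phi> n))"
        using zeq by (simp add: cis_cnj)
      also have "\<dots> = of_real (r * norm z) * cis (Arg z - \<phi> n)" by (simp add: cis_mult[of "Arg z" "- \<phi> n", simplified, symmetric] mult_ac)
      finally have E: "z * cnj (of_real r * cis (\<phi> n)) = of_real (r * norm z) * cis (Arg z - \<phi> n)" .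
      show ?thesis unfolding E by simp
    qed
    also have "\<dots> \<le> r * norm z * c0" using cle by (intro mult_left_mono) (auto simp: r_def)
    finally have "Re (z * cnj (of_real r * cis (\<phi> n))) \<le> c0 * (norm z * norm (of_real r * cis (\<phi> n)))"
      by (simp add: norm_mult r_def mult_ac)
    from norm_diff_ge_of_angle[OF c0 this] have "c * norm (t n) \<le> norm (z - of_real r * cis (\<phi> n))"
      by (simp add: c_def norm_mult r_def)
    also have "\<dots> = norm (\<omega> * (z - of_real r * cis (\<phi> n)))" using ang(4) by (simp add: norm_mult)
    also have "\<omega> * (z - of_real r * cis (\<phi> n)) = \<omega> * z - t n"
      using ang(2)[of n] by (simp add: r_def algebra_simps)
    finally show ?thesis .
  qed
  have off: "\<omega> * z \<notin> range t" "A (\<omega> * z) \<noteq> 0" if z: "Re z < norm z * cos \<alpha>1" for z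
  proof -
    show "\<omega> * z \<notin> range t"
    proof
      assume "\<omega> * z \<in> range t"
      then obtain n where n: "\<omega> * z = t n" by auto
      from far[OF z, of n] n have "c * norm (t n) \<le> 0" by simp
      thus False using c t_nonzero[of n] by (simp add: mult_le_0_iff)
    qed
    thus "A (\<omega> * z) \<noteq> 0" using A_zero by simp
  qed
  have ratio: "norm (csum A u (\<omega> * z) / A (\<omega> * z)) \<le> (\<Sum>n. norm (u n) / norm (t n)) / c"
    if z: "Re z < norm z * cos \<alpha>1" and u: "summable (\<lambda>n. norm (u n) / norm (t n))" for u z
  proof -
    have le: "norm (u n / (\<omega> * z - t n)) \<le> norm (u n) / norm (t n) / c" for n
    proof -
      have "norm (u n) / norm (\<omega> * z - t n) \<le> norm (u n) / (c * norm (t n))"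
        using far[OF z, of n] c t_nonzero[of n] by (intro frac_le) auto
      thus ?thesis by (simp add: norm_divide mult.commute)
    qed
    have s: "summable (\<lambda>n. norm (u n / (\<omega> * z - t n)))"
      by (rule summable_comparison_test'[OF summable_divide[OF u, of c]]) (use le in auto)
    have "csum A u (\<omega> * z) / A (\<omega> * z) = (\<Sum>n. u n / (\<omega> * z - t n))"
      using csum_off_nodes[OF A_entire A_node off(1)[OF z] u] off(2)[OF z] by simp
    also have "norm \<dots> \<le> (\<Sum>n. norm (u n / (\<omega> * z - t n)))" by (rule summable_norm[OF s])
    also have "\<dots> \<le> (\<Sum>n. norm (u n) / norm (t n) / c)" by (rule suminf_le[OF le s summable_divide[OF u]])
    also have "\<dots> = (\<Sum>n. norm (u n) / norm (t n)) / c" by (rule suminf_divide[OF u])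
    finally show ?thesis .
  qed
  note su = weight_summable[OF space_l2[OF F(1)]] weight_summable[OF space_l2[OF G]]
    l1_summable[OF pairing_summable[OF F(1) b]] l1_summable[OF pairing_summable[OF G b]]
  define S where "S u = (\<Sum>n. norm (u n) / norm (t n)) / c" for u :: "nat \<Rightarrow> complex"
  have S0: "S u \<ge> 0" if "summable (\<lambda>n. norm (u n) / norm (t n))" for u
  proof -
    have "0 \<le> (\<Sum>n. norm (u n) / norm (t n))" by (rule suminf_nonneg[OF that]) simp
    thus ?thesis using c by (simp add: S_def)
  qed
  have rF: "norm (F (\<omega> * z) / A (\<omega> * z)) \<le> S (wt F)" and rG: "norm (G (\<omega> * z) / A (\<omega> * z)) \<le> S (wt G)"
    and rpF: "norm (pairing F b (\<omega> * z) / A (\<omega> * z)) \<le> S (\<lambda>n. coef F n * b n)"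
    and rpG: "norm (pairing G b (\<omega> * z) / A (\<omega> * z)) \<le> S (\<lambda>n. coef G n * b n)" if z: "Re z < norm z * cos \<alpha>1" for z
    using ratio[OF z su(1)] ratio[OF z su(2)] ratio[OF z su(3)] ratio[OF z su(4)] space_csum[OF F(1)] space_csum[OF G]
    unfolding S_def pairing_def by metis+
  define P where "P = (\<lambda>z. F (\<omega> * z) / A (\<omega> * z))"
  define g where "g = (\<lambda>z. f (\<omega> * z))"
  have comp: "(\<lambda>z. h (\<omega> * z)) holomorphic_on U" if "h holomorphic_on UNIV" for h U
    using holomorphic_on_compose_gen[of "\<lambda>z. \<omega> * z" U h UNIV] that by (simp add: o_def holomorphic_intros)
  have g: "g holomorphic_on U" for U unfolding g_def by (intro comp f)
  define M where "M = S (wt F) + S (wt F) * S (\<lambda>n. coef G n * b n) + S (wt G) * S (\<lambda>n. coef F n * b n)"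
  have MN: "0 \<le> S (wt F)" "0 \<le> S (wt F) * S (\<lambda>n. coef G n * b n)" "0 \<le> S (wt G) * S (\<lambda>n. coef F n * b n)"
    using S0 su by auto
  obtain x where x: "x > 0" "P (- of_real x) \<noteq> 0"
  proof -
    have "\<exists>x>0. F (\<omega> * (- of_real x)) \<noteq> 0"
    proof (rule ccontr)
      assume *: "\<not> ?thesis"
      define L where "L = (\<lambda>n. \<omega> * (- of_real (1 / real (Suc n))) :: complex)"
      have lim: "L \<longlonglongrightarrow> 0"
      proof -
        have "(\<lambda>n. complex_of_real (1 / real (Suc n))) \<longlonglongrightarrow> of_real 0"
          by (rule tendsto_of_real[OF LIMSEQ_Suc[OF lim_1_over_n]])
        hence "L \<longlonglongrightarrow> \<omega> * (- of_real 0)" unfolding L_def by (intro tendsto_mult tendsto_minus tendsto_const)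
        thus ?thesis by simp
      qed
      have L0: "L n \<noteq> 0" for n using \<omega>0 by (simp add: L_def del: of_nat_Suc)
      have isl: "0 islimpt range L"
        unfolding islimpt_sequential using lim L0 by (intro exI[of _ L]) auto
      have "F z = 0" for z
      proof (rule analytic_continuation[of F UNIV "range L" 0])
        fix z assume "z \<in> range L"
        then obtain n where "z = L n" by blast
        moreover have "1 / real (Suc n) > 0" by simp
        ultimately show "F z = 0" using * unfolding L_def by blast
      qed (use isl space_entire[OF F(1)] in auto)
      thus False using F(2) by simp
    qed
    then obtain x where x: "x > 0" "F (\<omega> * (- of_real x)) \<noteq> 0" by blast
    have "0 < x * cos \<alpha>1" using x(1) \<alpha>12 by (intro mult_pos_pos cos_gt_zero) auto
    hence "A (\<omega> * (- of_real x)) \<noteq> 0" using x(1) by (intro off(2)) simp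
    thus ?thesis using that[of x] x by (simp add: P_def)
  qed
  have Pg: "g z * P z = P z * (pairing G b (\<omega> * z) / A (\<omega> * z)) - (G (\<omega> * z) / A (\<omega> * z)) * (pairing F b (\<omega> * z) / A (\<omega> * z))"
    if z: "Re z < norm z * cos \<alpha>1" for z
  proof -
    have "g z * P z = f (\<omega> * z) * F (\<omega> * z) * A (\<omega> * z) / (A (\<omega> * z) * A (\<omega> * z))"
      using off(2)[OF z] by (simp add: g_def P_def)
    also have "\<dots> = (F (\<omega> * z) * pairing G b (\<omega> * z) - G (\<omega> * z) * pairing F b (\<omega> * z)) / (A (\<omega> * z) * A (\<omega> * z))"
      by (simp only: eq)
    finally show ?thesis using off(2)[OF z] by (simp add: P_def diff_divide_distrib)
  qed
  have hP: "P holomorphic_on {z. Re z < norm z * cos \<alpha>1}"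
    unfolding P_def by (intro holomorphic_on_divide comp space_entire F A_entire) (use off(2) in auto)
  have Pb: "norm (P z) \<le> M" if z: "Re z < norm z * cos \<alpha>1" for z
    using rF[OF z] MN unfolding P_def M_def by linarith
  have gPb: "norm (g z * P z) \<le> M" if z: "Re z < norm z * cos \<alpha>1" for z
  proof -
    have "norm (g z * P z) \<le> S (wt F) * S (\<lambda>n. coef G n * b n) + S (wt G) * S (\<lambda>n. coef F n * b n)"
      by (subst Pg[OF z], unfold P_def, rule order_trans[OF norm_triangle_ineq4], unfold norm_mult[where 'a = complex], intro add_mono mult_mono rF rG rpF rpG z)
         (use S0 su in auto)
    thus ?thesis using MN unfolding M_def by linarith
  qed
  obtain C l where Cl: "C \<ge> 0" "0 < l" "l < 1" "\<And>z. norm z \<ge> x \<Longrightarrow> Re z \<le> norm z * cos \<alpha>2 \<Longrightarrow> norm (g z) \<le> exp (C * norm z powr l)"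
    using quotient_sector_growth[of \<alpha>1 \<alpha>2 g P M x, OF \<alpha>12(4,2,5) g hP Pb gPb x] by metis
  have gg: "norm (g v) \<le> C0 * exp (K0 * norm v powr \<tau>)" for v
    using gr[of "\<omega> * v"] ang(4) by (simp add: g_def norm_mult)
  show ?thesis
    unfolding zero_exp_type_def
  proof (intro allI impI)
    fix \<epsilon> :: real assume \<epsilon>: "\<epsilon> > 0"
    have ca: "0 < cos \<alpha>2" using \<alpha>12 by (intro cos_gt_zero) auto
    \<comment> \<open>Compensates the division by \<open>cos \<alpha>2\<close> in
      \<open>phragmen_lindelof_sector\<close>.\<close>
    define e where "e = \<epsilon> * cos \<alpha>2"
    have e: "e > 0" "e \<le> \<epsilon>" "e / cos \<alpha>2 = \<epsilon>" using \<epsilon> ca by (auto simp: e_def mult_le_cancel_left2)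
    obtain D where D: "\<And>x. x \<ge> 0 \<Longrightarrow> C * x powr l \<le> e * x + D" using powr_sublinear[OF Cl(1-3) e(1)] by metis
    obtain B where B: "B > 0" "\<And>z. norm z \<le> x \<Longrightarrow> norm (g z) \<le> B" using entire_bounded_cball[OF g, of x] by metis
    have out: "norm (g z) \<le> (B + exp D) * exp (e * norm z)" if z: "Re z \<le> norm z * cos \<alpha>2" for z
    proof (cases "norm z \<le> x")
      case True
      have "norm (g z) \<le> B * 1" using B(2)[OF True] by simp
      also have "\<dots> \<le> (B + exp D) * exp (e * norm z)" using B(1) e(1) by (intro mult_mono) auto
      finally show ?thesis .
    next
      case False
      have "norm (g z) \<le> exp (C * norm z powr l)" using Cl(4)[OF _ z] False by simp
      also have "\<dots> \<le> exp (e * norm z + D)" using D[of "norm z"] by simp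
      also have "\<dots> \<le> (B + exp D) * exp (e * norm z)" using B(1) by (simp add: exp_add algebra_simps)
      finally show ?thesis .
    qed
    obtain M1 where M1: "\<And>v. Re v \<ge> norm v * cos \<alpha>2 \<Longrightarrow> norm (g v) \<le> M1 * exp (e / cos \<alpha>2 * norm v)"
      by (rule phragmen_lindelof_sector[OF g \<alpha>12(6,5) \<tau>(1) \<tau>2 gg _ e(1), of "B + exp D"]) (use out in auto)
    have "norm (g v) \<le> (\<bar>M1\<bar> + (B + exp D)) * exp (\<epsilon> * norm v)" for v
    proof (cases "Re v \<ge> norm v * cos \<alpha>2")
      case True
      have "norm (g v) \<le> M1 * exp (\<epsilon> * norm v)" using M1[OF True] by (simp only: e(3))
      also have "\<dots> \<le> (\<bar>M1\<bar> + (B + exp D)) * exp (\<epsilon> * norm v)" using B(1) by (intro mult_right_mono) (auto intro: add_increasing2)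
      finally show ?thesis .
    next
      case False
      hence "norm (g v) \<le> (B + exp D) * exp (e * norm v)" by (intro out) auto
      also have "\<dots> \<le> (\<bar>M1\<bar> + (B + exp D)) * exp (\<epsilon> * norm v)"
        using B(1) e(2) by (intro mult_mono iffD2[OF exp_le_cancel_iff] mult_right_mono) auto
      finally show ?thesis .
    qed
    hence "norm (f z) \<le> (\<bar>M1\<bar> + (B + exp D)) * exp (\<epsilon> * norm z)" for z
      using \<omega>0 ang(4) by (metis g_def mult_1 nonzero_mult_div_cancel_left norm_mult times_divide_eq_right)
    thus "\<exists>C. \<forall>z. norm (f z) \<le> C * exp (\<epsilon> * norm z)" by blast
  qed
qed

text \<open>With \<alpha> half the opening of the given angle and \<omega> on its bisector, an
  exponent of convergence below \<open>1 / \<gamma>\<close> is the same as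
  \<open>\<tau> * \<alpha> < pi / 2\<close>. The preliminary growth bound for \<open>f\<close> uses
  \<open>A\<close> itself as multiplier.\<close>

lemma comparison_zero_type_condA:
  assumes adm: "admissible_set t" and cA: "condA \<gamma> t" and can: "canonical_product t A"
    and F: "F \<in> cdb_space t A \<mu>" "F x0 \<noteq> 0" and G: "G \<in> cdb_space t A \<mu>" and b: "l2seq b" and f: "f holomorphic_on UNIV"
    and eq: "\<And>w. f w * F w * A w = F w * pairing G b w - G w * pairing F b w"
  shows "zero_exp_type f"
proof -
  have \<gamma>: "0 < \<gamma>" "\<gamma> < 1" using cA by (auto simp: condA_def)
  obtain \<theta>0 where "\<forall>n. \<exists>\<theta>. \<theta>0 < \<theta> \<and> \<theta> < \<theta>0 + pi * \<gamma> \<and> t n = complex_of_real (norm (t n)) * cis \<theta>"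
    using cA by (auto simp: condA_def)
  then obtain \<theta> where \<theta>: "\<And>n. \<theta>0 < \<theta> n" "\<And>n. \<theta> n < \<theta>0 + pi * \<gamma>" "\<And>n. t n = complex_of_real (norm (t n)) * cis (\<theta> n)"
    by metis
  define \<alpha> where "\<alpha> = pi * \<gamma> / 2"
  have \<alpha>: "0 < \<alpha>" "\<alpha> < pi / 2" using \<gamma> by (auto simp: \<alpha>_def)
  have "\<exists>K. 0 < K \<and> summable (\<lambda>n. norm (t n) powr - K) \<and> K < 1 / \<gamma>"
  proof -
    define X where "X = {K. K > 0 \<and> summable (\<lambda>n. norm (t n) powr - K)}"
    have "X \<noteq> {}" using adm by (auto simp: X_def admissible_set_def)
    moreover have "Inf X < 1 / \<gamma>" using cA by (simp add: condA_def conv_exponent_def X_def)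
    ultimately obtain K where "K \<in> X" "K < 1 / \<gamma>" using cInf_lessD by blast
    thus ?thesis by (auto simp: X_def)
  qed
  then obtain K where K: "0 < K" "summable (\<lambda>n. norm (t n) powr - K)" "K < 1 / \<gamma>" by blast
  obtain \<tau> \<kappa> where \<tau>: "0 < \<tau>" "\<tau> \<le> K" and \<kappa>: "\<kappa> > 0" and Agr: "\<And>z. norm (A z) \<le> exp (\<kappa> * norm z powr \<tau>)"
    using canonical_product_growth[OF adm can K(1,2)] by metis
  obtain a where a: "A a \<noteq> 0" by (rule exists_off_node)
  have "\<exists>C'. \<forall>z. norm (f z) \<le> C' * exp (6 * 4 powr \<tau> * (2 powr \<tau> * \<kappa> + 1) * norm z powr \<tau>)"
    by (rule comparison_growth[OF A_entire A_node a F G b f eq \<tau>(1), of \<kappa> 1 1]) (use \<kappa> Agr in auto)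
  then obtain C0 where C0: "\<And>z. norm (f z) \<le> C0 * exp (6 * 4 powr \<tau> * (2 powr \<tau> * \<kappa> + 1) * norm z powr \<tau>)" by blast
  show ?thesis
  proof (rule comparison_zero_type_sector[where \<omega> = "cis (\<theta>0 + \<alpha>)" and \<phi> = "\<lambda>n. \<theta> n - (\<theta>0 + \<alpha>)",
      OF \<alpha>(1) _ _ _ \<tau>(1) _ \<alpha>(2) F G b f eq C0])
    show "t n = of_real (norm (t n)) * (cis (\<theta>0 + \<alpha>) * cis (\<theta> n - (\<theta>0 + \<alpha>)))" for n
      using \<theta>(3)[of n] by (simp add: cis_mult)
    show "\<bar>\<theta> n - (\<theta>0 + \<alpha>)\<bar> < \<alpha>" for n using \<theta>(1,2)[of n] by (auto simp: \<alpha>_def abs_if)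
    have "K * \<gamma> < 1" using K(3) \<gamma>(1) by (simp add: pos_less_divide_eq)
    moreover have "\<tau> * \<gamma> \<le> K * \<gamma>" using \<tau>(2) \<gamma>(1) by (intro mult_right_mono) auto
    ultimately have "\<tau> * \<gamma> < 1" by linarith
    hence "pi / 2 * (\<tau> * \<gamma>) < pi / 2 * 1" by (intro mult_strict_left_mono) auto
    thus "\<tau> * \<alpha> < pi / 2" by (simp add: \<alpha>_def mult_ac)
  qed simp
qed

end

section \<open>Ordering of nearly invariant subspaces\<close>

lemma countable_zeros_entire:
  assumes "f holomorphic_on UNIV" "f a \<noteq> 0"
  shows "countable {z. f z = 0}"
proof (cases "f constant_on UNIV")
  case True
  hence "{z. f z = 0} = {}" using assms(2) by (auto simp: constant_on_def)
  thus ?thesis by simp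
next
  case False
  from holomorphic_countable_zeros[OF assms(1) open_UNIV connected_UNIV fsigma_UNIV False] show ?thesis by simp
qed

lemma entire_zero_if_small_on_circles:
  assumes f: "f holomorphic_on UNIV"
    and small: "\<And>\<epsilon> T. \<epsilon> > 0 \<Longrightarrow> \<exists>r\<ge>T. \<forall>w. norm w = r \<longrightarrow> norm (f w) \<le> \<epsilon>"
  shows "f z = 0"
proof -
  have "norm (f z) \<le> 0 + \<epsilon>" if \<epsilon>: "\<epsilon> > 0" for \<epsilon>
  proof -
    obtain r where r: "r \<ge> norm z + 1" "\<And>w. norm w = r \<Longrightarrow> norm (f w) \<le> \<epsilon>" using small[OF \<epsilon>] by blast
    have r0: "r > 0" by (rule less_le_trans[OF _ r(1)]) (simp add: add_nonneg_pos)
    have "norm (f z) \<le> \<epsilon>"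
    proof (rule maximum_modulus_frontier[of f "ball 0 r"])
      show "f holomorphic_on interior (ball 0 r)" "continuous_on (closure (ball 0 r)) f"
        using f by (auto intro!: holomorphic_on_imp_continuous_on intro: holomorphic_on_subset)
      show "norm (f w) \<le> \<epsilon>" if "w \<in> frontier (ball 0 r)" for w using that r0 r(2) by simp
    qed (use r in auto)
    thus ?thesis by simp
  qed
  hence "norm (f z) \<le> 0" by (rule field_le_epsilon)
  thus ?thesis by simp
qed

context nodes_exp
begin

definition ctrans :: "(nat \<Rightarrow> complex) \<Rightarrow> complex \<Rightarrow> complex" where
  "ctrans u w = (\<Sum>n. u n / (w - t n))"

lemma off_exc_not_node:
  assumes "ln (norm w) \<notin> exc" shows "w \<notin> range t"
proof
  assume "w \<in> range t"
  then obtain n where n: "w = t n" by auto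
  have "ln (norm w) \<in> {lt n - gap n<..<lt n + gap n}" using gap_pos[of n] by (simp add: n lt_def)
  thus False using assms unfolding exc_def by blast
qed

text \<open>\<open>B\<close> and \<open>m\<close> do not depend on \<open>u\<close>, so one bound
  serves all four transforms of the comparison.\<close>

lemma ctrans_poly:
  obtains B m where "B > 0" "\<And>u w. summable (\<lambda>n. norm (u n)) \<Longrightarrow> norm w \<ge> 1 \<Longrightarrow> ln (norm w) \<notin> exc \<Longrightarrow>
     norm (ctrans u w) \<le> (\<Sum>n. norm (u n)) * (B * norm w ^ m)"
proof -
  obtain B m where B: "B > 0" "\<And>w n. norm w \<ge> 1 \<Longrightarrow> ln (norm w) \<notin> exc \<Longrightarrow> 1 \<le> norm (w - t n) * (B * norm w ^ m)"
    using off_exc_poly by metis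
  have "norm (ctrans u w) \<le> (\<Sum>n. norm (u n)) * (B * norm w ^ m)"
    if u: "summable (\<lambda>n. norm (u n))" and w: "norm w \<ge> 1" "ln (norm w) \<notin> exc" for u w
  proof -
    have le: "norm (u n / (w - t n)) \<le> norm (u n) * (B * norm w ^ m)" for n
    proof -
      have "w - t n \<noteq> 0" using off_exc_not_node[OF w(2)] by auto
      hence "1 / norm (w - t n) \<le> B * norm w ^ m" using B(2)[OF w, of n] by (simp add: pos_divide_le_eq mult.commute)
      from mult_left_mono[OF this norm_ge_zero[of "u n"]] show ?thesis by (simp add: norm_divide)
    qed
    have s: "summable (\<lambda>n. norm (u n / (w - t n)))"
      by (rule summable_comparison_test'[OF summable_mult2[OF u]]) (use le in auto)
    have "norm (ctrans u w) \<le> (\<Sum>n. norm (u n / (w - t n)))" unfolding ctrans_def by (rule summable_norm[OF s])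
    also have "\<dots> \<le> (\<Sum>n. norm (u n) * (B * norm w ^ m))" by (rule suminf_le[OF le s summable_mult2[OF u]])
    also have "\<dots> = (\<Sum>n. norm (u n)) * (B * norm w ^ m)" by (rule suminf_mult2[symmetric, OF u])
    finally show ?thesis .
  qed
  thus ?thesis using that B(1) by blast
qed

text \<open>\<open>w / (w - t n) = 1 + t n / (w - t n)\<close>; the error series is the one that
  \<open>good_radius\<close> makes small.\<close>

lemma ctrans_asymptotics:
  assumes w: "w \<notin> range t" and u: "summable (\<lambda>n. norm (u n))" and le: "\<And>n. norm (u n) \<le> \<eta> n"
    and s: "summable (\<lambda>n. \<eta> n * (norm (t n) / norm (w - t n)))" "(\<Sum>n. \<eta> n * (norm (t n) / norm (w - t n))) \<le> \<epsilon>"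
  shows "norm (w * ctrans u w - (\<Sum>n. u n)) \<le> \<epsilon>"
proof -
  have le': "norm (u n * (t n / (w - t n))) \<le> \<eta> n * (norm (t n) / norm (w - t n))" for n
    using mult_right_mono[OF le[of n], of "norm (t n) / norm (w - t n)"] by (simp add: norm_mult norm_divide)
  have sn: "summable (\<lambda>n. norm (u n * (t n / (w - t n))))"
    by (rule summable_comparison_test'[OF s(1)]) (use le' in auto)
  have su: "summable u" by (rule summable_norm_cancel[OF u])
  have eq: "w * (u n / (w - t n)) = u n + u n * (t n / (w - t n))" for n
  proof -
    have "w - t n \<noteq> 0" using w by auto
    thus ?thesis by (simp add: field_simps)
  qed
  have "w * ctrans u w = (\<Sum>n. u n) + (\<Sum>n. u n * (t n / (w - t n)))"
  proof (cases "w = 0")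
    case True
    have "u n + u n * (t n / (w - t n)) = 0" for n using eq[of n] True by simp
    hence "(\<lambda>n. u n + u n * (t n / (w - t n))) sums 0" by simp
    moreover have "(\<lambda>n. u n + u n * (t n / (w - t n))) sums ((\<Sum>n. u n) + (\<Sum>n. u n * (t n / (w - t n))))"
      by (intro sums_add summable_sums su summable_norm_cancel[OF sn])
    ultimately show ?thesis using True sums_unique2 by fastforce
  next
    case False
    have "(\<lambda>n. w * (u n / (w - t n))) sums ((\<Sum>n. u n) + (\<Sum>n. u n * (t n / (w - t n))))"
      unfolding eq by (intro sums_add summable_sums su summable_norm_cancel[OF sn])
    hence *: "(\<lambda>n. inverse w * (w * (u n / (w - t n)))) sums (inverse w * ((\<Sum>n. u n) + (\<Sum>n. u n * (t n / (w - t n)))))"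
      by (rule sums_mult)
    have "(\<lambda>n. u n / (w - t n)) sums (inverse w * ((\<Sum>n. u n) + (\<Sum>n. u n * (t n / (w - t n)))))"
      using * False by (simp add: mult.assoc[symmetric])
    thus ?thesis unfolding ctrans_def using False by (simp add: sums_iff)
  qed
  hence "norm (w * ctrans u w - (\<Sum>n. u n)) = norm (\<Sum>n. u n * (t n / (w - t n)))" by simp
  also have "\<dots> \<le> (\<Sum>n. norm (u n * (t n / (w - t n))))" by (rule summable_norm[OF sn])
  also have "\<dots> \<le> (\<Sum>n. \<eta> n * (norm (t n) / norm (w - t n)))" by (rule suminf_le[OF le' sn s(1)])
  finally show ?thesis using s(2) by simp
qed

end

locale cdb_exp = cdb t A \<mu> + nodes_exp t K for t A \<mu> K
begin

lemma pairing_ctrans: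
  assumes "f \<in> cdb_space t A \<mu>" "l2seq b" "w \<notin> range t"
  shows "pairing f b w = A w * ctrans (\<lambda>n. coef f n * b n) w"
  unfolding pairing_def ctrans_def
  by (rule csum_off_nodes[OF A_entire A_node assms(3) l1_summable[OF pairing_summable[OF assms(1,2)]]])

context
  fixes F G b c
  assumes F: "F \<in> cdb_space t A \<mu>" "\<exists>x. F x \<noteq> 0" and G: "G \<in> cdb_space t A \<mu>" "\<exists>x. G x \<noteq> 0"
    and b: "l2seq b" and c: "l2seq c"
begin

text \<open>Bundled because all four transforms and the zeros of \<open>F\<close> and
  \<open>G\<close> have to be controlled on the same circle.\<close>

definition regular_at :: "real \<Rightarrow> complex \<Rightarrow> bool" where
  "regular_at \<epsilon> w \<longleftrightarrow> A w \<noteq> 0 \<and> F w \<noteq> 0 \<and> G w \<noteq> 0 \<and>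
      norm (w * ctrans (\<lambda>n. coef F n * b n) w - (\<Sum>n. coef F n * b n)) \<le> \<epsilon> \<and>
      norm (w * ctrans (\<lambda>n. coef G n * b n) w - (\<Sum>n. coef G n * b n)) \<le> \<epsilon> \<and>
      norm (w * ctrans (\<lambda>n. coef F n * c n) w - (\<Sum>n. coef F n * c n)) \<le> \<epsilon> \<and>
      norm (w * ctrans (\<lambda>n. coef G n * c n) w - (\<Sum>n. coef G n * c n)) \<le> \<epsilon> \<and>
      pairing F b w = A w * ctrans (\<lambda>n. coef F n * b n) w \<and> pairing G b w = A w * ctrans (\<lambda>n. coef G n * b n) w \<and>
      pairing F c w = A w * ctrans (\<lambda>n. coef F n * c n) w \<and> pairing G c w = A w * ctrans (\<lambda>n. coef G n * c n) w"

text \<open>The sum of the four moduli is one summable majorant for all numerators, so a single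
  application of \<open>good_radius\<close> provides a common circle.\<close>

lemma good_circle:
  assumes "\<epsilon> > 0"
  shows "\<exists>r\<ge>T. r \<ge> 1 \<and> (\<forall>w. norm w = r \<longrightarrow> regular_at \<epsilon> w)"
proof -
  define C where "C = (\<lambda>w. ln (norm w)) ` ({w. F w = 0} \<union> {w. G w = 0})"
  have C: "countable C" unfolding C_def
    using F(2) G(2) countable_zeros_entire[OF space_entire[OF F(1)]] countable_zeros_entire[OF space_entire[OF G(1)]]
    by (intro countable_image countable_Un) auto
  note ps = pairing_summable[OF F(1) b] pairing_summable[OF G(1) b] pairing_summable[OF F(1) c] pairing_summable[OF G(1) c]
  define \<eta> where "\<eta> n = norm (coef F n * b n) + norm (coef G n * b n) + norm (coef F n * c n) + norm (coef G n * c n)" for n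
  have \<eta>: "\<eta> n \<ge> 0" "summable \<eta>" for n unfolding \<eta>_def[abs_def] by (auto intro!: summable_add ps add_nonneg_nonneg)
  have le: "norm (coef F n * b n) \<le> \<eta> n" "norm (coef G n * b n) \<le> \<eta> n" "norm (coef F n * c n) \<le> \<eta> n" "norm (coef G n * c n) \<le> \<eta> n" for n
    unfolding \<eta>_def by (auto intro: add_increasing add_increasing2 add_nonneg_nonneg)
  have "\<exists>s\<ge>max 0 (ln (max T 1)). s \<notin> exc \<union> C \<and> (\<forall>w. norm w = exp s \<longrightarrow>
      summable (\<lambda>n. \<eta> n * (norm (t n) / norm (w - t n))) \<and> (\<Sum>n. \<eta> n * (norm (t n) / norm (w - t n))) \<le> \<epsilon>)"
    by (rule good_radius[OF \<eta> C assms])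
  then obtain s where s: "s \<ge> max 0 (ln (max T 1))" "s \<notin> exc \<union> C" and
    ss': "\<forall>w. norm w = exp s \<longrightarrow> summable (\<lambda>n. \<eta> n * (norm (t n) / norm (w - t n))) \<and>
      (\<Sum>n. \<eta> n * (norm (t n) / norm (w - t n))) \<le> \<epsilon>"
    by (elim exE conjE)
  note ss = ss'[rule_format]
  have "max T 1 = exp (ln (max T 1))" by simp
  also have "\<dots> \<le> exp s" unfolding exp_le_cancel_iff by (rule order_trans[OF max.cobounded2 s(1)])
  finally have r: "exp s \<ge> T" "exp s \<ge> 1" by (simp_all only: max.bounded_iff)
  have "regular_at \<epsilon> w" if w: "norm w = exp s" for w
  proof -
    have lnw: "ln (norm w) = s" by (simp add: w)
    have nt: "w \<notin> range t" using off_exc_not_node s(2) lnw by blast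
    have FG: "F w \<noteq> 0" "G w \<noteq> 0" using s(2) lnw unfolding C_def by blast+
    have Aw: "A w \<noteq> 0" using nt A_zero by blast
    show ?thesis unfolding regular_at_def
      by (intro conjI Aw FG pairing_ctrans F G b c nt ctrans_asymptotics[OF nt _ _ conjunct1[OF ss[OF w]] conjunct2[OF ss[OF w]]] ps le)
  qed
  thus ?thesis using r by blast
qed

lemma comparison_contradiction:
  assumes Fb: "(\<Sum>n. coef F n * b n) = 0" and Gb: "(\<Sum>n. coef G n * b n) \<noteq> 0"
    and Fc: "(\<Sum>n. coef F n * c n) \<noteq> 0" and Gc: "(\<Sum>n. coef G n * c n) = 0"
    and f1: "\<And>w. F w * pairing G b w = G w * pairing F b w"
    and f2: "f2 holomorphic_on UNIV" "\<And>w. f2 w * G w * A w = G w * pairing F c w - F w * pairing G c w"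
  shows False
proof -
  define d1 where "d1 = norm (\<Sum>n. coef G n * b n)"
  define d where "d = (\<Sum>n. coef F n * c n)"
  have d1: "d1 > 0" and d: "norm d > 0" using Gb Fc by (auto simp: d1_def d_def)
  \<comment> \<open>The bound \<open>d1 / 2\<close> keeps \<open>norm (w * Yb)\<close> at least
    \<open>\<epsilon>\<close>, and \<open>norm d / 4\<close> makes the two errors in
    \<open>w * f2 w\<close> add up to at most \<open>norm d / 2\<close>.\<close>
  define \<epsilon> where "\<epsilon> = min (d1 / 2) (norm d / 4)"
  have \<epsilon>: "\<epsilon> > 0" "\<epsilon> \<le> d1 / 2" "\<epsilon> \<le> norm d / 4" using d1 d by (auto simp: \<epsilon>_def)
  have circ: "\<exists>r\<ge>T. r \<ge> 1 \<and> (\<forall>w. norm w = r \<longrightarrow> norm (w * f2 w - d) \<le> norm d / 2)" for T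
  proof -
    obtain r where r: "r \<ge> T" "r \<ge> 1" and g: "\<And>w. norm w = r \<Longrightarrow> regular_at \<epsilon> w"
      using good_circle[OF \<epsilon>(1)] by blast
    have "norm (w * f2 w - d) \<le> norm d / 2" if w: "norm w = r" for w
    proof -
      define Xb where "Xb = ctrans (\<lambda>n. coef F n * b n) w"
      define Yb where "Yb = ctrans (\<lambda>n. coef G n * b n) w"
      define Xc where "Xc = ctrans (\<lambda>n. coef F n * c n) w"
      define Yc where "Yc = ctrans (\<lambda>n. coef G n * c n) w"
      have nz: "A w \<noteq> 0" "F w \<noteq> 0" "G w \<noteq> 0" and e: "norm (w * Xb) \<le> \<epsilon>" "norm (w * Yb - (\<Sum>n. coef G n * b n)) \<le> \<epsilon>"
        "norm (w * Xc - d) \<le> \<epsilon>" "norm (w * Yc) \<le> \<epsilon>"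
        and pe: "pairing F b w = A w * Xb" "pairing G b w = A w * Yb" "pairing F c w = A w * Xc" "pairing G c w = A w * Yc"
        using g[OF w] unfolding regular_at_def Xb_def Yb_def Xc_def Yc_def d_def Fb Gc by simp_all
      have "A w * (F w * Yb) = A w * (G w * Xb)" using f1[of w] unfolding pe by (simp add: mult_ac)
      hence FG: "F w * Yb = G w * Xb" using nz by simp
      have "d1 - \<epsilon> \<le> norm (w * Yb)" using e(2) norm_triangle_ineq2[of "\<Sum>n. coef G n * b n" "w * Yb"]
        by (simp add: d1_def norm_minus_commute)
      hence Yb: "norm (w * Yb) \<ge> \<epsilon>" using \<epsilon> by simp
      have "norm (F w) * norm (w * Yb) = norm (G w) * norm (w * Xb)"
        using arg_cong[OF FG, of "\<lambda>z. norm (w * z)"] by (simp add: norm_mult mult_ac)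
      also have "\<dots> \<le> norm (G w) * \<epsilon>" using e(1) by (intro mult_left_mono) auto
      finally have "norm (F w) * \<epsilon> \<le> norm (G w) * \<epsilon>" using mult_left_mono[OF Yb norm_ge_zero[of "F w"]] by linarith
      \<comment> \<open>The first comparison function being zero means
        \<open>F / G = Xb / Yb\<close>; here
        \<open>norm (w * Xb) \<le> \<epsilon> \<le> norm (w * Yb)\<close>.\<close>
      hence le: "norm (F w / G w) \<le> 1" using \<epsilon>(1) nz by (simp add: norm_divide)
      have "f2 w * G w * A w = (G w * Xc - F w * Yc) * A w" using f2(2)[of w] unfolding pe by (simp add: algebra_simps)
      hence "f2 w * G w = G w * Xc - F w * Yc" using nz by simp
      hence f2w: "f2 w = Xc - F w / G w * Yc" using nz by (simp add: field_simps)
      have "w * f2 w - d = (w * Xc - d) - (F w / G w) * (w * Yc)" unfolding f2w by (simp add: algebra_simps)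
      also have "norm \<dots> \<le> \<epsilon> + 1 * \<epsilon>"
        by (rule order_trans[OF norm_triangle_ineq4], unfold norm_mult[of "F w / G w"], intro add_mono mult_mono e le) auto
      finally show ?thesis using \<epsilon>(3) by simp
    qed
    thus ?thesis using r by blast
  qed
  \<comment> \<open>On these circles \<open>norm (w * f2 w)\<close> is at most
    \<open>2 norm d\<close>, so \<open>f2\<close> tends to 0 there and vanishes, whereas
    \<open>w * f2 w\<close> has to stay close to \<open>d\<close>.\<close>
  have f20: "f2 z = 0" for z
  proof (rule entire_zero_if_small_on_circles[OF f2(1)])
    fix e T :: real assume e: "e > 0"
    obtain r where r: "r \<ge> max T (2 * norm d / e)" "r \<ge> 1" "\<And>w. norm w = r \<Longrightarrow> norm (w * f2 w - d) \<le> norm d / 2"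
      using circ by blast
    have "norm (f2 w) \<le> e" if w: "norm w = r" for w
    proof -
      have "norm w * norm (f2 w) \<le> norm (w * f2 w - d) + norm d"
        using norm_triangle_ineq[of "w * f2 w - d" d] by (simp add: norm_mult)
      also have "\<dots> \<le> 2 * norm d" using r(3)[OF w] norm_ge_zero[of d] by linarith
      also have "\<dots> \<le> r * e" using r(1) e by (simp add: field_simps)
      finally show ?thesis using r(2) w by simp
    qed
    thus "\<exists>r\<ge>T. \<forall>w. norm w = r \<longrightarrow> norm (f2 w) \<le> e" using r(1) by auto
  qed
  obtain r where r: "r \<ge> 1" "\<And>w. norm w = r \<Longrightarrow> norm (w * f2 w - d) \<le> norm d / 2" using circ[of 0] by blast
  have "norm (of_real r * f2 (of_real r) - d) \<le> norm d / 2" using r by (intro r(2)) simp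
  thus False using d by (simp add: f20)
qed

text \<open>\<open>two_tract_polynomial\<close> makes one function zero or bounded away from 0 near
  infinity. In the second case the circles on which one of the two is O(1/r) must single out the
  other function, which is then zero.\<close>

lemma comparison_one_zero:
  assumes f1: "f1 holomorphic_on UNIV" "zero_exp_type f1" "\<And>w. f1 w * F w * A w = F w * pairing G b w - G w * pairing F b w"
    and f2: "f2 holomorphic_on UNIV" "zero_exp_type f2" "\<And>w. f2 w * G w * A w = G w * pairing F c w - F w * pairing G c w"
  shows "(\<forall>z. f1 z = 0) \<or> (\<forall>z. f2 z = 0)"
proof -
  \<comment> \<open>Whichever of \<open>F\<close>, \<open>G\<close> has the larger modulus at
    \<open>w\<close> serves as denominator, so the other quotient is at most 1.\<close>
  have formula: "norm (f1 w) \<le> norm (Yb) + norm Xb \<or> norm (f2 w) \<le> norm Xc + norm Yc"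
    if nz: "A w \<noteq> 0" "F w \<noteq> 0" "G w \<noteq> 0"
      and pe: "pairing F b w = A w * Xb" "pairing G b w = A w * Yb" "pairing F c w = A w * Xc" "pairing G c w = A w * Yc" for w Xb Yb Xc Yc
  proof (cases "norm (G w) \<le> norm (F w)")
    case True
    have "f1 w * F w * A w = (F w * Yb - G w * Xb) * A w" using f1(3)[of w] unfolding pe by (simp add: algebra_simps)
    hence "f1 w * F w = F w * Yb - G w * Xb" using nz by simp
    hence "f1 w = Yb - G w / F w * Xb" using nz by (simp add: field_simps)
    also have "norm \<dots> \<le> norm Yb + norm (G w / F w * Xb)" by (rule norm_triangle_ineq4)
    also have "norm (G w / F w * Xb) = norm (G w / F w) * norm Xb" by (rule norm_mult)
    also have "\<dots> \<le> 1 * norm Xb" by (intro mult_right_mono) (use nz True in \<open>simp_all add: norm_divide\<close>)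
    finally show ?thesis by simp
  next
    case False
    have "f2 w * G w * A w = (G w * Xc - F w * Yc) * A w" using f2(3)[of w] unfolding pe by (simp add: algebra_simps)
    hence "f2 w * G w = G w * Xc - F w * Yc" using nz by simp
    hence "f2 w = Xc - F w / G w * Yc" using nz by (simp add: field_simps)
    also have "norm \<dots> \<le> norm Xc + norm (F w / G w * Yc)" by (rule norm_triangle_ineq4)
    also have "norm (F w / G w * Yc) = norm (F w / G w) * norm Yc" by (rule norm_mult)
    also have "\<dots> \<le> 1 * norm Yc" by (intro mult_right_mono) (use nz False in \<open>simp_all add: norm_divide\<close>)
    finally show ?thesis by simp
  qed
  \<comment> \<open>With tolerance 1, each transform on a good circle is at most its total sum in
    modulus plus 1, over \<open>r\<close>; each comparison function involves two of them.\<close>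
  define S where "S = norm (\<Sum>n. coef F n * b n) + norm (\<Sum>n. coef G n * b n) + norm (\<Sum>n. coef F n * c n) + norm (\<Sum>n. coef G n * c n) + 2"
  have S: "S \<ge> 2" unfolding S_def by simp
  have circ: "\<exists>r\<ge>T. r \<ge> 1 \<and> (\<forall>w. norm w = r \<longrightarrow> norm (f1 w) \<le> S / r \<or> norm (f2 w) \<le> S / r)" for T
  proof -
    obtain r where r: "r \<ge> T" "r \<ge> 1" and g: "\<And>w. norm w = r \<Longrightarrow> regular_at 1 w"
      using good_circle[OF zero_less_one] by blast
    have "norm (f1 w) \<le> S / r \<or> norm (f2 w) \<le> S / r" if w: "norm w = r" for w
    proof -
      have bd: "norm x \<le> (norm d + 1) / r" if "norm (w * x - d) \<le> 1" for x d
      proof -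
        have "norm w * norm x \<le> norm (w * x - d) + norm d" using norm_triangle_ineq[of "w * x - d" d] by (simp add: norm_mult)
        thus ?thesis using that r(2) w by (simp add: field_simps)
      qed
      have "norm (f1 w) \<le> (norm (\<Sum>n. coef G n * b n) + 1) / r + (norm (\<Sum>n. coef F n * b n) + 1) / r \<or>
        norm (f2 w) \<le> (norm (\<Sum>n. coef F n * c n) + 1) / r + (norm (\<Sum>n. coef G n * c n) + 1) / r"
        using formula[of w "ctrans (\<lambda>n. coef F n * b n) w" "ctrans (\<lambda>n. coef G n * b n) w" "ctrans (\<lambda>n. coef F n * c n) w" "ctrans (\<lambda>n. coef G n * c n) w"]
          g[OF w, unfolded regular_at_def] bd by (smt (verit))
      moreover have "(norm (\<Sum>n. coef G n * b n) + 1) / r + (norm (\<Sum>n. coef F n * b n) + 1) / r \<le> S / r"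
        "(norm (\<Sum>n. coef F n * c n) + 1) / r + (norm (\<Sum>n. coef G n * c n) + 1) / r \<le> S / r"
        unfolding add_divide_distrib[symmetric] using r(2) by (auto intro!: divide_right_mono simp: S_def)
      ultimately show ?thesis by linarith
    qed
    thus ?thesis using r by blast
  qed
  \<comment> \<open>Once \<open>S / r\<close> is below the lower bound \<open>k\<close> of
    \<open>h1\<close>, the disjunction leaves only \<open>h2\<close>.\<close>
  have zero: "\<forall>z. h2 z = 0" if large: "\<not> (\<forall>z. h1 z = 0)" "zero_or_large h1" and h2: "h2 holomorphic_on UNIV"
    and circ: "\<And>T. \<exists>r\<ge>T. r \<ge> 1 \<and> (\<forall>w. norm w = r \<longrightarrow> norm (h1 w) \<le> S / r \<or> norm (h2 w) \<le> S / r)" for h1 h2 :: "complex \<Rightarrow> complex"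
  proof -
    obtain k R where k: "k > 0" "\<And>z. norm z \<ge> R \<Longrightarrow> norm (h1 z) \<ge> k" using large by (auto simp: zero_or_large_def)
    have "h2 z = 0" for z
    proof (rule entire_zero_if_small_on_circles[OF h2])
      fix e T :: real assume e: "e > 0"
      obtain r where r: "r \<ge> max (max T R) (max (S / e) (2 * S / k))" "r \<ge> 1" "\<And>w. norm w = r \<Longrightarrow> norm (h1 w) \<le> S / r \<or> norm (h2 w) \<le> S / r"
        using circ by blast
      have r0: "r > 0" using r(2) by linarith
      have "S / e \<le> r" "2 * S / k \<le> r" using r(1) by auto
      hence 1: "S / r \<le> e" "S / r < k" using r0 e k(1) S by (auto simp: field_simps)
      have "norm (h2 w) \<le> e" if w: "norm w = r" for w using r(3)[OF w] k(2)[of w] r(1) w 1 by auto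
      thus "\<exists>r\<ge>T. \<forall>w. norm w = r \<longrightarrow> norm (h2 w) \<le> e" using r(1) by auto
    qed
    thus ?thesis by blast
  qed
  have "zero_or_large f1 \<or> zero_or_large f2"
  proof -
    obtain B m where B: "B > 0" "\<And>u w. summable (\<lambda>n. norm (u n)) \<Longrightarrow> norm w \<ge> 1 \<Longrightarrow> ln (norm w) \<notin> exc \<Longrightarrow>
       norm (ctrans u w) \<le> (\<Sum>n. norm (u n)) * (B * norm w ^ m)" using ctrans_poly by metis
    note ps = pairing_summable[OF F(1) b] pairing_summable[OF G(1) b] pairing_summable[OF F(1) c] pairing_summable[OF G(1) c]
    define C where "C = (\<lambda>w. ln (norm w)) ` ({w. F w = 0} \<union> {w. G w = 0})"
    have C: "countable C" unfolding C_def
      using F(2) G(2) countable_zeros_entire[OF space_entire[OF F(1)]] countable_zeros_entire[OF space_entire[OF G(1)]]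
      by (intro countable_image countable_Un) auto
    define N where "N = (\<Sum>n. norm (coef F n * b n)) + (\<Sum>n. norm (coef G n * b n)) + (\<Sum>n. norm (coef F n * c n)) + (\<Sum>n. norm (coef G n * c n))"
    have nn: "0 \<le> (\<Sum>n. norm (coef F n * b n))" "0 \<le> (\<Sum>n. norm (coef G n * b n))" "0 \<le> (\<Sum>n. norm (coef F n * c n))" "0 \<le> (\<Sum>n. norm (coef G n * c n))"
      using ps by (auto intro!: suminf_nonneg)
    show ?thesis
    proof (rule two_tract_polynomial[OF f1(1,2) f2(1,2) exc_Un_countable(1)[OF C], of "N * B" m])
      fix w :: complex assume w: "norm w \<ge> 1" "ln (norm w) \<notin> exc \<union> C"
      have wE: "ln (norm w) \<notin> exc" using w by simp
      have nt: "w \<notin> range t" by (rule off_exc_not_node[OF wE])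
      have FG: "F w \<noteq> 0" "G w \<noteq> 0" using w(2) unfolding C_def by blast+
      have Aw: "A w \<noteq> 0" using nt A_zero by blast
      define q where "q = B * norm w ^ m"
      have q: "q \<ge> 0" using B(1) by (simp add: q_def)
      note cb = B(2)[OF ps(1) w(1) wE, folded q_def] B(2)[OF ps(2) w(1) wE, folded q_def] B(2)[OF ps(3) w(1) wE, folded q_def] B(2)[OF ps(4) w(1) wE, folded q_def]
      have "norm (f1 w) \<le> N * q \<or> norm (f2 w) \<le> N * q"
        using formula[OF Aw FG pairing_ctrans[OF F(1) b nt] pairing_ctrans[OF G(1) b nt] pairing_ctrans[OF F(1) c nt] pairing_ctrans[OF G(1) c nt]]
          cb nn[THEN mult_nonneg_nonneg[OF _ q]] unfolding N_def distrib_right by linarith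
      thus "norm (f1 w) \<le> N * B * norm w ^ m \<or> norm (f2 w) \<le> N * B * norm w ^ m" by (simp add: q_def mult.assoc)
    qed
  qed
  moreover have "\<And>T. \<exists>r\<ge>T. r \<ge> 1 \<and> (\<forall>w. norm w = r \<longrightarrow> norm (f2 w) \<le> S / r \<or> norm (f1 w) \<le> S / r)"
    using circ by blast
  ultimately show ?thesis using zero[OF _ _ f2(1) circ] zero[OF _ _ f1(1)] by blast
qed

end

text \<open>The hypothesis \<open>ztype\<close> isolates the role of the two geometric conditions:
  everything else is common to both. It is applied to both comparison functions by exchanging the
  roles of \<open>F\<close> and \<open>G\<close>.\<close>

theorem ordering:
  assumes ztype: "\<And>F G b f x. F \<in> cdb_space t A \<mu> \<Longrightarrow> F x \<noteq> 0 \<Longrightarrow> G \<in> cdb_space t A \<mu> \<Longrightarrow> l2seq b \<Longrightarrow> f holomorphic_on UNIV \<Longrightarrow>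
      (\<And>w. f w * F w * A w = F w * pairing G b w - G w * pairing F b w) \<Longrightarrow> zero_exp_type f"
    and H1: "nearly_invariant t A \<mu> H1" "no_common_zeros H1" and H2: "nearly_invariant t A \<mu> H2" "no_common_zeros H2"
  shows "H1 \<subseteq> H2 \<or> H2 \<subseteq> H1"
proof (rule ccontr)
  assume "\<not> ?thesis"
  then obtain F G where FG: "F \<in> H1" "F \<notin> H2" "G \<in> H2" "G \<notin> H1" by blast
  have cl: "cdb_closed_subspace t A \<mu> H1" "cdb_closed_subspace t A \<mu> H2" using H1 H2 by (auto simp: nearly_invariant_def)
  have sp: "F \<in> cdb_space t A \<mu>" "G \<in> cdb_space t A \<mu>" using cl FG by (auto simp: cdb_closed_subspace_def)
  have z: "(\<lambda>z. 0) \<in> H1" "(\<lambda>z. 0) \<in> H2" using cl by (auto simp: cdb_closed_subspace_def)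
  have F0: "\<exists>x. F x \<noteq> 0"
  proof (rule ccontr)
    assume "\<not> ?thesis"
    hence "F = (\<lambda>z. 0)" by auto
    thus False using z FG by simp
  qed
  have G0: "\<exists>x. G x \<noteq> 0"
  proof (rule ccontr)
    assume "\<not> ?thesis"
    hence "G = (\<lambda>z. 0)" by auto
    thus False using z FG by simp
  qed
  obtain b where b: "perp H1 b" "(\<Sum>n. coef G n * b n) \<noteq> 0" using separation[OF cl(1) sp(2) FG(4)] by blast
  obtain c where c: "perp H2 c" "(\<Sum>n. coef F n * c n) \<noteq> 0" using separation[OF cl(2) sp(1) FG(2)] by blast
  have l2: "l2seq b" "l2seq c" and Fb: "(\<Sum>n. coef F n * b n) = 0" and Gc: "(\<Sum>n. coef G n * c n) = 0"
    using b c FG by (auto simp: perp_def)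
  obtain f1 where f1: "f1 holomorphic_on UNIV" "\<And>F w. F \<in> H1 \<Longrightarrow> f1 w * F w * A w = F w * pairing G b w - G w * pairing F b w"
    using comparison_function[OF H1(1) b(1) H1(2) sp(2)] by blast
  obtain f2 where f2: "f2 holomorphic_on UNIV" "\<And>G w. G \<in> H2 \<Longrightarrow> f2 w * G w * A w = G w * pairing F c w - F w * pairing G c w"
    using comparison_function[OF H2(1) c(1) H2(2) sp(1)] by blast
  have z1: "zero_exp_type f1" using F0 ztype[OF sp(1) _ sp(2) l2(1) f1(1) f1(2)[OF FG(1)]] by blast
  have z2: "zero_exp_type f2" using G0 ztype[OF sp(2) _ sp(1) l2(2) f2(1) f2(2)[OF FG(3)]] by blast
  from comparison_one_zero[OF sp(1) F0 sp(2) G0 l2 f1(1) z1 f1(2)[OF FG(1)] f2(1) z2 f2(2)[OF FG(3)]]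
  show False
  proof
    assume "\<forall>z. f1 z = 0"
    hence "F w * pairing G b w = G w * pairing F b w" for w using f1(2)[OF FG(1), of w] by simp
    from comparison_contradiction[OF sp(1) F0 sp(2) G0 l2 Fb b(2) c(2) Gc this f2(1) f2(2)[OF FG(3)]] show False .
  next
    assume "\<forall>z. f2 z = 0"
    hence "G w * pairing F c w = F w * pairing G c w" for w using f2(2)[OF FG(3), of w] by simp
    from comparison_contradiction[OF sp(2) G0 sp(1) F0 l2(2,1) Gc c(2) b(2) Fb this f1(1) f1(2)[OF FG(1)]] show False .
  qed
qed

end

theorem theorem1p3:
  fixes t :: "nat \<Rightarrow> complex" and A :: "complex \<Rightarrow> complex" and \<mu> :: "nat \<Rightarrow> real"
    and H1 H2 :: "(complex \<Rightarrow> complex) set"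
  assumes T: "admissible_set t"
    and cond: "condZ t \<or> (\<exists>\<gamma>. 0 < \<gamma> \<and> \<gamma> < 1 \<and> condA \<gamma> t)"
    and Acan: "canonical_product t A"
    and mu_pos: "\<forall>n. \<mu> n > 0"
    and mu_sum: "summable (\<lambda>n. \<mu> n / ((norm (t n))\<^sup>2 + 1))"
    and H1: "nearly_invariant t A \<mu> H1" and H1z: "no_common_zeros H1"
    and H2: "nearly_invariant t A \<mu> H2" and H2z: "no_common_zeros H2"
  shows "H1 \<subseteq> H2 \<or> H2 \<subseteq> H1"
proof -
  \<comment> \<open>Any exponent of convergence serves here; it fixes the widths of the excluded
    intervals of radii.\<close>
  obtain K where K: "K > 0" "summable (\<lambda>n. norm (t n) powr (- K))" using T by (auto simp: admissible_set_def)
  note cp = canonical_product_props[OF T Acan]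
  interpret cdb_exp t A \<mu> K
    by unfold_locales (use T K cp mu_pos mu_sum in \<open>auto simp: admissible_set_def\<close>)
  show ?thesis
  proof (rule ordering[OF _ H1 H1z H2 H2z])
    fix F G b f x
    assume a: "F \<in> cdb_space t A \<mu>" "F x \<noteq> 0" "G \<in> cdb_space t A \<mu>" "l2seq b" "f holomorphic_on UNIV"
      "\<And>w. f w * F w * A w = F w * pairing G b w - G w * pairing F b w"
    from cond show "zero_exp_type f"
    proof
      assume "condZ t"
      thus ?thesis by (rule comparison_zero_type_condZ[OF _ a])
    next
      assume "\<exists>\<gamma>. 0 < \<gamma> \<and> \<gamma> < 1 \<and> condA \<gamma> t"
      then obtain \<gamma> where "condA \<gamma> t" by blast
      thus ?thesis by (rule comparison_zero_type_condA[OF T _ Acan a])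
    qed
  qed
qed

end
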